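(* For each real $x>0$ let $(a_{n,x})_{n\geq 1}$ be a sequence of complex numbers, and suppose that $$\limsup_{x\to\infty} \frac{1}{x}\sum_{n<x}|a_{n,x}|^2<\infty.$$ For a positive integer $n$ and real $z>0$ let $L(n,z)=\sum_{d\mid n,\ d<z}\lambda(d)$, where $\lambda$ is the Liouville function. If the limits $$\ell(z):=\lim_{x\to\infty}\frac{1}{x}\sum_{n<x} a_{n,x}\, L(n,z)$$ exist for all $z$, then $\ell(z)\to 0$ as $z\to\infty$.
   Context: The Liouville function $\lambda$ is the completely multiplicative function with $\lambda(p)=-1$ for every prime $p$; equivalently $\lambda(n)=(-1)^{\Omega(n)}$, where $\Omega(n)$ is the number of prime factors of $n$ counted with multiplicity. Sums over $d\mid n$ range over positive divisors $d$ of $n$. *)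

theory Defs
  imports Complex_Main "HOL-Library.Liminf_Limsup" "HOL-Library.Extended_Real"
    "HOL-Computational_Algebra.Primes"
begin

definition bigomega :: "nat \<Rightarrow> nat" where
  "bigomega n = size (prime_factorization n)"

text \<open>The value at \<open>0\<close> is a junk value; \<open>liouville\<close> is only used at positive arguments.\<close>

definition liouville :: "nat \<Rightarrow> int" where
  "liouville n = (-1) ^ bigomega n"

definition liouville_divisor_sum :: "nat \<Rightarrow> real \<Rightarrow> int" where
  "liouville_divisor_sum n z = (\<Sum>d | d dvd n \<and> real d < z. liouville d)"

end

theory Submission
  imports Defs "HOL-Probability.Probability" "HOL-Number_Theory.Totient" "HOL-Real_Asymp.Real_Asymp"
begin

text \<open>
  Write \<open>M(u) = \<Sum>\<^bsub>d < u\<^esub> \<lambda>(d)/d\<close>. The mean of \<open>L(n,z) L(n,w)\<close> over \<open>n\<close> is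
  \<open>P(z,w) = \<Sum>\<^bsub>k\<^esub> \<phi>(k)/k\<^sup>2 M(z/k) M(w/k)\<close>. If \<open>P(z,z)\<close> is bounded and \<open>P(z,w) \<longlonglongrightarrow> 0\<close> for fixed \<open>w\<close>,
  then \<open>\<bar>\<ell>(z)\<bar> \<ge> \<epsilon>\<close> for arbitrarily large \<open>z\<close> is impossible: choose \<open>J\<close> such \<open>z\<close> that are almost
  orthogonal for \<open>P\<close> and apply Cauchy-Schwarz to the unimodular combination of the \<open>L(n,z)\<close> that
  aligns the \<open>\<ell>(z)\<close>; this gives \<open>(J \<epsilon>)\<^sup>2 = O(J)\<close>.

  As \<open>M\<close> varies slowly, both properties of \<open>P\<close> follow from \<open>\<integral> M(e\<^sup>x)\<^sup>2 dx < \<infinity>\<close> over \<open>x \<ge> 0\<close>. The Laplace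
  transform of \<open>M(e\<^sup>x)\<close> is \<open>\<zeta>(2 + 2s) / (s \<zeta>(1 + s))\<close>, so by Plancherel it is enough to bound this in
  mean square on the lines \<open>Re s = \<sigma>\<close>, uniformly in small \<open>\<sigma> > 0\<close>. That needs only a lower bound
  \<open>\<bar>\<zeta>(1 + \<sigma> + it)\<bar> \<ge> c \<bar>t\<bar>\<^bsup>-a\<^esup>\<close> with \<open>a < 1/2\<close>, which the quantitative form of the classical 3-4-1 argument
  provides without leaving the half-plane of absolute convergence.
\<close>

section \<open>Means of truncated divisor sums\<close>

text \<open>All work stays in Re s > 1, so no estimate may degenerate as \<sigma> tends to 0. The
  3-4-1 inequality alone gives only |zeta(1 + \<delta> + it)|^4 >= c \<delta>^3 / W with W =
  \<open>zeta_majorant t\<close>. The remedy is a Lipschitz bound in the real part with constant W: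
  3-4-1 is used down to a distance \<delta> of order W^(-5), and closer points lose at most half of
  the bound reached there, which has order W^(-4). With W of order |t|^(1/16) this is |t|^(-1/4), so
  the Plancherel integrand decays like |t|^(-3/2); there is room for a small power of |t| in place
  of log^2 |t|. Near t = 0 the pole of zeta compensates the factor 1/s. Neither infinite Euler
  products nor the exact identity with zeta(2s)/zeta(s) is established: inequalities between moduli
  suffice, and these are proved one prime at a time on sums over integers without small prime
  factors. Convergence of the integral of M^2 is enough because M(u) moves little when u grows by a
  factor close to 1: a large value of M persists on an interval of fixed logarithmic length.\<close>

definition posnats_below :: "real \<Rightarrow> nat set" where
  "posnats_below z = {d. 1 \<le> d \<and> real d < z}"

text \<open>This is M(z) of the overview; the argument is real because the quotients z / k
  occur.\<close>

definition liouville_log_sum :: "real \<Rightarrow> real" where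
  "liouville_log_sum z = (\<Sum>d\<in>posnats_below z. liouville d / d)"

text \<open>The P(z,w) of the overview before its diagonalisation: the integers divisible by both
  \<open>d\<close> and \<open>e\<close> have density \<open>1 / lcm d e\<close>.\<close>

definition liouville_gram :: "real \<Rightarrow> real \<Rightarrow> real" where
  "liouville_gram z w =
     (\<Sum>d\<in>posnats_below z. \<Sum>e\<in>posnats_below w. liouville d * liouville e / lcm d e)"

lemma finite_posnats_below [simp, intro]: "finite (posnats_below z)"
proof (rule finite_subset)
  show "posnats_below z \<subseteq> {..nat \<lceil>z\<rceil>}"
    unfolding posnats_below_def by (auto simp: le_nat_iff) linarith
qed auto

lemma posnats_below_pos: "d \<in> posnats_below z \<Longrightarrow> d > 0"
  by (auto simp: posnats_below_def)

lemma abs_liouville [simp]: "\<bar>liouville n\<bar> = 1"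
  by (simp add: liouville_def power_abs)

lemma abs_real_liouville [simp]: "\<bar>real_of_int (liouville n)\<bar> = 1"
  by (metis abs_liouville of_int_1 of_int_abs)

lemma liouville_mult: "m > 0 \<Longrightarrow> n > 0 \<Longrightarrow> liouville (m * n) = liouville m * liouville n"
  by (simp add: liouville_def Defs.bigomega_def prime_factorization_mult power_add)

lemma liouville_one [simp]: "liouville 1 = 1" "liouville (Suc 0) = 1"
  by (simp_all add: liouville_def Defs.bigomega_def)

lemma liouville_prime: "prime p \<Longrightarrow> liouville p = -1"
  by (simp add: liouville_def Defs.bigomega_def prime_factorization_prime)

lemma liouville_gram_commute: "liouville_gram z w = liouville_gram w z"
  unfolding liouville_gram_def by (subst sum.swap) (simp add: lcm.commute mult.commute)

text \<open>Complete multiplicativity splits \<open>k\<close> off from every multiple of it, without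
  any coprimality condition.\<close>

lemma sum_multiples_liouville:
  assumes "k > 0"
  shows "(\<Sum>d | d \<in> posnats_below z \<and> k dvd d. real_of_int (liouville d) / d) =
    liouville k / k * liouville_log_sum (z / k)"
proof -
  have "(\<Sum>d | d \<in> posnats_below z \<and> k dvd d. real_of_int (liouville d) / d) =
     (\<Sum>d\<in>posnats_below (z/k). real_of_int (liouville (k * d)) / (k * d))"
  proof (rule sum.reindex_bij_witness[of _ "\<lambda>d. k * d" "\<lambda>d. d div k"])
  qed (use assms in \<open>auto simp: posnats_below_def field_simps dvd_def\<close>)
  also have "\<dots> = (\<Sum>d\<in>posnats_below (z/k). liouville k / k * (liouville d / d))"
    using assms by (intro sum.cong) (auto simp: liouville_mult posnats_below_pos)
  finally show ?thesis
    by (simp add: liouville_log_sum_def sum_distrib_left)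
qed

text \<open>Since 1/lcm(d,e) = gcd(d,e)/(d e) and gcd(d,e) is the sum of \<open>totient k\<close>
  over its divisors k, the variables d and e separate for each k. The square of
  \<open>liouville k\<close> that arises is 1. Indices k >= z do no harm: there
  \<open>liouville_log_sum (z / k)\<close> is an empty sum.\<close>

lemma liouville_gram_eq:
  "liouville_gram z w = (\<Sum>k\<in>posnats_below w. totient k / k\<^sup>2 *
     (liouville_log_sum (z / k) * liouville_log_sum (w / k)))"
proof -
  have lcm: "1 / real (lcm d e) =
      (\<Sum>k\<in>posnats_below w. if k dvd d \<and> k dvd e then totient k / (d * e) else 0)"
    if "d \<in> posnats_below z" "e \<in> posnats_below w" for d e
  proof -
    have pos: "d > 0" "e > 0" using that by (auto simp: posnats_below_def)
    have "real (lcm d e) * real (gcd d e) = real d * real e"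
      by (metis of_nat_mult prod_gcd_lcm_nat mult.commute)
    hence "1 / real (lcm d e) = real (gcd d e) / (d * e)"
      using pos by (simp add: field_simps)
    also have "real (gcd d e) = (\<Sum>k | k dvd gcd d e. real (totient k))"
      by (metis of_nat_sum totient_divisor_sum)
    also have "{k. k dvd gcd d e} = {k \<in> posnats_below w. k dvd d \<and> k dvd e}"
    proof (intro set_eqI iffI)
      fix k assume "k \<in> {k. k dvd gcd d e}"
      hence dvd: "k dvd d" "k dvd e" by auto
      moreover have "k \<le> e" using dvd_imp_le[OF dvd(2) pos(2)] .
      moreover have "1 \<le> k" using dvd_pos_nat[OF pos(2) dvd(2)] by simp
      ultimately show "k \<in> {k \<in> posnats_below w. k dvd d \<and> k dvd e}"
        using that(2) unfolding posnats_below_def by auto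
    qed auto
    also have "(\<Sum>k | k \<in> posnats_below w \<and> k dvd d \<and> k dvd e. real (totient k)) / (d * e) =
        (\<Sum>k | k \<in> posnats_below w \<and> k dvd d \<and> k dvd e. totient k / (d * e))"
      by (rule sum_divide_distrib)
    also have "\<dots> = (\<Sum>k\<in>posnats_below w. if k dvd d \<and> k dvd e then totient k / (d * e) else 0)"
      by (rule sum.inter_filter) simp
    finally show ?thesis by (simp only: of_nat_mult)
  qed
  have "liouville_gram z w = (\<Sum>d\<in>posnats_below z. \<Sum>e\<in>posnats_below w. \<Sum>k\<in>posnats_below w.
       if k dvd d \<and> k dvd e then liouville d / d * (liouville e / e) * totient k else 0)"
    unfolding liouville_gram_def
  proof (intro sum.cong refl)
    fix d e assume "d \<in> posnats_below z" "e \<in> posnats_below w"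
    note lcm = lcm[OF this]
    have "real_of_int (liouville d * liouville e) / real (lcm d e) =
      real_of_int (liouville d * liouville e) * (1 / real (lcm d e))" by simp
    also have "\<dots> = real_of_int (liouville d * liouville e) *
      (\<Sum>k\<in>posnats_below w. if k dvd d \<and> k dvd e then totient k / (d * e) else 0)"
      by (simp only: lcm of_nat_mult)
    also have "\<dots> = (\<Sum>k\<in>posnats_below w.
       if k dvd d \<and> k dvd e then liouville d / d * (liouville e / e) * totient k else 0)"
      unfolding sum_distrib_left by (rule sum.cong[OF refl]) simp
    finally show "real_of_int (liouville d * liouville e) / real (lcm d e) = \<dots>" .
  qed
  also have "\<dots> = (\<Sum>d\<in>posnats_below z. \<Sum>k\<in>posnats_below w. \<Sum>e\<in>posnats_below w.
       if k dvd d \<and> k dvd e then liouville d / d * (liouville e / e) * totient k else 0)"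
    by (intro sum.cong refl sum.swap)
  also have "\<dots> = (\<Sum>k\<in>posnats_below w. \<Sum>d\<in>posnats_below z. \<Sum>e\<in>posnats_below w.
       if k dvd d \<and> k dvd e then liouville d / d * (liouville e / e) * totient k else 0)"
    by (rule sum.swap)
  also have "\<dots> = (\<Sum>k\<in>posnats_below w. totient k *
     ((\<Sum>d | d \<in> posnats_below z \<and> k dvd d. liouville d / d) *
      (\<Sum>e | e \<in> posnats_below w \<and> k dvd e. liouville e / e)))"
    unfolding sum.inter_filter[OF finite_posnats_below]
    unfolding sum_product
    unfolding sum_distrib_left
    by (intro sum.cong refl) simp
  also have "\<dots> = (\<Sum>k\<in>posnats_below w. totient k / k\<^sup>2 *
     (liouville_log_sum (z / k) * liouville_log_sum (w / k)))"
  proof (intro sum.cong refl)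
    fix k assume "k \<in> posnats_below w"
    hence k: "k > 0" by (rule posnats_below_pos)
    have "real_of_int (liouville k) * liouville k = 1"
      by (metis abs_liouville abs_mult_self_eq of_int_1 of_int_mult mult_1)
    thus "totient k * ((\<Sum>d | d \<in> posnats_below z \<and> k dvd d. liouville d / d) *
      (\<Sum>e | e \<in> posnats_below w \<and> k dvd e. liouville e / e)) = totient k / k\<^sup>2 *
     (liouville_log_sum (z / k) * liouville_log_sum (w / k))"
      unfolding sum_multiples_liouville[OF k] using k
      by (simp add: power2_eq_square field_simps)
  qed
  finally show ?thesis .
qed

lemma mean_multiples:
  assumes "m > 0"
  shows "((\<lambda>x. (1 / x) * card {n \<in> posnats_below x. m dvd n}) \<longlongrightarrow> 1 / real m) at_top"
proof -
  have bounds: "x / m - 1 \<le> card {n \<in> posnats_below x. m dvd n} \<and>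
        card {n \<in> posnats_below x. m dvd n} \<le> x / m" if "x \<ge> 1" for x :: real
  proof -
    have "card {n \<in> posnats_below x. m dvd n} = card (posnats_below (x / m))"
    proof -
      have "{n \<in> posnats_below x. m dvd n} = (\<lambda>d. m * d) ` posnats_below (x / m)"
      proof (intro set_eqI iffI)
        fix n assume n: "n \<in> {n \<in> posnats_below x. m dvd n}"
        then obtain d where d: "n = m * d" by auto
        with n assms have "d \<in> posnats_below (x / m)"
          by (simp add: posnats_below_def less_divide_eq mult.commute Suc_le_eq)
        with d show "n \<in> (\<lambda>d. m * d) ` posnats_below (x / m)" by blast
      next
        fix n assume "n \<in> (\<lambda>d. m * d) ` posnats_below (x / m)"
        then obtain d where "d \<in> posnats_below (x / m)" "n = m * d" by auto
        with assms show "n \<in> {n \<in> posnats_below x. m dvd n}"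
          by (simp add: posnats_below_def less_divide_eq mult.commute Suc_le_eq)
      qed
      moreover have "inj_on (\<lambda>d. m * d) (posnats_below (x / m))"
        using assms by (auto simp: inj_on_def)
      ultimately show ?thesis by (simp add: card_image)
    qed
    \<comment> \<open>The inequality d < x / m is strict, so an integral endpoint is excluded:
      ceiling minus one instead of floor.\<close>
    also have "posnats_below (x / m) = {1..nat (\<lceil>x / m\<rceil> - 1)}"
    proof -
      have "real d < x / m \<longleftrightarrow> d \<le> nat (\<lceil>x / m\<rceil> - 1)" if "1 \<le> d" for d
        using that by (auto simp: nat_le_iff le_nat_iff) linarith+
      thus ?thesis by (auto simp: posnats_below_def)
    qed
    also have "card \<dots> = nat (\<lceil>x / m\<rceil> - 1)" by simp
    also have "real \<dots> = of_int (\<lceil>x / m\<rceil> - 1)"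
    proof -
      have "0 < x / m" using that assms by simp
      hence "1 \<le> \<lceil>x / m\<rceil>" by linarith
      thus ?thesis by simp
    qed
    finally show ?thesis by linarith
  qed
  show ?thesis
  proof (rule tendsto_sandwich)
    show "\<forall>\<^sub>F x in at_top. 1 / real m - 1 / x \<le> (1 / x) * card {n \<in> posnats_below x. m dvd n}"
      using eventually_ge_at_top[of 1]
    proof eventually_elim
      case (elim x)
      have "(1/x) * (x / m - 1) \<le> (1 / x) * card {n \<in> posnats_below x. m dvd n}"
        using bounds[OF elim] elim by (intro mult_left_mono) auto
      thus ?case using elim by (simp add: field_simps)
    qed
    show "\<forall>\<^sub>F x in at_top. (1 / x) * card {n \<in> posnats_below x. m dvd n} \<le> 1 / real m"
      using eventually_ge_at_top[of 1]
    proof eventually_elim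
      case (elim x)
      have "(1/x) * (x / m) \<ge> (1 / x) * card {n \<in> posnats_below x. m dvd n}"
        using bounds[OF elim] elim by (intro mult_left_mono) auto
      thus ?case using elim by (simp add: field_simps)
    qed
    have "((\<lambda>x::real. 1 / real m - 1 / x) \<longlongrightarrow> 1 / real m - 0) at_top"
      by (intro tendsto_intros tendsto_divide_0[OF tendsto_const]) (simp add: filterlim_at_top_imp_at_infinity filterlim_ident)
    thus "((\<lambda>x::real. 1 / real m - 1 / x) \<longlongrightarrow> 1 / real m) at_top" by simp
  qed auto
qed

lemma liouville_divisor_sum_eq:
  assumes "n > 0"
  shows "liouville_divisor_sum n z = (\<Sum>d\<in>posnats_below z. if d dvd n then liouville d else 0)"
proof -
  have "{d. d dvd n \<and> real d < z} = {d \<in> posnats_below z. d dvd n}"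
    using assms by (auto simp: posnats_below_def Suc_le_eq intro: Nat.gr0I)
  thus ?thesis by (simp add: liouville_divisor_sum_def sum.inter_filter)
qed

lemma mean_liouville_divisor_sum_mult:
  "((\<lambda>x. (1 / x) * (\<Sum>n\<in>posnats_below x.
      real_of_int (liouville_divisor_sum n z * liouville_divisor_sum n w)))
    \<longlongrightarrow> liouville_gram z w) at_top"
proof -
  have eq: "(1 / x) * (\<Sum>n\<in>posnats_below x.
      real_of_int (liouville_divisor_sum n z * liouville_divisor_sum n w)) =
     (\<Sum>d\<in>posnats_below z. \<Sum>e\<in>posnats_below w. liouville d * liouville e *
        ((1 / x) * card {n \<in> posnats_below x. lcm d e dvd n}))" for x
  proof -
    have "(\<Sum>n\<in>posnats_below x.
      real_of_int (liouville_divisor_sum n z * liouville_divisor_sum n w)) =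
      (\<Sum>n\<in>posnats_below x. \<Sum>d\<in>posnats_below z. \<Sum>e\<in>posnats_below w.
        real_of_int (liouville d * liouville e) * (if lcm d e dvd n then 1 else 0))"
      by (intro sum.cong)
        (auto simp: liouville_divisor_sum_eq posnats_below_pos sum_product intro!: sum.cong)
    also have "\<dots> = (\<Sum>d\<in>posnats_below z. \<Sum>n\<in>posnats_below x. \<Sum>e\<in>posnats_below w.
        real_of_int (liouville d * liouville e) * (if lcm d e dvd n then 1 else 0))"
      by (rule sum.swap)
    also have "\<dots> = (\<Sum>d\<in>posnats_below z. \<Sum>e\<in>posnats_below w. \<Sum>n\<in>posnats_below x.
        real_of_int (liouville d * liouville e) * (if lcm d e dvd n then 1 else 0))"
      by (intro sum.cong refl sum.swap)
    also have "\<dots> = (\<Sum>d\<in>posnats_below z. \<Sum>e\<in>posnats_below w.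
        real_of_int (liouville d * liouville e) * card {n \<in> posnats_below x. lcm d e dvd n})"
      by (intro sum.cong refl) (simp flip: sum_distrib_left sum.inter_filter)
    finally show ?thesis by (simp add: sum_distrib_left mult_ac)
  qed
  show ?thesis unfolding eq liouville_gram_def
  proof (intro tendsto_sum)
    fix d e assume "d \<in> posnats_below z" "e \<in> posnats_below w"
    hence "lcm d e > 0" by (simp add: posnats_below_pos lcm_pos_nat)
    from tendsto_mult[OF tendsto_const mean_multiples[OF this], of "real_of_int (liouville d * liouville e)"]
    show "((\<lambda>x. real_of_int (liouville d * liouville e) *
         (1 / x * card {n \<in> posnats_below x. lcm d e dvd n})) \<longlongrightarrow>
         real_of_int (liouville d * liouville e) / real (lcm d e)) at_top"
      by simp
  qed
qed

section \<open>From bounds on the Gram form to the limits\<close>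

lemma Cauchy_Schwarz_sum_complex:
  fixes f g :: "'a \<Rightarrow> complex"
  shows "(cmod (\<Sum>i\<in>S. f i * g i))\<^sup>2 \<le> (\<Sum>i\<in>S. (cmod (f i))\<^sup>2) * (\<Sum>i\<in>S. (cmod (g i))\<^sup>2)"
proof -
  have "cmod (\<Sum>i\<in>S. f i * g i) \<le> (\<Sum>i\<in>S. cmod (f i) * cmod (g i))"
    by (metis (no_types, lifting) norm_mult norm_sum sum.cong)
  hence "(cmod (\<Sum>i\<in>S. f i * g i))\<^sup>2 \<le> (\<Sum>i\<in>S. cmod (f i) * cmod (g i))\<^sup>2"
    by (intro power_mono) auto
  also have "\<dots> \<le> (\<Sum>i\<in>S. (cmod (f i))\<^sup>2) * (\<Sum>i\<in>S. (cmod (g i))\<^sup>2)"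
    by (rule Cauchy_Schwarz_ineq_sum)
  finally show ?thesis .
qed

text \<open>Duality: the sum of the |l z| is the limiting mean of \<open>a\<close> against a single
  combination V of the divisor sums. Cauchy-Schwarz splits off the mean square of V, which converges
  to a quadratic form in \<open>liouville_gram\<close> with coefficients of modulus at most
  1.\<close>

lemma sum_limits_bound:
  fixes a :: "real \<Rightarrow> nat \<Rightarrow> complex" and l :: "real \<Rightarrow> complex"
  assumes bdd: "\<forall>\<^sub>F x in at_top. (1 / x) * (\<Sum>n\<in>posnats_below x. (cmod (a x n))\<^sup>2) \<le> A"
    and lim: "\<And>z. z \<in> Z \<Longrightarrow> ((\<lambda>x. complex_of_real (1 / x) *
          (\<Sum>n\<in>posnats_below x. a x n * of_int (liouville_divisor_sum n z))) \<longlongrightarrow> l z) at_top"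
    and Z: "finite Z"
  shows "(\<Sum>z\<in>Z. cmod (l z))\<^sup>2 \<le> A * (\<Sum>z\<in>Z. \<Sum>w\<in>Z. \<bar>liouville_gram z w\<bar>)"
proof -
  \<comment> \<open>Rotates \<open>l z\<close> onto its modulus. As \<open>sgn 0 = 0\<close>, the
    modulus of \<open>\<theta> z\<close> may be 0, so only the upper bound 1 is recorded.\<close>
  define \<theta> where "\<theta> z = cnj (sgn (l z))" for z
  define V where "V n = (\<Sum>z\<in>Z. \<theta> z * of_int (liouville_divisor_sum n z))" for n
  have \<theta>: "\<theta> z * l z = cmod (l z)" "cmod (\<theta> z) \<le> 1" for z
  proof -
    have "cnj (l z) * l z = of_real (cmod (l z)) * of_real (cmod (l z))"
      using complex_norm_square[of "l z"] by (simp add: power2_eq_square mult.commute[of "cnj _"])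
    thus "\<theta> z * l z = cmod (l z)"
      by (cases "l z = 0") (simp_all add: \<theta>_def sgn_eq)
  qed (simp add: \<theta>_def norm_sgn)
  have "((\<lambda>x. \<Sum>z\<in>Z. \<theta> z * (complex_of_real (1 / x) *
          (\<Sum>n\<in>posnats_below x. a x n * of_int (liouville_divisor_sum n z))))
        \<longlongrightarrow> (\<Sum>z\<in>Z. \<theta> z * l z)) at_top"
    by (intro tendsto_intros lim)
  moreover have "(\<Sum>z\<in>Z. \<theta> z * (complex_of_real (1 / x) *
          (\<Sum>n\<in>posnats_below x. a x n * of_int (liouville_divisor_sum n z)))) =
        of_real (1/x) * (\<Sum>n\<in>posnats_below x. a x n * V n)" for x
  proof -
    have "(\<Sum>n\<in>posnats_below x. a x n * V n) = (\<Sum>z\<in>Z. \<Sum>n\<in>posnats_below x.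
        a x n * (\<theta> z * of_int (liouville_divisor_sum n z)))"
      unfolding V_def sum_distrib_left by (rule sum.swap)
    thus ?thesis by (simp add: sum_distrib_left mult_ac)
  qed
  ultimately have "((\<lambda>x. of_real (1/x) * (\<Sum>n\<in>posnats_below x. a x n * V n))
       \<longlongrightarrow> (\<Sum>z\<in>Z. cmod (l z))) at_top"
    by (simp add: \<theta>)
  from tendsto_power[OF tendsto_norm[OF this], of 2]
  have limL: "((\<lambda>x. (cmod (of_real (1/x) * (\<Sum>n\<in>posnats_below x. a x n * V n)))\<^sup>2)
       \<longlongrightarrow> (\<Sum>z\<in>Z. cmod (l z))\<^sup>2) at_top"
    by (simp del: of_real_divide of_real_sum flip: of_real_power)
  \<comment> \<open>|V n|^2 is real and so are the divisor sums; only the real parts of the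
    coefficients survive.\<close>
  define c where "c z w = Re (\<theta> z * cnj (\<theta> w))" for z w
  have V: "(cmod (V n))\<^sup>2 = (\<Sum>z\<in>Z. \<Sum>w\<in>Z. c z w *
      real_of_int (liouville_divisor_sum n z * liouville_divisor_sum n w))" for n
  proof -
    have "(cmod (V n))\<^sup>2 = Re (V n * cnj (V n))"
      unfolding complex_norm_square[of "V n", symmetric] by (rule Re_complex_of_real[symmetric])
    also have "\<dots> = Re (\<Sum>z\<in>Z. \<Sum>w\<in>Z. (\<theta> z * cnj (\<theta> w)) *
      of_real (real_of_int (liouville_divisor_sum n z * liouville_divisor_sum n w)))"
      unfolding V_def by (simp add: sum_product mult_ac)
    finally show ?thesis unfolding Re_sum c_def by simp
  qed
  have "((\<lambda>x. \<Sum>z\<in>Z. \<Sum>w\<in>Z. c z w * ((1 / x) * (\<Sum>n\<in>posnats_below x.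
      real_of_int (liouville_divisor_sum n z * liouville_divisor_sum n w)))) \<longlongrightarrow>
      (\<Sum>z\<in>Z. \<Sum>w\<in>Z. c z w * liouville_gram z w)) at_top"
    by (intro tendsto_intros mean_liouville_divisor_sum_mult)
  moreover have "(\<Sum>z\<in>Z. \<Sum>w\<in>Z. c z w * ((1 / x) * (\<Sum>n\<in>posnats_below x.
      real_of_int (liouville_divisor_sum n z * liouville_divisor_sum n w)))) =
      (1 / x) * (\<Sum>n\<in>posnats_below x. (cmod (V n))\<^sup>2)" for x
  proof -
    have "(\<Sum>n\<in>posnats_below x. (cmod (V n))\<^sup>2) = (\<Sum>z\<in>Z. \<Sum>n\<in>posnats_below x. \<Sum>w\<in>Z. c z w *
      real_of_int (liouville_divisor_sum n z * liouville_divisor_sum n w))"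
      unfolding V by (rule sum.swap)
    also have "\<dots> = (\<Sum>z\<in>Z. \<Sum>w\<in>Z. \<Sum>n\<in>posnats_below x. c z w *
      real_of_int (liouville_divisor_sum n z * liouville_divisor_sum n w))"
      by (intro sum.cong refl sum.swap)
    finally show ?thesis by (simp add: sum_distrib_left mult_ac)
  qed
  ultimately have "((\<lambda>x. (1 / x) * (\<Sum>n\<in>posnats_below x. (cmod (V n))\<^sup>2)) \<longlongrightarrow>
      (\<Sum>z\<in>Z. \<Sum>w\<in>Z. c z w * liouville_gram z w)) at_top"
    by simp
  hence limR: "((\<lambda>x. A * ((1 / x) * (\<Sum>n\<in>posnats_below x. (cmod (V n))\<^sup>2))) \<longlongrightarrow>
      A * (\<Sum>z\<in>Z. \<Sum>w\<in>Z. c z w * liouville_gram z w)) at_top"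
    by (intro tendsto_intros)
  have ev: "\<forall>\<^sub>F x in at_top. (cmod (of_real (1/x) * (\<Sum>n\<in>posnats_below x. a x n * V n)))\<^sup>2 \<le>
      A * ((1 / x) * (\<Sum>n\<in>posnats_below x. (cmod (V n))\<^sup>2))"
    using bdd eventually_gt_at_top[of 0]
  proof eventually_elim
    case (elim x)
    have "(cmod (of_real (1/x) * (\<Sum>n\<in>posnats_below x. a x n * V n)))\<^sup>2 =
        (1/x)\<^sup>2 * (cmod (\<Sum>n\<in>posnats_below x. a x n * V n))\<^sup>2"
      by (simp add: norm_mult norm_divide power_mult_distrib power_divide)
    also have "\<dots> \<le> (1/x)\<^sup>2 * ((\<Sum>n\<in>posnats_below x. (cmod (a x n))\<^sup>2) *
        (\<Sum>n\<in>posnats_below x. (cmod (V n))\<^sup>2))"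
      by (intro mult_left_mono Cauchy_Schwarz_sum_complex) auto
    also have "\<dots> = ((1/x) * (\<Sum>n\<in>posnats_below x. (cmod (a x n))\<^sup>2)) *
        ((1/x) * (\<Sum>n\<in>posnats_below x. (cmod (V n))\<^sup>2))"
      by (simp add: power2_eq_square)
    also have "\<dots> \<le> A * ((1 / x) * (\<Sum>n\<in>posnats_below x. (cmod (V n))\<^sup>2))"
      using elim by (intro mult_right_mono mult_nonneg_nonneg sum_nonneg) auto
    finally show ?case .
  qed
  have "0 \<le> A"
  proof -
    obtain x where x: "(1 / x) * (\<Sum>n\<in>posnats_below x. (cmod (a x n))\<^sup>2) \<le> A" "x > 0"
      using eventually_happens'[OF _ eventually_conj[OF bdd eventually_gt_at_top[of 0]]] by auto
    have "0 \<le> (1 / x) * (\<Sum>n\<in>posnats_below x. (cmod (a x n))\<^sup>2)"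
      using x by (intro mult_nonneg_nonneg sum_nonneg) auto
    with x show ?thesis by linarith
  qed
  have "(\<Sum>z\<in>Z. cmod (l z))\<^sup>2 \<le> A * (\<Sum>z\<in>Z. \<Sum>w\<in>Z. c z w * liouville_gram z w)"
    by (rule tendsto_le[OF _ limR limL ev]) simp
  also have "\<dots> \<le> A * (\<Sum>z\<in>Z. \<Sum>w\<in>Z. \<bar>liouville_gram z w\<bar>)"
  proof (intro mult_left_mono sum_mono \<open>0 \<le> A\<close>)
    fix z w
    have "\<bar>c z w\<bar> \<le> cmod (\<theta> z) * cmod (\<theta> w)"
      unfolding c_def by (metis abs_Re_le_cmod complex_mod_cnj norm_mult)
    also have "\<dots> \<le> 1" using \<theta>(2) by (intro mult_le_one) auto
    finally have "\<bar>c z w\<bar> * \<bar>liouville_gram z w\<bar> \<le> 1 * \<bar>liouville_gram z w\<bar>"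
      by (intro mult_right_mono) auto
    thus "c z w * liouville_gram z w \<le> \<bar>liouville_gram z w\<bar>"
      by (metis abs_ge_self abs_mult mult_1 order.trans)
  qed
  finally show ?thesis .
qed

text \<open>Greedy choice: with finitely many points fixed, every sufficiently large z is almost
  orthogonal to all of them, and P holds for arbitrarily large z. Taking z beyond the earlier points
  makes it new, so the cardinality really grows.\<close>

lemma almost_orthogonal_subset:
  fixes G :: "real \<Rightarrow> real \<Rightarrow> real"
  assumes G: "\<And>w. ((\<lambda>z. G z w) \<longlongrightarrow> 0) at_top" and sym: "\<And>z w. G z w = G w z"
    and freq: "\<exists>\<^sub>F z in at_top. P z" and "\<eta> > 0"
  shows "\<exists>Z. finite Z \<and> card Z = J \<and> (\<forall>z\<in>Z. P z) \<and> (\<forall>z\<in>Z. \<forall>w\<in>Z. z \<noteq> w \<longrightarrow> \<bar>G z w\<bar> \<le> \<eta>)"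
proof (induction J)
  case 0
  show ?case by (rule exI[of _ "{}"]) auto
next
  case (Suc J)
  then obtain Z where Z: "finite Z" "card Z = J" "\<forall>z\<in>Z. P z"
    "\<forall>z\<in>Z. \<forall>w\<in>Z. z \<noteq> w \<longrightarrow> \<bar>G z w\<bar> \<le> \<eta>" by blast
  have "\<forall>\<^sub>F z in at_top. \<bar>G z w\<bar> \<le> \<eta> \<and> w < z" for w
  proof (rule eventually_conj)
    have "\<forall>\<^sub>F z in at_top. dist (G z w) 0 < \<eta>"
      using G \<open>\<eta> > 0\<close> by (rule tendstoD)
    thus "\<forall>\<^sub>F z in at_top. \<bar>G z w\<bar> \<le> \<eta>" by eventually_elim simp
  qed (rule eventually_gt_at_top)
  hence "\<forall>\<^sub>F z in at_top. \<forall>w\<in>Z. \<bar>G z w\<bar> \<le> \<eta> \<and> w < z"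
    using Z(1) by (intro eventually_ball_finite) auto
  hence "\<exists>\<^sub>F z in at_top. P z \<and> (\<forall>w\<in>Z. \<bar>G z w\<bar> \<le> \<eta> \<and> w < z)"
    by (intro frequently_rev_mp[OF freq]) (auto elim: eventually_mono)
  then obtain z where z: "P z" "\<forall>w\<in>Z. \<bar>G z w\<bar> \<le> \<eta> \<and> w < z"
    by (auto dest!: frequently_ex)
  show ?case
  proof (intro exI[of _ "insert z Z"] conjI)
    show "card (insert z Z) = Suc J"
      using z Z by auto
    show "\<forall>x\<in>insert z Z. \<forall>w\<in>insert z Z. x \<noteq> w \<longrightarrow> \<bar>G x w\<bar> \<le> \<eta>"
      using z Z sym by (metis insert_iff)
  qed (use z Z in auto)
qed

lemma limits_tendsto_0:
  fixes a :: "real \<Rightarrow> nat \<Rightarrow> complex" and l :: "real \<Rightarrow> complex"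
  assumes bdd: "\<forall>\<^sub>F x in at_top. (1 / x) * (\<Sum>n\<in>posnats_below x. (cmod (a x n))\<^sup>2) \<le> A"
    and lim: "\<And>z. z > 0 \<Longrightarrow> ((\<lambda>x. complex_of_real (1 / x) *
          (\<Sum>n\<in>posnats_below x. a x n * of_int (liouville_divisor_sum n z))) \<longlongrightarrow> l z) at_top"
    and diag: "\<And>z. liouville_gram z z \<le> B"
    and weak: "\<And>w. ((\<lambda>z. liouville_gram z w) \<longlongrightarrow> 0) at_top"
  shows "(l \<longlongrightarrow> 0) at_top"
proof (rule ccontr)
  assume "\<not> (l \<longlongrightarrow> 0) at_top"
  then obtain \<epsilon> where "\<epsilon> > 0" and "\<not> (\<forall>\<^sub>F z in at_top. dist (l z) 0 < \<epsilon>)"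
    by (auto simp: tendsto_iff)
  hence "\<exists>\<^sub>F z in at_top. cmod (l z) \<ge> \<epsilon>"
    by (simp add: frequently_def not_le)
  hence freq: "\<exists>\<^sub>F z in at_top. cmod (l z) \<ge> \<epsilon> \<and> z > 0"
    by (rule frequently_rev_mp) (use eventually_gt_at_top[of 0] in eventually_elim, auto)
  \<comment> \<open>With off-diagonal entries at most 1/J, the J^2 entries contribute at most J
    beyond the diagonal, so the double sum is at most J (|B| + 1). Cauchy-Schwarz then forces J
    \<epsilon>^2 <= |A| (|B| + 1), which this J violates.\<close>
  obtain J :: nat where J: "real J > \<bar>A\<bar> * (\<bar>B\<bar> + 1) / \<epsilon>\<^sup>2"
    using reals_Archimedean2 by blast
  moreover have "0 \<le> \<bar>A\<bar> * (\<bar>B\<bar> + 1) / \<epsilon>\<^sup>2" by simp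
  ultimately have "J > 0" by (intro Nat.gr0I) (auto simp del: divide_nonneg_nonneg)
  obtain Z where Z: "finite Z" "card Z = J" "\<And>z. z \<in> Z \<Longrightarrow> cmod (l z) \<ge> \<epsilon> \<and> z > 0"
    "\<And>z w. z \<in> Z \<Longrightarrow> w \<in> Z \<Longrightarrow> z \<noteq> w \<Longrightarrow> \<bar>liouville_gram z w\<bar> \<le> 1 / J"
    using almost_orthogonal_subset[of liouville_gram, OF weak liouville_gram_commute freq, of "1 / J" J] \<open>J > 0\<close>
    by (metis divide_pos_pos of_nat_0_less_iff zero_less_one)
  have nn: "liouville_gram z z \<ge> 0" for z
    unfolding liouville_gram_eq by (intro sum_nonneg mult_nonneg_nonneg[OF _ zero_le_square]) auto
  have "(J * \<epsilon>)\<^sup>2 \<le> (\<Sum>z\<in>Z. cmod (l z))\<^sup>2"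
  proof (intro power_mono)
    show "J * \<epsilon> \<le> (\<Sum>z\<in>Z. cmod (l z))"
      using sum_mono[of Z "\<lambda>_. \<epsilon>" "\<lambda>z. cmod (l z)"] Z by simp
  qed (use \<open>\<epsilon> > 0\<close> in auto)
  also have "\<dots> \<le> A * (\<Sum>z\<in>Z. \<Sum>w\<in>Z. \<bar>liouville_gram z w\<bar>)"
    using bdd lim Z by (intro sum_limits_bound) auto
  also have "\<dots> \<le> \<bar>A\<bar> * (\<Sum>z\<in>Z. \<Sum>w\<in>Z. \<bar>liouville_gram z w\<bar>)"
    by (intro mult_right_mono sum_nonneg) auto
  also have "\<dots> \<le> \<bar>A\<bar> * (\<Sum>z\<in>Z. \<Sum>w\<in>Z. (if z = w then \<bar>B\<bar> else 0) + 1 / J)"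
  proof (intro mult_left_mono sum_mono)
    fix z w assume "z \<in> Z" "w \<in> Z"
    thus "\<bar>liouville_gram z w\<bar> \<le> (if z = w then \<bar>B\<bar> else 0) + 1 / J"
      using Z(4)[of z w] nn[of z] diag[of z]
      by (auto intro!: add_increasing2)
  qed auto
  also have "\<dots> = \<bar>A\<bar> * (\<bar>B\<bar> + 1) * J"
    using Z \<open>J > 0\<close> by (simp add: sum.distrib algebra_simps)
  finally have "J * (J * \<epsilon>\<^sup>2) \<le> J * (\<bar>A\<bar> * (\<bar>B\<bar> + 1))"
    by (simp add: power2_eq_square mult_ac)
  hence "J * \<epsilon>\<^sup>2 \<le> \<bar>A\<bar> * (\<bar>B\<bar> + 1)"
    using \<open>J > 0\<close> by simp
  with J \<open>\<epsilon> > 0\<close> show False by (simp add: field_simps)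
qed

section \<open>Square integrability of the logarithmic sums\<close>

text \<open>At most v - u + 1 integers lie in [u, v), and each contributes at most 1/u. This is the
  slow variation of M: the bound equals v/u - 1 + 1/u.\<close>

lemma abs_liouville_log_sum_diff_le:
  assumes "0 < u" "u \<le> v"
  shows "\<bar>liouville_log_sum v - liouville_log_sum u\<bar> \<le> (v - u + 1) / u"
proof -
  define D where "D = posnats_below v - posnats_below u"
  have sub: "posnats_below u \<subseteq> posnats_below v"
    using assms by (auto simp: posnats_below_def)
  have "liouville_log_sum v - liouville_log_sum u = (\<Sum>d\<in>D. liouville d / d)"
    unfolding liouville_log_sum_def D_def using sub by (simp add: sum_diff)
  also have "\<bar>\<dots>\<bar> \<le> (\<Sum>d\<in>D. \<bar>real_of_int (liouville d) / d\<bar>)"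
    by (rule sum_abs)
  also have "\<dots> \<le> (\<Sum>d\<in>D. 1 / u)"
  proof (intro sum_mono)
    fix d assume "d \<in> D"
    hence d: "u \<le> d" by (auto simp: D_def posnats_below_def)
    show "\<bar>real_of_int (liouville d) / d\<bar> \<le> 1 / u"
      using d assms by (simp add: frac_le)
  qed
  also have "\<dots> = card D / u" by simp
  also have "\<dots> \<le> (v - u + 1) / u"
  proof (rule divide_right_mono)
    have "D \<subseteq> {nat \<lceil>u\<rceil>..<nat \<lceil>v\<rceil>}"
      using assms by (auto simp: D_def posnats_below_def nat_le_iff) linarith+
    hence "card D \<le> card {nat \<lceil>u\<rceil>..<nat \<lceil>v\<rceil>}" by (intro card_mono) auto
    hence "card D \<le> nat \<lceil>v\<rceil> - nat \<lceil>u\<rceil>" by simp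
    thus "real (card D) \<le> v - u + 1" using assms by linarith
  qed (use assms in auto)
  finally show ?thesis .
qed

lemma abs_liouville_log_sum_le: "u \<ge> 0 \<Longrightarrow> \<bar>liouville_log_sum u\<bar> \<le> u"
proof -
  assume "u \<ge> 0"
  have "\<bar>liouville_log_sum u\<bar> \<le> (\<Sum>d\<in>posnats_below u. \<bar>real_of_int (liouville d) / d\<bar>)"
    unfolding liouville_log_sum_def by (rule sum_abs)
  also have "\<dots> \<le> (\<Sum>d\<in>posnats_below u. 1)"
  proof (intro sum_mono)
    fix d assume "d \<in> posnats_below u"
    thus "\<bar>real_of_int (liouville d) / d\<bar> \<le> 1" by (simp add: posnats_below_def)
  qed
  also have "\<dots> = card (posnats_below u)" by simp
  also have "\<dots> \<le> u"
  proof -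
    have "posnats_below u \<subseteq> {1..nat \<lfloor>u\<rfloor>}"
      by (auto simp: posnats_below_def le_nat_floor)
    hence "card (posnats_below u) \<le> card {1..nat \<lfloor>u\<rfloor>}" by (intro card_mono) auto
    hence "card (posnats_below u) \<le> nat \<lfloor>u\<rfloor>" by simp
    thus ?thesis using \<open>u \<ge> 0\<close> by linarith
  qed
  finally show ?thesis .
qed

lemma liouville_log_sum_exp_measurable [measurable]:
  "(\<lambda>x. liouville_log_sum (exp x)) \<in> borel_measurable borel"
proof -
  have "liouville_log_sum (exp x) = (\<Sum>d. if 1 \<le> d \<and> real d < exp x then liouville d / d else 0)" for x
    unfolding liouville_log_sum_def
    by (subst suminf_finite[OF finite_posnats_below[of "exp x"]])
      (auto simp: posnats_below_def intro!: sum.cong)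
  thus ?thesis by simp
qed

lemma liouville_log_sum_sq_set_integrable:
  "set_integrable lborel {a..b} (\<lambda>x. (liouville_log_sum (exp x))\<^sup>2)"
  unfolding set_integrable_def
proof (rule integrableI_bounded_set_indicator[where B = "(exp b)\<^sup>2"])
  show "AE x in lborel. x \<in> {a..b} \<longrightarrow> norm ((liouville_log_sum (exp x))\<^sup>2) \<le> (exp b)\<^sup>2"
  proof (intro AE_I2 impI)
    fix x assume "x \<in> {a..b}"
    hence "\<bar>liouville_log_sum (exp x)\<bar> \<le> exp b"
      using abs_liouville_log_sum_le[of "exp x"] by (auto intro: order_trans)
    hence "\<bar>liouville_log_sum (exp x)\<bar>\<^sup>2 \<le> (exp b)\<^sup>2"
      by (intro power_mono) auto
    thus "norm ((liouville_log_sum (exp x))\<^sup>2) \<le> (exp b)\<^sup>2" by simp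
  qed
qed (auto simp: emeasure_lborel_Icc_eq)

lemma liouville_log_sum_sq_integrable:
  "(\<lambda>x. (liouville_log_sum (exp x))\<^sup>2) integrable_on {a..b}"
  using liouville_log_sum_sq_set_integrable by (rule set_borel_integral_eq_integral)

text \<open>In the variable x = ln u a dilation u / k becomes a shift by ln k. The upper end stays
  finite since boundedness in X is what is proved and used.\<close>

definition sq_integral :: "real \<Rightarrow> real" where
  "sq_integral X = integral {0..X} (\<lambda>x. (liouville_log_sum (exp x))\<^sup>2)"

lemma sq_integral_diff_ge:
  assumes "0 \<le> a" "a \<le> b" "\<And>x. a \<le> x \<Longrightarrow> x \<le> b \<Longrightarrow> c \<le> (liouville_log_sum (exp x))\<^sup>2"
  shows "c * (b - a) \<le> sq_integral b - sq_integral a"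
proof -
  have "sq_integral b = sq_integral a + integral {a..b} (\<lambda>x. (liouville_log_sum (exp x))\<^sup>2)"
    unfolding sq_integral_def
    by (rule Henstock_Kurzweil_Integration.integral_combine
        [OF assms(1,2) liouville_log_sum_sq_integrable, symmetric])
  moreover have "integral {a..b} (\<lambda>x. c) \<le> integral {a..b} (\<lambda>x. (liouville_log_sum (exp x))\<^sup>2)"
    using assms by (intro integral_le liouville_log_sum_sq_integrable) auto
  ultimately show ?thesis using assms by (simp add: mult.commute)
qed

lemma sq_integral_mono: "0 \<le> a \<Longrightarrow> a \<le> b \<Longrightarrow> sq_integral a \<le> sq_integral b"
  using sq_integral_diff_ge[of a b 0] by simp

text \<open>If |M(u)| >= \<epsilon>, slow variation keeps |M| >= \<epsilon>/2 on a logarithmic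
  interval of length h independent of u. This adds h (\<epsilon>/2)^2 to the integral, which is
  impossible once the integral up to X is closer than that to its supremum.\<close>

lemma liouville_log_sum_tendsto_0:
  assumes C: "\<And>X. 0 \<le> X \<Longrightarrow> sq_integral X \<le> C"
  shows "(liouville_log_sum \<longlongrightarrow> 0) at_top"
proof (rule tendstoI)
  fix \<epsilon> :: real assume \<epsilon>: "\<epsilon> > 0"
  \<comment> \<open>On [u, u (1 + \<epsilon>/4)] M changes by at most \<epsilon>/4 + 1/u, which is
    at most \<epsilon>/2 for u >= 4/\<epsilon>.\<close>
  define h where "h = ln (1 + \<epsilon> / 4)"
  have h: "h > 0" using \<epsilon> by (simp add: h_def ln_gt_zero)
  have bdd: "bdd_above (sq_integral ` {0..})" using C by (auto intro!: bdd_aboveI)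
  have "Sup (sq_integral ` {0..}) - h * (\<epsilon> / 2)\<^sup>2 < Sup (sq_integral ` {0..})"
    using h \<epsilon> by simp
  then obtain X where X: "X \<ge> 0" "Sup (sq_integral ` {0..}) - h * (\<epsilon> / 2)\<^sup>2 < sq_integral X"
    using less_cSUP_iff[OF _ bdd] by (metis atLeast_iff atLeast_empty_triv empty_iff order_refl)
  show "\<forall>\<^sub>F u in at_top. dist (liouville_log_sum u) 0 < \<epsilon>"
    using eventually_ge_at_top[of "max (exp X) (4 / \<epsilon>)"]
  proof eventually_elim
    case (elim u)
    hence u: "u \<ge> exp X" "u \<ge> 4 / \<epsilon>" by auto
    have u0: "u > 0" using u(1) exp_gt_zero[of X] by linarith
    have lnu: "X \<le> ln u" using u(1) u0 by (simp add: ln_ge_iff)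
    show ?case
    proof (rule ccontr)
      assume "\<not> dist (liouville_log_sum u) 0 < \<epsilon>"
      hence Mu: "\<bar>liouville_log_sum u\<bar> \<ge> \<epsilon>" by simp
      have "(\<epsilon> / 2)\<^sup>2 * (ln u + h - ln u) \<le> sq_integral (ln u + h) - sq_integral (ln u)"
      proof (rule sq_integral_diff_ge)
        fix x assume x: "ln u \<le> x" "x \<le> ln u + h"
        have le: "u \<le> exp x" using x(1) u0 by (metis exp_le_cancel_iff exp_ln)
        have "exp x \<le> exp (ln u + h)" using x by simp
        also have "\<dots> = u * (1 + \<epsilon> / 4)" using u0 \<epsilon> by (simp add: exp_add h_def)
        finally have "(exp x - u + 1) / u \<le> (u * (1 + \<epsilon> / 4) - u + 1) / u"
          using u0 by (intro divide_right_mono) auto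
        also have "\<dots> = \<epsilon> / 4 + 1 / u" using u0 by (simp add: field_simps)
        also have "1 / u \<le> \<epsilon> / 4" using u(2) u0 \<epsilon> by (simp add: field_simps)
        finally have "(exp x - u + 1) / u \<le> \<epsilon> / 2" by simp
        with abs_liouville_log_sum_diff_le[OF u0 le]
        have "\<bar>liouville_log_sum (exp x) - liouville_log_sum u\<bar> \<le> \<epsilon> / 2" by linarith
        hence "\<epsilon> / 2 \<le> \<bar>liouville_log_sum (exp x)\<bar>" using Mu by linarith
        hence "(\<epsilon> / 2)\<^sup>2 \<le> \<bar>liouville_log_sum (exp x)\<bar>\<^sup>2" using \<epsilon> by (intro power_mono) auto
        thus "(\<epsilon> / 2)\<^sup>2 \<le> (liouville_log_sum (exp x))\<^sup>2" by simp
      qed (use X lnu h in auto)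
      moreover have "sq_integral (ln u + h) \<le> Sup (sq_integral ` {0..})"
        using bdd X lnu h by (intro cSUP_upper) auto
      moreover have "sq_integral X \<le> sq_integral (ln u)"
        using X lnu by (intro sq_integral_mono) auto
      ultimately show False using X(2) by (simp add: mult.commute)
    qed
  qed
qed

section \<open>Boundedness of the Gram form on the diagonal\<close>

lemma sum_inverse_squares_le: "(\<Sum>k=1..n. 1 / (real k)\<^sup>2) \<le> 2"
proof -
  have *: "(\<Sum>k=1..Suc m. 1 / (real k)\<^sup>2) \<le> 2 - 1 / Suc m" for m
  proof (induction m)
    case (Suc m)
    have "1 / (real (Suc (Suc m)))\<^sup>2 \<le> 1 / (real (Suc m) * real (Suc (Suc m)))"
      by (intro divide_left_mono) (auto simp: power2_eq_square)
    also have "\<dots> = 1 / Suc m - 1 / Suc (Suc m)"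
      by (simp add: field_simps)
    finally show ?case using Suc by simp
  qed simp
  show ?thesis
  proof (cases n)
    case (Suc m)
    have "0 \<le> 1 / real (Suc m)" by simp
    with *[of m] have "(\<Sum>k=1..Suc m. 1 / (real k)\<^sup>2) \<le> 2" by linarith
    thus ?thesis by (simp only: Suc)
  qed simp
qed

text \<open>The interval from ln (z/(k+1)) to ln (z/k) has length about 1/k, so M(z/k)^2 / k is
  comparable to the integral of M^2 over it. These intervals are adjacent, so the main terms
  telescope; the errors stay bounded when summed over k < z. The hypothesis z >= k + 1 keeps the
  interval in x >= 0.\<close>

lemma liouville_gram_diag_term:
  assumes z: "real k + 1 \<le> z" and k: "k \<ge> 1"
  shows "(liouville_log_sum (z / k))\<^sup>2 / k \<le>
     4 * (sq_integral (ln z - ln k) - sq_integral (ln z - ln (Suc k))) + 8 / (real k)\<^sup>2 + 32 / z\<^sup>2 * k"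
proof -
  define M where "M = liouville_log_sum (z / k)"
  \<comment> \<open>The bound of \<open>abs_liouville_log_sum_diff_le\<close> for u = z/(k+1) and v
    = z/k, hence for the variation of M over the whole interval.\<close>
  define \<Delta> where "\<Delta> = 1 / k + (real k + 1) / z"
  define len where "len = ln (real (Suc k)) - ln k"
  have z0: "z > 0" using z by simp
  have len: "1 / (2 * real k) \<le> len" "len \<le> 1 / k"
  proof -
    have "len = ln (Suc k / k)" using k by (simp add: len_def ln_div)
    also have "real (Suc k) / k = 1 + 1 / k" using k by (simp add: field_simps)
    finally have "len = ln (1 + 1 / k)" .
    thus "len \<le> 1 / k" using ln_add_one_self_le_self[of "1 / k"] by simp
    have "-len = ln (k / Suc k)" using k by (simp add: len_def ln_div)
    also have "\<dots> \<le> k / Suc k - 1" using k by (intro ln_le_minus_one) auto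
    also have "\<dots> = - (1 / (k + 1))" by (simp add: field_simps)
    finally have "1 / (real k + 1) \<le> len" by (simp add: add.commute)
    moreover have "1 / (2 * real k) \<le> 1 / (real k + 1)" using k by (simp add: field_simps)
    ultimately show "1 / (2 * real k) \<le> len" by linarith
  qed
  have "(M\<^sup>2 / 2 - \<Delta>\<^sup>2) * ((ln z - ln k) - (ln z - ln (Suc k))) \<le>
      sq_integral (ln z - ln k) - sq_integral (ln z - ln (Suc k))"
  proof (rule sq_integral_diff_ge)
    show "0 \<le> ln z - ln (real (Suc k))" using z k by simp
    show "ln z - ln (real (Suc k)) \<le> ln z - ln (real k)" using k by simp
    fix x assume x: "ln z - ln (real (Suc k)) \<le> x" "x \<le> ln z - ln (real k)"
    have "exp (ln z - ln (real (Suc k))) \<le> exp x" using x by simp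
    hence lo: "z / Suc k \<le> exp x" using z0 by (simp add: exp_diff)
    have "exp x \<le> exp (ln z - ln (real k))" using x by simp
    hence hi: "exp x \<le> z / k" using z0 k by (simp add: exp_diff)
    have "\<bar>M - liouville_log_sum (exp x)\<bar> \<le> (z / k - exp x + 1) / exp x"
      unfolding M_def using hi by (intro abs_liouville_log_sum_diff_le) auto
    also have "\<dots> \<le> (z / k - z / Suc k + 1) / (z / Suc k)"
      using lo hi z0 k by (intro frac_le) auto
    also have "\<dots> = \<Delta>"
    proof -
      have "(z / x - z / s + 1) / (z / s) = s / x - 1 + s / z" if "x > 0" "s > 0" for x s
        using z0 that by (simp add: field_simps)
      from this[of k "Suc k"] k show ?thesis
        by (simp add: \<Delta>_def add_divide_distrib)
    qed
    finally have d: "\<bar>M - liouville_log_sum (exp x)\<bar> \<le> \<Delta>" .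
    define m where "m = liouville_log_sum (exp x)"
    have "(M - m)\<^sup>2 \<le> \<Delta>\<^sup>2" using d by (metis abs_ge_zero m_def power2_abs power_mono)
    moreover have "M\<^sup>2 \<le> 2 * (M - m)\<^sup>2 + 2 * m\<^sup>2"
      using zero_le_power2[of "M - 2 * m"] by (simp add: power2_eq_square algebra_simps)
    ultimately show "M\<^sup>2 / 2 - \<Delta>\<^sup>2 \<le> (liouville_log_sum (exp x))\<^sup>2" unfolding m_def by linarith
  qed
  hence *: "M\<^sup>2 * len \<le> 2 * (sq_integral (ln z - ln k) - sq_integral (ln z - ln (Suc k))) + 2 * (\<Delta>\<^sup>2 * len)"
  proof -
    have "(ln z - ln k) - (ln z - ln (real (Suc k))) = len" by (simp add: len_def)
    moreover have "M\<^sup>2 * len = 2 * ((M\<^sup>2 / 2 - \<Delta>\<^sup>2) * len) + 2 * (\<Delta>\<^sup>2 * len)"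
      by (simp add: algebra_simps)
    ultimately show ?thesis
      using \<open>(M\<^sup>2 / 2 - \<Delta>\<^sup>2) * _ \<le> _\<close> by simp
  qed
  have "\<Delta>\<^sup>2 \<le> 2 * (1 / k)\<^sup>2 + 2 * ((real k + 1) / z)\<^sup>2"
    using zero_le_power2[of "1 / k - (real k + 1) / z"]
    unfolding \<Delta>_def power2_sum power2_diff by linarith
  also have "((real k + 1) / z)\<^sup>2 \<le> ((2 * real k) / z)\<^sup>2"
    using k z0 by (intro power_mono divide_right_mono) auto
  finally have "\<Delta>\<^sup>2 \<le> 2 / (real k)\<^sup>2 + 8 * (real k)\<^sup>2 / z\<^sup>2" by (simp add: power_divide power_mult_distrib add.commute)
  hence "\<Delta>\<^sup>2 * len \<le> (2 / (real k)\<^sup>2 + 8 * (real k)\<^sup>2 / z\<^sup>2) * (1 / k)"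
    using len by (intro mult_mono) auto
  also have "\<dots> = 2 / (real k)\<^sup>2 * (1 / k) + 8 / z\<^sup>2 * k" using k by (simp add: field_simps power2_eq_square)
  also have "2 / (real k)\<^sup>2 * (1 / k) \<le> 2 / (real k)\<^sup>2 * 1"
    using k by (intro mult_left_mono) auto
  finally have **: "\<Delta>\<^sup>2 * len \<le> 2 / (real k)\<^sup>2 + 8 / z\<^sup>2 * k" by simp
  have "M\<^sup>2 / k = 2 * (M\<^sup>2 * (1 / (2 * real k)))" by simp
  also have "\<dots> \<le> 2 * (M\<^sup>2 * len)" using len by (intro mult_left_mono) auto
  also have "\<dots> \<le> 4 * (sq_integral (ln z - ln k) - sq_integral (ln z - ln (Suc k))) + 4 * (\<Delta>\<^sup>2 * len)"
    using * by linarith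
  also have "\<dots> \<le> 4 * (sq_integral (ln z - ln k) - sq_integral (ln z - ln (Suc k))) + 8 / (real k)\<^sup>2 + 32 / z\<^sup>2 * k"
    using ** by linarith
  finally show ?thesis unfolding M_def .
qed

text \<open>Uses \<open>totient k\<close> <= k and compares the sum with the integral term by term.
  The constant 52 is 4 from the last index, 8 * 2 from the inverse squares, and 32 from the errors
  linear in k.\<close>

lemma liouville_gram_diag_le:
  assumes C: "\<And>X. 0 \<le> X \<Longrightarrow> sq_integral X \<le> C"
  shows "liouville_gram z z \<le> 4 * C + 52"
proof (cases "z > 1")
  case False
  hence "posnats_below z = {}" by (auto simp: posnats_below_def)
  moreover have "C \<ge> 0" using C[of 0] by (simp add: sq_integral_def)
  ultimately show ?thesis by (simp add: liouville_gram_def)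
next
  case True
  define K where "K = nat (\<lceil>z\<rceil> - 1)"
  have K: "K \<ge> 1" "real K < z" "z \<le> real K + 1"
    using True unfolding K_def by linarith+
  have D: "posnats_below z = {1..K}"
    using K by (auto simp: posnats_below_def)
  have "liouville_gram z z = (\<Sum>k=1..K. totient k / k\<^sup>2 * (liouville_log_sum (z / k))\<^sup>2)"
    unfolding liouville_gram_eq D by (simp add: power2_eq_square)
  also have "\<dots> \<le> (\<Sum>k=1..K. (liouville_log_sum (z / k))\<^sup>2 / k)"
  proof (rule sum_mono)
    fix k assume k: "k \<in> {1..K}"
    have "real (totient k) / k\<^sup>2 \<le> real k / k\<^sup>2"
      by (intro divide_right_mono) (auto simp: totient_le)
    also have "\<dots> = 1 / k" using k by (simp add: power2_eq_square)
    finally have "totient k / k\<^sup>2 * (liouville_log_sum (z / k))\<^sup>2 \<le> 1 / k * (liouville_log_sum (z / k))\<^sup>2"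
      by (intro mult_right_mono) auto
    thus "totient k / k\<^sup>2 * (liouville_log_sum (z / k))\<^sup>2 \<le> (liouville_log_sum (z / k))\<^sup>2 / k" by simp
  qed
  \<comment> \<open>The index K is split off because K + 1 <= z may fail; there z / K <= 2, so the
    trivial bound for M suffices.\<close>
  also have "\<dots> = (\<Sum>k\<in>{1..<K}. (liouville_log_sum (z / k))\<^sup>2 / k) + (liouville_log_sum (z / K))\<^sup>2 / K"
  proof -
    have "{1..K} = insert K {1..<K}" using K(1) by auto
    thus ?thesis by simp
  qed
  also have "(liouville_log_sum (z / K))\<^sup>2 / K \<le> 4"
  proof -
    have "z / K \<le> 2" using K by (simp add: field_simps)
    hence "\<bar>liouville_log_sum (z / K)\<bar> \<le> 2"
      using abs_liouville_log_sum_le[of "z / K"] True by simp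
    hence "\<bar>liouville_log_sum (z / K)\<bar>\<^sup>2 \<le> 2\<^sup>2" by (intro power_mono) auto
    hence "(liouville_log_sum (z / K))\<^sup>2 / K \<le> 4 / 1" using K by (intro frac_le) auto
    thus ?thesis by simp
  qed
  also have "(\<Sum>k\<in>{1..<K}. (liouville_log_sum (z / k))\<^sup>2 / k) \<le> (\<Sum>k\<in>{1..<K}.
     4 * (sq_integral (ln z - ln k) - sq_integral (ln z - ln (Suc k))) + 8 / (real k)\<^sup>2 + 32 / z\<^sup>2 * k)"
    using K by (intro sum_mono liouville_gram_diag_term) auto
  also have "\<dots> = 4 * (\<Sum>k\<in>{1..<K}. sq_integral (ln z - ln k) - sq_integral (ln z - ln (Suc k)))
      + 8 * (\<Sum>k\<in>{1..<K}. 1 / (real k)\<^sup>2) + 32 / z\<^sup>2 * (\<Sum>k\<in>{1..<K}. real k)"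
    by (simp add: sum.distrib sum_distrib_left)
  also have "(\<Sum>k\<in>{1..<K}. sq_integral (ln z - ln k) - sq_integral (ln z - ln (Suc k))) \<le> C"
  proof -
    have "(\<Sum>k\<in>{1..<K}. sq_integral (ln z - ln k) - sq_integral (ln z - ln (Suc k)))
      = - (\<Sum>k\<in>{1..<K}. sq_integral (ln z - ln (Suc k)) - sq_integral (ln z - ln k))"
      by (simp flip: sum_negf)
    also have "\<dots> = sq_integral (ln z) - sq_integral (ln z - ln K)"
      using K(1) by (subst sum_Suc_diff') auto
    also have "\<dots> \<le> C"
      using C[of "ln z"] sq_integral_mono[of 0 "ln z - ln K"] K True by (simp add: sq_integral_def)
    finally show ?thesis .
  qed
  also have "(\<Sum>k\<in>{1..<K}. 1 / (real k)\<^sup>2) \<le> 2"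
  proof -
    have "(\<Sum>k\<in>{1..<K}. 1 / (real k)\<^sup>2) \<le> (\<Sum>k\<in>{1..K}. 1 / (real k)\<^sup>2)"
      by (intro sum_mono2) auto
    also have "\<dots> \<le> 2" by (rule sum_inverse_squares_le)
    finally show ?thesis .
  qed
  also have "32 / z\<^sup>2 * (\<Sum>k\<in>{1..<K}. real k) \<le> 32 / z\<^sup>2 * z\<^sup>2"
  proof (rule mult_left_mono)
    have "(\<Sum>k\<in>{1..<K}. real k) \<le> (\<Sum>k\<in>{1..<K}. z)" using K by (intro sum_mono) auto
    also have "\<dots> = (real K - 1) * z" using K by (simp add: of_nat_diff)
    also have "\<dots> \<le> z * z" using K True by (intro mult_right_mono) auto
    finally show "(\<Sum>k\<in>{1..<K}. real k) \<le> z\<^sup>2" by (simp add: power2_eq_square)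
  qed simp
  finally show ?thesis using True by simp
qed

text \<open>For fixed w the range of k is finite and independent of z, so the limit can be taken in
  each factor M(z/k).\<close>

lemma liouville_gram_tendsto_0:
  assumes "(liouville_log_sum \<longlongrightarrow> 0) at_top"
  shows "((\<lambda>z. liouville_gram z w) \<longlongrightarrow> 0) at_top"
proof -
  have "((\<lambda>z. \<Sum>k\<in>posnats_below w. totient k / k\<^sup>2 *
     (liouville_log_sum (z / k) * liouville_log_sum (w / k))) \<longlongrightarrow>
     (\<Sum>k\<in>posnats_below w. totient k / k\<^sup>2 * (0 * liouville_log_sum (w / k)))) at_top"
  proof (intro tendsto_intros)
    fix k assume "k \<in> posnats_below w"
    hence "k > 0" by (rule posnats_below_pos)
    hence "filterlim (\<lambda>z. z / real k) at_top at_top"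
      using filterlim_tendsto_pos_mult_at_top[OF tendsto_const, of "1 / real k" "\<lambda>z. z" at_top]
      by (simp add: filterlim_ident)
    from filterlim_compose[OF assms this]
    show "((\<lambda>z. liouville_log_sum (z / k)) \<longlongrightarrow> 0) at_top" .
  qed
  thus ?thesis by (simp add: liouville_gram_eq)
qed

section \<open>Sieving completely multiplicative series\<close>

text \<open>The integers left by the sieve of Eratosthenes up to N. For N < 2 the number 0 belongs
  to the set, which is harmless for the functions summed, as they vanish at 0.\<close>

definition rough :: "nat \<Rightarrow> nat set" where
  "rough N = {n. \<forall>p. prime p \<and> p \<le> N \<longrightarrow> \<not> p dvd n}"

lemma rough_1: "rough (Suc 0) = UNIV"
  by (auto simp: rough_def dest: prime_gt_1_nat)

lemma one_in_rough: "1 \<in> rough N"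
  by (auto simp: rough_def)

lemma rough_gt: "n \<in> rough N \<Longrightarrow> n \<noteq> 0 \<Longrightarrow> n \<noteq> 1 \<Longrightarrow> n > N"
proof (rule ccontr)
  assume n: "n \<in> rough N" "n \<noteq> 0" "n \<noteq> 1" "\<not> n > N"
  from n(3) obtain p where p: "prime p" "p dvd n" using prime_factor_nat by blast
  hence "p \<le> N" using n dvd_imp_le[of p n] by auto
  with p n(1) show False by (auto simp: rough_def)
qed

text \<open>One step of the sieve: a number free of primes up to N either avoids the prime p = N + 1
  or is p times another such number, possibly again divisible by p.\<close>

lemma rough_Suc_prime:
  assumes "prime (Suc N)"
  shows "rough N = rough (Suc N) \<union> (\<lambda>n. Suc N * n) ` rough N"
    and "rough (Suc N) \<inter> (\<lambda>n. Suc N * n) ` rough N = {}"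
proof -
  have 1: "Suc N * m \<in> rough N \<longleftrightarrow> m \<in> rough N" for m
  proof -
    have "p dvd Suc N * m \<longleftrightarrow> p dvd m" if "prime p" "p \<le> N" for p
    proof -
      have "\<not> p dvd Suc N" using that assms by (metis primes_dvd_imp_eq Suc_n_not_le_n)
      thus ?thesis using that(1) prime_dvd_mult_iff by blast
    qed
    thus ?thesis unfolding rough_def by blast
  qed
  have 2: "n \<in> rough (Suc N) \<longleftrightarrow> n \<in> rough N \<and> \<not> Suc N dvd n" for n
    unfolding rough_def using assms le_Suc_eq by auto
  show "rough N = rough (Suc N) \<union> (\<lambda>n. Suc N * n) ` rough N"
  proof (intro set_eqI iffI)
    fix n assume n: "n \<in> rough N"
    show "n \<in> rough (Suc N) \<union> (\<lambda>n. Suc N * n) ` rough N"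
    proof (cases "Suc N dvd n")
      case True
      then obtain m where "n = Suc N * m" by (elim dvdE)
      with n 1 show ?thesis by blast
    qed (use n 2 in blast)
  next
    fix n assume "n \<in> rough (Suc N) \<union> (\<lambda>n. Suc N * n) ` rough N"
    thus "n \<in> rough N" using 1 2 by blast
  qed
  show "rough (Suc N) \<inter> (\<lambda>n. Suc N * n) ` rough N = {}"
    using 2 dvd_triv_left by blast
qed

lemma rough_Suc_nonprime: "\<not> prime (Suc N) \<Longrightarrow> rough (Suc N) = rough N"
  unfolding rough_def by (auto simp: le_Suc_eq)

locale summable_completely_multiplicative =
  fixes f :: "nat \<Rightarrow> complex"
  assumes f_0 [simp]: "f 0 = 0" and f_1: "f 1 = 1" and f_mult: "f (m * n) = f m * f n"
    and summable_norm: "summable (\<lambda>n. norm (f n))"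
begin

text \<open>What remains of the Euler product of f after the factors of the primes up to N are
  removed. It leads from the full series at N = 1 to the limit 1, so products over primes can be
  compared without infinite products.\<close>

definition sieved :: "nat \<Rightarrow> complex" where
  "sieved N = infsum f (rough N)"

lemma norm_summable_on: "(\<lambda>n. norm (f n)) summable_on A"
proof -
  have "(\<lambda>n. norm (f n)) summable_on UNIV"
    using summable_norm by (intro norm_summable_imp_summable_on) simp
  thus ?thesis by (rule summable_on_subset_banach) simp
qed

lemma summable_on_any: "f summable_on A"
  using norm_summable_on by (rule abs_summable_summable)

lemma sieved_1: "sieved (Suc 0) = suminf f"
proof -
  have "f sums infsum f UNIV"
    using summable_on_any[of UNIV] by (intro has_sum_imp_sums) auto
  thus ?thesis by (simp add: sieved_def rough_1 sums_iff)
qed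

text \<open>For a prime p = N + 1 the sieve step gives
  \<open>sieved N = sieved (Suc N) + f p * sieved N\<close>, the multiples of p being evaluated by
  complete multiplicativity.\<close>

lemma sieved_Suc: "sieved (Suc N) = (if prime (Suc N) then 1 - f (Suc N) else 1) * sieved N"
proof (cases "prime (Suc N)")
  case True
  have "sieved N = infsum f (rough (Suc N)) + infsum f ((\<lambda>n. Suc N * n) ` rough N)"
    unfolding sieved_def
    by (subst (1) rough_Suc_prime(1)[OF True])
      (rule infsum_Un_disjoint[OF summable_on_any summable_on_any rough_Suc_prime(2)[OF True]])
  also have "infsum f ((\<lambda>n. Suc N * n) ` rough N) = infsum (f \<circ> (\<lambda>n. Suc N * n)) (rough N)"
    by (rule infsum_reindex) (auto simp: inj_on_def simp del: mult_Suc)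
  also have "f \<circ> (\<lambda>n. Suc N * n) = (\<lambda>n. f (Suc N) * f n)"
    by (rule ext) (simp only: o_def f_mult)
  also have "infsum \<dots> (rough N) = f (Suc N) * sieved N"
    unfolding sieved_def by (rule infsum_cmult_right')
  finally show ?thesis using True by (simp add: sieved_def algebra_simps)
qed (simp add: sieved_def rough_Suc_nonprime)

text \<open>Apart from 1, and 0 where f vanishes, rough numbers exceed N, so the rest is dominated
  by a tail of the absolutely convergent series.\<close>

lemma sieved_tendsto_1: "sieved \<longlonglongrightarrow> 1"
proof -
  have bound: "norm (sieved N - 1) \<le> (\<Sum>n. norm (f (n + Suc N)))" if "N \<ge> 1" for N
  proof -
    have "rough N = insert 1 (rough N - {1})" using one_in_rough by auto
    hence "sieved N = infsum f ({1} \<union> (rough N - {1}))" by (simp add: sieved_def)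
    also have "\<dots> = infsum f {1} + infsum f (rough N - {1})"
      by (rule infsum_Un_disjoint) (auto simp: summable_on_any)
    finally have "sieved N - 1 = infsum f (rough N - {1})" by (simp add: f_1[simplified])
    also have "\<dots> = infsum f ({Suc N..} \<inter> rough N)"
    proof (rule infsum_cong_neutral)
      fix n assume "n \<in> rough N - {1} - {Suc N..} \<inter> rough N"
      hence "n \<in> rough N" "n \<noteq> 1" "\<not> n > N" by auto
      hence "n = 0" using rough_gt by blast
      thus "f n = 0" by simp
    qed (use that in auto)
    also have "norm \<dots> \<le> infsum (\<lambda>n. norm (f n)) ({Suc N..} \<inter> rough N)"
      by (rule norm_infsum_bound) (rule norm_summable_on)
    also have "\<dots> \<le> infsum (\<lambda>n. norm (f n)) {Suc N..}"
      by (intro infsum_mono2 norm_summable_on) auto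
    also have "{Suc N..} = (\<lambda>n. n + Suc N) ` UNIV"
      by (auto simp: image_iff le_iff_add add.commute)
    also have "infsum (\<lambda>n. norm (f n)) \<dots> = infsum ((\<lambda>n. norm (f n)) \<circ> (\<lambda>n. n + Suc N)) UNIV"
      by (rule infsum_reindex) (auto simp: inj_on_def)
    also have "\<dots> = (\<Sum>n. norm (f (n + Suc N)))"
    proof -
      have "summable (\<lambda>n. norm (norm (f (n + Suc N))))"
        using summable_norm summable_iff_shift[of "\<lambda>n. norm (f n)" "Suc N"] by simp
      hence "(\<lambda>n. norm (f (n + Suc N))) summable_on UNIV"
        by (rule norm_summable_imp_summable_on)
      hence "(\<lambda>n. norm (f (n + Suc N))) sums infsum (\<lambda>n. norm (f (n + Suc N))) UNIV"
        by (intro has_sum_imp_sums) auto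
      thus ?thesis by (simp add: sums_iff o_def)
    qed
    finally show ?thesis .
  qed
  have "(\<lambda>N. \<Sum>n. norm (f (n + Suc N))) \<longlonglongrightarrow> 0"
    using LIMSEQ_Suc[OF suminf_exist_split2[OF summable_norm]] by simp
  hence "(\<lambda>N. norm (sieved N - 1)) \<longlonglongrightarrow> 0"
    by (rule Lim_null_comparison[rotated])
      (use bound in \<open>auto simp: eventually_sequentially intro!: exI[of _ 1]\<close>)
  thus ?thesis by (simp add: LIM_zero_iff tendsto_norm_zero_iff)
qed

end

text \<open>Passes from an inequality at each prime to one for the whole series: the losses exp
  (c/n^2) multiply to at most exp (2c), since the inverse squares sum to at most 2. Here the limit
  is bounded by the initial value, in the next lemma the initial value by the limit.\<close>

lemma quasi_monotone_limit_le:
  fixes G :: "nat \<Rightarrow> real"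
  assumes step: "\<And>N. G (Suc N) \<le> G N * exp (c / (real (Suc N))\<^sup>2)" and "c \<ge> 0" "G 1 \<ge> 0"
    and lim: "G \<longlonglongrightarrow> L"
  shows "L \<le> G 1 * exp (2 * c)"
proof (rule LIMSEQ_le_const2[OF lim], intro exI allI impI)
  fix N :: nat assume "1 \<le> N"
  hence "G N \<le> G 1 * exp (c * (\<Sum>k=2..N. 1 / (real k)\<^sup>2))"
  proof (induction N rule: dec_induct)
    case (step N)
    have "G (Suc N) \<le> G N * exp (c / (real (Suc N))\<^sup>2)" by (rule assms)
    also have "\<dots> \<le> G 1 * exp (c * (\<Sum>k=2..N. 1 / (real k)\<^sup>2)) * exp (c / (real (Suc N))\<^sup>2)"
      using step by (intro mult_right_mono) auto
    also have "\<dots> = G 1 * exp (c * (\<Sum>k=2..N. 1 / (real k)\<^sup>2) + c / (real (Suc N))\<^sup>2)"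
      by (simp add: exp_add)
    also have "c * (\<Sum>k=2..N. 1 / (real k)\<^sup>2) + c / (real (Suc N))\<^sup>2 =
        c * (\<Sum>k=2..Suc N. 1 / (real k)\<^sup>2)"
      using step by (simp add: distrib_left)
    finally show ?case .
  qed simp
  also have "\<dots> \<le> G 1 * exp (c * 2)"
  proof (intro mult_left_mono iffD2[OF exp_le_cancel_iff] assms)
    have "(\<Sum>k=2..N. 1 / (real k)\<^sup>2) \<le> (\<Sum>k=1..N. 1 / (real k)\<^sup>2)"
      by (intro sum_mono2) auto
    also have "\<dots> \<le> 2" by (rule sum_inverse_squares_le)
    finally show "(\<Sum>k=2..N. 1 / (real k)\<^sup>2) \<le> 2" .
  qed
  finally show "G N \<le> G 1 * exp (2 * c)" by (simp add: mult.commute)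
qed

lemma quasi_antimonotone_limit_ge:
  fixes G :: "nat \<Rightarrow> real"
  assumes step: "\<And>N. G N \<le> G (Suc N) * exp (c / (real (Suc N))\<^sup>2)" and "c \<ge> 0" "\<And>N. G N \<ge> 0"
    and lim: "G \<longlonglongrightarrow> L"
  shows "G 1 \<le> L * exp (2 * c)"
proof -
  have "(\<lambda>N. G N * exp (2 * c)) \<longlonglongrightarrow> L * exp (2 * c)"
    by (intro tendsto_intros lim)
  thus ?thesis
  proof (rule LIMSEQ_le_const, intro exI allI impI)
    fix N :: nat assume "1 \<le> N"
    hence "G 1 \<le> G N * exp (c * (\<Sum>k=2..N. 1 / (real k)\<^sup>2))"
    proof (induction N rule: dec_induct)
      case (step N)
      have "G 1 \<le> G N * exp (c * (\<Sum>k=2..N. 1 / (real k)\<^sup>2))" by (rule step)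
      also have "\<dots> \<le> G (Suc N) * exp (c / (real (Suc N))\<^sup>2) * exp (c * (\<Sum>k=2..N. 1 / (real k)\<^sup>2))"
        using assms by (intro mult_right_mono) auto
      also have "\<dots> = G (Suc N) * exp (c * (\<Sum>k=2..N. 1 / (real k)\<^sup>2) + c / (real (Suc N))\<^sup>2)"
        by (simp add: exp_add)
      also have "c * (\<Sum>k=2..N. 1 / (real k)\<^sup>2) + c / (real (Suc N))\<^sup>2 =
          c * (\<Sum>k=2..Suc N. 1 / (real k)\<^sup>2)"
        using step by (simp add: distrib_left)
      finally show ?case .
    qed simp
    also have "\<dots> \<le> G N * exp (c * 2)"
    proof (intro mult_left_mono iffD2[OF exp_le_cancel_iff] assms)
      have "(\<Sum>k=2..N. 1 / (real k)\<^sup>2) \<le> (\<Sum>k=1..N. 1 / (real k)\<^sup>2)"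
        by (intro sum_mono2) auto
      also have "\<dots> \<le> 2" by (rule sum_inverse_squares_le)
      finally show "(\<Sum>k=2..N. 1 / (real k)\<^sup>2) \<le> 2" .
    qed
    finally show "G 1 \<le> G N * exp (2 * c)" by (simp add: mult.commute)
  qed
qed

text \<open>The terms at \<open>n = 0\<close> vanish, since \<open>0 powr s = 0\<close>.\<close>

definition zeta_series :: "complex \<Rightarrow> complex" where
  "zeta_series s = (\<Sum>n. of_nat n powr (-s))"

definition liouville_series :: "complex \<Rightarrow> complex" where
  "liouville_series s = (\<Sum>n. of_int (liouville n) * of_nat n powr (-s))"

section \<open>Euler factor inequalities for the zeta and Liouville series\<close>

lemma norm_nat_powr: "norm ((of_nat n :: complex) powr (-s)) = real n powr (-Re s)"
proof (cases "n = 0")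
  case False
  thus ?thesis by (subst norm_powr_real_powr) auto
qed simp

lemma nat_powr_mult: "(of_nat (m * n) :: complex) powr s = of_nat m powr s * of_nat n powr s"
  by (simp add: powr_times_real)

lemma nat_powr_summable_completely_multiplicative:
  assumes "Re s > 1"
  shows "summable_completely_multiplicative (\<lambda>n. of_nat n powr (-s))"
proof
  show "summable (\<lambda>n. norm ((of_nat n :: complex) powr (-s)))"
    using assms by (simp add: norm_nat_powr summable_real_powr_iff)
qed (simp_all add: nat_powr_mult del: of_nat_mult)

lemma liouville_powr_summable_completely_multiplicative:
  assumes "Re s > 1"
  shows "summable_completely_multiplicative (\<lambda>n. of_int (liouville n) * of_nat n powr (-s))"
proof
  show "summable (\<lambda>n. norm (of_int (liouville n) * (of_nat n :: complex) powr (-s)))"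
    using assms by (simp add: norm_mult norm_nat_powr summable_real_powr_iff)
  show "of_int (liouville (m * n)) * (of_nat (m * n) :: complex) powr (-s) =
      of_int (liouville m) * of_nat m powr (-s) * (of_int (liouville n) * of_nat n powr (-s))" for m n
    by (cases "m = 0 \<or> n = 0") (auto simp: nat_powr_mult liouville_mult simp del: of_nat_mult)
qed simp_all

lemma prime_powr_le:
  assumes "prime p" "Re s > 1"
  shows "norm ((of_nat p :: complex) powr (-s)) \<le> 1 / p"
proof -
  have "real p powr (-Re s) \<le> real p powr (-1)"
    using assms prime_gt_0_nat[of p] by (intro powr_mono) (auto simp: Suc_le_eq)
  also have "real p powr (-1) = 1 / p"
    using assms prime_gt_0_nat[of p] by (simp add: powr_minus_divide)
  finally show ?thesis unfolding norm_nat_powr .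
qed

text \<open>With z = p^(-s) the two Euler factors multiply to (1 + z)(1 - z) = 1 - z^2, and |z^2| <=
  1/p^2. The product is therefore zeta(2s), but only its boundedness is needed: the loss exp (2/p^2)
  per prime gives exp 4 in total.\<close>

lemma norm_liouville_series_zeta_series_le:
  assumes s: "Re s > 1"
  shows "norm (liouville_series s) * norm (zeta_series s) \<le> exp 4"
proof -
  interpret L: summable_completely_multiplicative "\<lambda>n. of_int (liouville n) * of_nat n powr (-s)"
    by (rule liouville_powr_summable_completely_multiplicative[OF s])
  interpret Z: summable_completely_multiplicative "\<lambda>n. of_nat n powr (-s)"
    by (rule nat_powr_summable_completely_multiplicative[OF s])
  define G where "G N = norm (L.sieved N) * norm (Z.sieved N)" for N
  have "G 1 \<le> 1 * exp (2 * 2)"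
  proof (rule quasi_antimonotone_limit_ge)
    show "G \<longlonglongrightarrow> 1"
      using tendsto_mult[OF tendsto_norm[OF L.sieved_tendsto_1] tendsto_norm[OF Z.sieved_tendsto_1]]
      by (simp add: G_def[abs_def])
    fix N
    show "G N \<le> G (Suc N) * exp (2 / (real (Suc N))\<^sup>2)"
    proof (cases "prime (Suc N)")
      case True
      define z where "z = (of_nat (Suc N) :: complex) powr (-s)"
      have z: "norm z \<le> 1 / Suc N" unfolding z_def by (rule prime_powr_le[OF True s])
      define x where "x = 1 / (real (Suc N))\<^sup>2"
      have x: "0 \<le> x" "x \<le> 1 / 2"
      proof -
        have "real (Suc N) \<ge> 2" using prime_ge_2_nat[OF True] by linarith
        hence "(real (Suc N))\<^sup>2 \<ge> 2\<^sup>2" by (intro power_mono) auto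
        hence "1 / (real (Suc N))\<^sup>2 \<le> 1 / 2" by (intro divide_left_mono) auto
        thus "x \<le> 1 / 2" by (simp add: x_def)
      qed (simp add: x_def)
      have "norm z ^ 2 \<le> (1 / Suc N)\<^sup>2" using z by (intro power_mono) auto
      hence z2: "norm (z\<^sup>2) \<le> x" by (simp add: norm_power x_def power_divide)
      \<comment> \<open>For 0 <= x <= 1/2 already (1 - x)(1 + 2x) = 1 + x (1 - 2x) >= 1.\<close>
      have "1 \<le> (1 - x) * exp (2 * x)"
      proof -
        have "1 \<le> (1 - x) * (1 + 2 * x)"
          using x mult_left_mono[of "2 * x" 1 x] by (simp add: algebra_simps)
        also have "\<dots> \<le> (1 - x) * exp (2 * x)"
          using x exp_ge_add_one_self[of "2 * x"] by (intro mult_left_mono) auto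
        finally show ?thesis .
      qed
      also have "\<dots> \<le> norm (1 - z\<^sup>2) * exp (2 * x)"
        using z2 norm_triangle_ineq2[of 1 "z\<^sup>2"] by (intro mult_right_mono) auto
      finally have "G N * 1 \<le> G N * (norm (1 - z\<^sup>2) * exp (2 * x))"
        by (intro mult_left_mono) (auto simp: G_def)
      also have "1 - z\<^sup>2 = (1 + z) * (1 - z)" by (simp add: power2_eq_square algebra_simps)
      also have "G N * (norm ((1 + z) * (1 - z)) * exp (2 * x)) = G (Suc N) * exp (2 * x)"
        unfolding G_def L.sieved_Suc Z.sieved_Suc using True
        by (simp only: if_True liouville_prime[OF True] flip: z_def) (simp add: norm_mult)
      finally show ?thesis by (simp add: x_def)
    next
      case False
      have "G N * 1 \<le> G N * exp (2 / (real (Suc N))\<^sup>2)"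
        by (intro mult_left_mono) (auto simp: G_def)
      thus ?thesis using False by (simp add: G_def L.sieved_Suc Z.sieved_Suc)
    qed
  qed (auto simp: G_def)
  thus ?thesis
    by (simp add: G_def L.sieved_1 Z.sieved_1 liouville_series_def zeta_series_def)
qed

text \<open>The exponents come from \<open>3 + 4 cos \<theta> + cos (2\<theta>) \<ge> 0\<close>; the bound \<open>1 + x \<le> exp x\<close> loses
  only the convergent factor \<open>exp (8 r\<^sup>2)\<close>.\<close>

lemma norm_euler_factors_le:
  fixes w :: complex
  assumes w: "norm w = 1" and r: "r \<ge> 0"
  shows "norm (1 - of_real r :: complex) ^ 6 * norm (1 - of_real r * w) ^ 8 * norm (1 - of_real r * w\<^sup>2) ^ 2
    \<le> exp (8 * r\<^sup>2)"
proof -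
  have n: "norm (1 - of_real r * v) ^ 2 \<le> exp (r\<^sup>2 - 2 * r * Re v)" if "norm v = 1" for v :: complex
  proof -
    have v: "(Re v)\<^sup>2 + (Im v)\<^sup>2 = 1" using that by (metis cmod_power2 one_power2)
    have "norm (1 - of_real r * v) ^ 2 = (1 - r * Re v)\<^sup>2 + (r * Im v)\<^sup>2"
      by (simp add: cmod_power2)
    also have "\<dots> = 1 - 2 * r * Re v + r\<^sup>2 * ((Re v)\<^sup>2 + (Im v)\<^sup>2)"
      by (simp add: power2_eq_square algebra_simps)
    also have "\<dots> = 1 + (r\<^sup>2 - 2 * r * Re v)" by (simp add: v)
    also have "\<dots> \<le> exp (r\<^sup>2 - 2 * r * Re v)" by (rule exp_ge_add_one_self)
    finally show ?thesis .
  qed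
  \<comment> \<open>The exponents 6, 8, 2 are doubled from 3, 4, 1 so that only squared moduli
    occur, which are polynomials in the real part.\<close>
  have "norm (1 - of_real r :: complex) ^ 6 * norm (1 - of_real r * w) ^ 8 * norm (1 - of_real r * w\<^sup>2) ^ 2 =
    (norm (1 - of_real r * (1::complex)) ^ 2) ^ 3 * (norm (1 - of_real r * w) ^ 2) ^ 4 * norm (1 - of_real r * w\<^sup>2) ^ 2"
    by (simp flip: power_mult)
  also have "\<dots> \<le> exp (r\<^sup>2 - 2 * r * Re 1) ^ 3 * exp (r\<^sup>2 - 2 * r * Re w) ^ 4 * exp (r\<^sup>2 - 2 * r * Re (w\<^sup>2))"
    using w by (intro mult_mono power_mono n mult_nonneg_nonneg) (auto simp: norm_power)
  also have "\<dots> = exp (3 * (r\<^sup>2 - 2 * r) + 4 * (r\<^sup>2 - 2 * r * Re w) + (r\<^sup>2 - 2 * r * Re (w\<^sup>2)))"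
  proof -
    have "exp x ^ 3 = exp (3 * x)" "exp x ^ 4 = exp (4 * x)" for x :: real
      using exp_of_nat_mult[of 3 x] exp_of_nat_mult[of 4 x] by simp_all
    thus ?thesis by (simp only: exp_add one_complex.sel mult_1_right)
  qed
  \<comment> \<open>With this the terms linear in r combine to a negative multiple of the square (1
    + Re w)^2, because 3 + 4c + (2c^2 - 1) = 2 (1 + c)^2.\<close>
  also have "Re (w\<^sup>2) = 2 * (Re w)\<^sup>2 - 1"
    using w cmod_power2[of w] by (simp add: power2_eq_square)
  also have "3 * (r\<^sup>2 - 2 * r) + 4 * (r\<^sup>2 - 2 * r * Re w) + (r\<^sup>2 - 2 * r * (2 * (Re w)\<^sup>2 - 1)) =
      8 * r\<^sup>2 - 4 * r * (1 + Re w)\<^sup>2"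
    by (simp add: power2_eq_square algebra_simps)
  also have "\<dots> \<le> 8 * r\<^sup>2" using r by simp
  finally show ?thesis by simp
qed

section \<open>The zeta function in the half-plane of absolute convergence\<close>

lemma norm_real_powr:
  assumes "v > 0"
  shows "norm ((of_real v :: complex) powr s) = v powr Re s"
  using assms by (subst norm_powr_real_powr) auto

text \<open>Removing the factors of a prime p multiplies G by the quantity of
  \<open>norm_euler_factors_le\<close> with r = p^(-1-\<delta>) <= 1/p, so G grows by at most exp
  (8/p^2). As G tends to 1, its initial value, the product of zeta values, is at least exp
  (-16).\<close>

lemma zeta_series_3_4_1:
  assumes "\<delta> > 0"
  shows "exp (- 16) \<le> norm (zeta_series (Complex (1 + \<delta>) 0)) ^ 6 *
    norm (zeta_series (Complex (1 + \<delta>) t)) ^ 8 * norm (zeta_series (Complex (1 + \<delta>) (2 * t))) ^ 2"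
proof -
  interpret Z0: summable_completely_multiplicative "\<lambda>n. of_nat n powr (- Complex (1 + \<delta>) 0)"
    by (rule nat_powr_summable_completely_multiplicative) (use assms in simp)
  interpret Z1: summable_completely_multiplicative "\<lambda>n. of_nat n powr (- Complex (1 + \<delta>) t)"
    by (rule nat_powr_summable_completely_multiplicative) (use assms in simp)
  interpret Z2: summable_completely_multiplicative "\<lambda>n. of_nat n powr (- Complex (1 + \<delta>) (2 * t))"
    by (rule nat_powr_summable_completely_multiplicative) (use assms in simp)
  define G where "G N = norm (Z0.sieved N) ^ 6 * norm (Z1.sieved N) ^ 8 * norm (Z2.sieved N) ^ 2" for N
  have "1 \<le> G 1 * exp (2 * 8)"
  proof (rule quasi_monotone_limit_le)
    have "(\<lambda>N. norm (Z0.sieved N) ^ 6 * norm (Z1.sieved N) ^ 8 * norm (Z2.sieved N) ^ 2)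
        \<longlonglongrightarrow> norm (1::complex) ^ 6 * norm (1::complex) ^ 8 * norm (1::complex) ^ 2"
      by (intro tendsto_intros Z0.sieved_tendsto_1 Z1.sieved_tendsto_1 Z2.sieved_tendsto_1)
    thus "G \<longlonglongrightarrow> 1" by (simp add: G_def[abs_def])
    fix N
    show "G (Suc N) \<le> G N * exp (8 / (real (Suc N))\<^sup>2)"
    proof (cases "prime (Suc N)")
      case True
      define p where "p = real (Suc N)"
      define r where "r = p powr (- (1 + \<delta>))"
      define w where "w = (of_real p :: complex) powr (- Complex 0 t)"
      have p: "p > 0" by (simp add: p_def)
      have "norm ((of_nat (Suc N) :: complex) powr (- Complex (1 + \<delta>) 0)) \<le> 1 / Suc N"
        using True assms by (intro prime_powr_le) auto
      hence r: "0 \<le> r" "r \<le> 1 / p"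
        unfolding norm_nat_powr by (simp_all add: r_def p_def)
      have w: "norm w = 1" using p unfolding w_def by (subst norm_real_powr) auto
      have f: "(of_nat (Suc N) :: complex) powr (- Complex (1 + \<delta>) (k * t)) = of_real r * of_real p powr (- Complex 0 (k * t))" for k
      proof -
        have "- Complex (1 + \<delta>) (k * t) = of_real (- (1 + \<delta>)) + (- Complex 0 (k * t))"
          by (simp add: complex_eq_iff)
        hence "(of_real p :: complex) powr (- Complex (1 + \<delta>) (k * t)) =
            of_real p powr of_real (- (1 + \<delta>)) * of_real p powr (- Complex 0 (k * t))"
          by (simp only: powr_add)
        moreover have "(of_real p :: complex) powr of_real (- (1 + \<delta>)) = of_real r"
          unfolding r_def using p by (intro powr_of_real) auto
        moreover have "(of_nat (Suc N) :: complex) = of_real p" by (simp add: p_def)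
        ultimately show ?thesis by (simp only:)
      qed
      have f0: "(of_nat (Suc N) :: complex) powr (- Complex (1 + \<delta>) 0) = of_real r"
        using f[of 0] p by (simp add: Complex_eq)
      have f1: "(of_nat (Suc N) :: complex) powr (- Complex (1 + \<delta>) t) = of_real r * w"
        using f[of 1] by (simp add: w_def)
      have f2: "(of_nat (Suc N) :: complex) powr (- Complex (1 + \<delta>) (2 * t)) = of_real r * w\<^sup>2"
      proof -
        have "- Complex 0 (2 * t) = (- Complex 0 t) + (- Complex 0 t)" by (simp add: complex_eq_iff)
        hence "of_real p powr (- Complex 0 (2 * t)) = w\<^sup>2"
          unfolding w_def power2_eq_square by (simp only: powr_add)
        thus ?thesis using f[of 2] by simp
      qed
      have "G (Suc N) = (norm (1 - of_real r :: complex) ^ 6 * norm (1 - of_real r * w) ^ 8 *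
          norm (1 - of_real r * w\<^sup>2) ^ 2) * G N"
        unfolding G_def Z0.sieved_Suc Z1.sieved_Suc Z2.sieved_Suc if_P[OF True] f0 f1 f2 norm_mult
          power_mult_distrib by (simp only: mult_ac)
      also have "\<dots> \<le> exp (8 * r\<^sup>2) * G N"
        by (intro mult_right_mono norm_euler_factors_le w r) (auto simp: G_def)
      also have "\<dots> \<le> exp (8 / p\<^sup>2) * G N"
      proof -
        have "r\<^sup>2 \<le> (1 / p)\<^sup>2" using r by (intro power_mono) auto
        thus ?thesis by (intro mult_right_mono) (auto simp: G_def power_divide)
      qed
      finally show ?thesis by (simp add: p_def mult.commute)
    next
      case False
      have "G N * 1 \<le> G N * exp (8 / (real (Suc N))\<^sup>2)"
        by (intro mult_left_mono) (auto simp: G_def)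
      thus ?thesis using False by (simp add: G_def Z0.sieved_Suc Z1.sieved_Suc Z2.sieved_Suc)
    qed
  qed (auto simp: G_def)
  hence "exp (- 16) * 1 \<le> exp (- 16) * (G 1 * exp 16)" by (intro mult_left_mono) auto
  also have "\<dots> = G 1" by (simp add: exp_minus field_simps)
  finally show ?thesis
    by (simp add: G_def Z0.sieved_1 Z1.sieved_1 Z2.sieved_1 zeta_series_def)
qed

section \<open>Comparison of sums with integrals\<close>

text \<open>First-order Euler-Maclaurin: the integral of k over [a, a+1] differs from k(a) by at
  most the supremum of |k'|. The mean value inequality is applied to k and then to K(z) - k(a) z on
  the real segment.\<close>

lemma antiderivative_difference_le:
  fixes K k k' :: "complex \<Rightarrow> complex" and a B :: real
  assumes K: "\<And>v. a \<le> v \<Longrightarrow> (K has_field_derivative k (of_real v)) (at (of_real v))"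
    and k: "\<And>v. a \<le> v \<Longrightarrow> (k has_field_derivative k' (of_real v)) (at (of_real v))"
    and B: "\<And>v. a \<le> v \<Longrightarrow> v \<le> a + 1 \<Longrightarrow> norm (k' (of_real v)) \<le> B"
  shows "norm (K (of_real (a + 1)) - K (of_real a) - k (of_real a)) \<le> B"
proof -
  define S where "S = closed_segment (of_real a :: complex) (of_real (a + 1))"
  have S: "\<exists>v. z = of_real v \<and> a \<le> v \<and> v \<le> a + 1" if "z \<in> S" for z
    using that unfolding S_def closed_segment_of_real by (auto simp: closed_segment_eq_real_ivl)
  have ends: "of_real a \<in> S" "of_real (a + 1) \<in> S" by (auto simp: S_def)
  have cvx: "convex S" by (simp add: S_def)
  have B0: "B \<ge> 0" using B[of a] norm_ge_zero order_trans by (metis add_increasing2 order_refl zero_le_one)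
  have *: "norm (k z - k (of_real a)) \<le> B" if z: "z \<in> S" for z
  proof -
    have "norm (k z - k (of_real a)) \<le> B * norm (z - of_real a)"
    proof (rule field_differentiable_bound[OF cvx _ _ z ends(1)])
      fix y assume "y \<in> S"
      with S obtain v where v: "y = of_real v" "a \<le> v" "v \<le> a + 1" by blast
      show "(k has_field_derivative k' y) (at y within S)" "norm (k' y) \<le> B"
        using k[of v] B[of v] v by (auto intro: has_field_derivative_at_within)
    qed
    also have "norm (z - of_real a) \<le> 1"
    proof -
      obtain v where v: "z = of_real v" "a \<le> v" "v \<le> a + 1" using S[OF z] by blast
      have "norm (z - of_real a) = \<bar>v - a\<bar>" unfolding v(1) by (metis norm_of_real of_real_diff)
      thus ?thesis using v by simp
    qed
    finally show ?thesis using B0 by (simp add: mult_left_mono)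
  qed
  have "norm ((K (of_real (a + 1)) - k (of_real a) * of_real (a + 1)) -
      (K (of_real a) - k (of_real a) * of_real a)) \<le> B * norm (of_real (a + 1) - of_real a :: complex)"
  proof (rule field_differentiable_bound[OF cvx _ _ ends(2,1)])
    fix z assume z: "z \<in> S"
    then obtain v where v: "z = of_real v" "a \<le> v" "v \<le> a + 1" using S by blast
    have "(K has_field_derivative k z) (at z within S)"
      using K[of v] v by (auto intro: has_field_derivative_at_within)
    thus "((\<lambda>z. K z - k (of_real a) * z) has_field_derivative k z - k (of_real a)) (at z within S)"
      by (auto intro!: derivative_eq_intros)
    show "norm (k z - k (of_real a)) \<le> B" by (rule *[OF z])
  qed
  moreover have "norm (of_real (a + 1) - of_real a :: complex) = 1" by simp
  ultimately show ?thesis by (simp add: algebra_simps)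
qed

text \<open>A telescoping majorant for a^(-3/2), which makes error sums explicit without
  integration.\<close>

lemma inverse_mult_sqrt_le:
  assumes "a \<ge> 1"
  shows "1 / (a * sqrt a) \<le> 4 * (1 / sqrt a - 1 / sqrt (a + 1))"
proof -
  define x where "x = sqrt a"
  define y where "y = sqrt (a + 1)"
  have x: "x \<ge> 1" "x\<^sup>2 = a" and y: "y > 0" "y\<^sup>2 = x\<^sup>2 + 1"
    using assms by (auto simp: x_def y_def)
  have "y\<^sup>2 \<le> 2 * x\<^sup>2" using y(2) x one_le_power[of x 2] by linarith
  moreover have "2 * (x * y) \<le> x\<^sup>2 + y\<^sup>2"
    using zero_le_power2[of "x - y"] by (simp add: power2_diff)
  moreover have "y * (x + y) = x * y + y\<^sup>2" "0 \<le> x\<^sup>2"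
    by (simp_all add: power2_eq_square algebra_simps)
  ultimately have "y * (x + y) \<le> 4 * x\<^sup>2" by linarith
  hence "4 / (x * (4 * x\<^sup>2)) \<le> 4 / (x * (y * (x + y)))"
    using x(1) y(1) by (intro divide_left_mono mult_left_mono mult_pos_pos) auto
  also have "4 / (x * (y * (x + y))) = 4 * ((y - x) * (x + y) / (x * (y * (x + y))))"
    using y(2) by (simp add: algebra_simps power2_eq_square)
  also have "(y - x) * (x + y) / (x * (y * (x + y))) = (y - x) / (x * y)"
    using x(1) y(1) mult_divide_mult_cancel_right[of "x + y" "y - x" "x * y"] by (simp add: mult_ac)
  also have "(y - x) / (x * y) = 1 / x - 1 / y"
    using x(1) y(1) by (simp add: diff_divide_distrib)
  finally have "1 / (x * x\<^sup>2) \<le> 4 * (1 / x - 1 / y)" by simp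
  thus ?thesis unfolding x(2) by (simp add: x_def y_def mult.commute)
qed

text \<open>As K tends to 0, its increments from N on sum to - K N, while the assumed error terms
  telescope to D / sqrt N.\<close>

lemma norm_series_plus_antiderivative_le:
  fixes K k :: "nat \<Rightarrow> complex"
  assumes diff: "\<And>n. n \<ge> N \<Longrightarrow> norm (K (Suc n) - K n - k n) \<le> D * (1 / sqrt n - 1 / sqrt (Suc n))"
    and K: "K \<longlonglongrightarrow> 0" and k: "summable k"
  shows "norm ((\<Sum>n. k (n + N)) + K N) \<le> D / sqrt N"
proof -
  have 1: "(\<lambda>n. K (Suc n + N) - K (n + N)) sums (0 - K (0 + N))"
    by (rule telescope_sums) (rule LIMSEQ_ignore_initial_segment[OF K])
  have 2: "(\<lambda>n. k (n + N)) sums (\<Sum>n. k (n + N))"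
    using k by (intro summable_sums) (simp add: summable_iff_shift)
  have "(\<lambda>n. 1 / sqrt (real n)) \<longlonglongrightarrow> 0" by real_asymp
  hence 3: "(\<lambda>n. 1 / sqrt (real (n + N)) - 1 / sqrt (real (Suc n + N))) sums (1 / sqrt (real (0 + N)) - 0)"
    by (intro telescope_sums') (rule LIMSEQ_ignore_initial_segment)
  have "norm (0 - K (0 + N) - (\<Sum>n. k (n + N))) \<le> D * (1 / sqrt (real (0 + N)) - 0)"
  proof (rule norm_sums_le[OF sums_diff[OF 1 2] sums_mult[OF 3]])
    fix n show "norm (K (Suc n + N) - K (n + N) - k (n + N)) \<le>
        D * (1 / sqrt (real (n + N)) - 1 / sqrt (real (Suc n + N)))"
      using diff[of "n + N"] by simp
  qed
  moreover have "0 - K (0 + N) - (\<Sum>n. k (n + N)) = - ((\<Sum>n. k (n + N)) + K N)" by simp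
  ultimately show ?thesis by (simp only: norm_minus_cancel) simp
qed

lemma has_derivative_powr_antiderivative:
  assumes "v > 0" "s \<noteq> 1"
  shows "((\<lambda>z. z powr (1 - s) / (1 - s)) has_field_derivative (of_real v) powr (-s)) (at (of_real v :: complex))"
proof -
  have "(of_real v :: complex) \<notin> \<real>\<^sub>\<le>\<^sub>0" using assms by (simp add: complex_nonpos_Reals_iff)
  note DERIV_cdivide[OF has_field_derivative_powr[OF this, of "1 - s"], of "1 - s"]
  moreover have "(1 - s) * of_real v powr (1 - s - 1) / (1 - s) = of_real v powr (-s)"
    using assms(2) by simp
  ultimately show ?thesis by (simp only:)
qed

lemma has_derivative_powr_uminus:
  assumes "v > 0"
  shows "((\<lambda>z. z powr (-s)) has_field_derivative (-s) * (of_real v) powr (-s-1)) (at (of_real v :: complex))"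
proof -
  have "(of_real v :: complex) \<notin> \<real>\<^sub>\<le>\<^sub>0" using assms by (simp add: complex_nonpos_Reals_iff)
  from has_field_derivative_powr[OF this, of "-s"] show ?thesis by simp
qed

lemma powr_antiderivative_tendsto_0:
  assumes "Re s > 1"
  shows "(\<lambda>n. (of_nat n :: complex) powr (1 - s) / (1 - s)) \<longlonglongrightarrow> 0"
proof -
  have "(\<lambda>n. real n powr (1 - Re s) / norm (1 - s)) \<longlonglongrightarrow> 0 / norm (1 - s)"
    using assms by (intro tendsto_intros tendsto_neg_powr filterlim_real_sequentially) auto
  moreover have "norm ((of_nat n :: complex) powr (1 - s) / (1 - s)) = real n powr (1 - Re s) / norm (1 - s)" for n
    using norm_nat_powr[of n "s - 1"] by (simp add: norm_divide)
  ultimately have "(\<lambda>n. norm ((of_nat n :: complex) powr (1 - s) / (1 - s))) \<longlonglongrightarrow> 0" by simp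
  thus ?thesis by (rule tendsto_norm_zero_cancel)
qed

lemma summable_nat_powr: "Re s > 1 \<Longrightarrow> summable (\<lambda>n. (of_nat n :: complex) powr (-s))"
  using summable_completely_multiplicative.summable_norm[OF nat_powr_summable_completely_multiplicative]
  by (rule summable_norm_cancel)

text \<open>The comparison with the integral from N = 1 on, where the antiderivative has the value
  1/(1 - s), minus the polar term.\<close>

lemma norm_zeta_series_minus_pole_le:
  assumes s: "Re s > 1"
  shows "norm (zeta_series s - 1 / (s - 1)) \<le> 4 * norm s"
proof -
  have s1: "s \<noteq> 1" using s by auto
  have "norm ((\<Sum>n. (of_nat (n + 1) :: complex) powr (-s)) + of_nat 1 powr (1 - s) / (1 - s)) \<le> 4 * norm s / sqrt (real 1)"
  proof (rule norm_series_plus_antiderivative_le[OF _ powr_antiderivative_tendsto_0[OF s] summable_nat_powr[OF s]])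
    fix n :: nat assume n: "n \<ge> 1"
    have "norm ((of_real (real n + 1) :: complex) powr (1 - s) / (1 - s) - of_real (real n) powr (1 - s) / (1 - s) -
        of_real (real n) powr (-s)) \<le> norm s * (1 / (real n * sqrt n))"
    proof (rule antiderivative_difference_le[where k' = "\<lambda>z. (-s) * z powr (-s-1)"])
      fix v assume v: "real n \<le> v"
      with n have v0: "v > 0" "v \<ge> 1" by auto
      show "((\<lambda>z. z powr (1 - s) / (1 - s)) has_field_derivative (of_real v) powr (-s)) (at (of_real v :: complex))"
        using v0 s1 by (intro has_derivative_powr_antiderivative)
      show "((\<lambda>z. z powr (-s)) has_field_derivative (-s) * (of_real v) powr (-s-1)) (at (of_real v :: complex))"
        using v0 by (intro has_derivative_powr_uminus)
      have "norm ((-s) * (of_real v :: complex) powr (-s-1)) = norm s * v powr (-Re s - 1)"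
        using v0 by (simp add: norm_mult norm_real_powr)
      \<comment> \<open>The exponent is relaxed to -3/2, the one that
        \<open>inverse_mult_sqrt_le\<close> telescopes.\<close>
      also have "v powr (-Re s - 1) \<le> v powr (- 3 / 2)"
        using v0 s by (intro powr_mono) auto
      also have "\<dots> \<le> real n powr (- 3 / 2)"
        using v n by (intro powr_mono2') auto
      also have "\<dots> = 1 / (real n * sqrt n)"
        using n powr_add[of "real n" 1 "1/2"] by (simp add: powr_minus_divide powr_half_sqrt)
      finally show "norm ((-s) * (of_real v :: complex) powr (-s-1)) \<le> norm s * (1 / (real n * sqrt n))"
        by (simp add: mult_left_mono)
    qed
    also have "\<dots> \<le> norm s * (4 * (1 / sqrt n - 1 / sqrt (real n + 1)))"
      using n by (intro mult_left_mono inverse_mult_sqrt_le) auto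
    finally show "norm ((of_nat (Suc n) :: complex) powr (1 - s) / (1 - s) - of_nat n powr (1 - s) / (1 - s) -
        of_nat n powr (-s)) \<le> 4 * norm s * (1 / sqrt n - 1 / sqrt (Suc n))"
      by (simp add: add.commute mult_ac)
  qed
  moreover have "zeta_series s = (\<Sum>n. (of_nat (n + 1) :: complex) powr (-s))"
    unfolding zeta_series_def using suminf_split_initial_segment[OF summable_nat_powr[OF s], of 1] by simp
  moreover have "1 / (1 - s) = - (1 / (s - 1))" using s1 by (simp add: field_simps)
  ultimately show ?thesis by simp
qed

section \<open>Lipschitz dependence of zeta on the real part\<close>

lemma abs_exp_diff_le:
  fixes x y :: real
  assumes "x \<le> 0" "y \<le> 0"
  shows "\<bar>exp x - exp y\<bar> \<le> \<bar>x - y\<bar>"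
proof -
  have *: "\<bar>exp x - exp y\<bar> \<le> \<bar>x - y\<bar>" if "x \<le> y" "y \<le> 0" for x y :: real
  proof -
    define E where "E = exp (x - y)"
    have E: "1 + (x - y) \<le> E" unfolding E_def by (rule exp_ge_add_one_self)
    have "exp y - exp x = exp y * (1 - E)"
      by (simp add: right_diff_distrib E_def flip: exp_add)
    also have "\<dots> \<le> 1 * (1 - E)"
      using that by (intro mult_right_mono) (auto simp: E_def)
    also have "\<dots> \<le> y - x"
      using E by (simp add: algebra_simps)
    finally have "exp y - exp x \<le> y - x" .
    thus ?thesis using that by (simp add: abs_if)
  qed
  show ?thesis using *[of x y] *[of y x] assms by (cases "x \<le> y") (auto simp: abs_minus_commute)
qed

lemma abs_powr_diff_le:
  fixes v :: real
  assumes "v \<ge> 1" "\<delta> \<ge> 0" "\<eta> \<ge> 0"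
  shows "\<bar>v powr (-\<delta>) - v powr (-\<eta>)\<bar> \<le> \<bar>\<delta> - \<eta>\<bar> * ln v"
proof -
  have "\<bar>exp (-\<delta> * ln v) - exp (-\<eta> * ln v)\<bar> \<le> \<bar>-\<delta> * ln v - (-\<eta> * ln v)\<bar>"
    using assms by (intro abs_exp_diff_le) (auto simp: mult_nonneg_nonneg)
  also have "-\<delta> * ln v - (-\<eta> * ln v) = -(\<delta> - \<eta>) * ln v" by (simp add: algebra_simps)
  also have "\<bar>\<dots>\<bar> = \<bar>\<delta> - \<eta>\<bar> * ln v"
    using assms by (simp add: abs_mult abs_minus_commute[of \<eta> \<delta>])
  finally show ?thesis using assms by (simp add: powr_def)
qed

text \<open>Separates the real power from the oscillating factor, which depends only on x and t;
  differences in \<delta> thus reduce to differences of real powers.\<close>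

lemma powr_Complex_split:
  assumes "v > 0"
  shows "(of_real v :: complex) powr (- Complex (x + \<delta>) t) = of_real (v powr (-\<delta>)) * of_real v powr (- Complex x t)"
proof -
  have "- Complex (x + \<delta>) t = of_real (-\<delta>) + (- Complex x t)"
    by (simp add: complex_eq_iff)
  hence "(of_real v :: complex) powr (- Complex (x + \<delta>) t) =
      of_real v powr of_real (-\<delta>) * of_real v powr (- Complex x t)"
    by (simp only: powr_add)
  moreover have "(of_real v :: complex) powr of_real (-\<delta>) = of_real (v powr (-\<delta>))"
    using assms by (intro powr_of_real) auto
  ultimately show ?thesis by (simp only:)
qed

lemma norm_powr_Complex_diff_le:
  assumes "v \<ge> 1" "\<delta> \<ge> 0" "\<eta> \<ge> 0"
  shows "norm ((of_real v :: complex) powr (- Complex (1 + \<delta>) t) - of_real v powr (- Complex (1 + \<eta>) t))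
    \<le> \<bar>\<delta> - \<eta>\<bar> * (ln v / v)"
proof -
  have v: "v > 0" using assms by simp
  have "norm ((of_real v :: complex) powr (- Complex (1 + \<delta>) t) - of_real v powr (- Complex (1 + \<eta>) t)) =
     norm (of_real (v powr (-\<delta>) - v powr (-\<eta>)) * (of_real v :: complex) powr (- Complex 1 t))"
    unfolding powr_Complex_split[OF v] by (simp add: algebra_simps)
  also have "\<dots> = \<bar>v powr (-\<delta>) - v powr (-\<eta>)\<bar> * v powr (-1)"
    using v by (simp add: norm_mult norm_real_powr del: of_real_diff)
  also have "v powr (-1) = 1 / v" using v by (simp add: powr_minus_divide)
  also have "\<bar>v powr (-\<delta>) - v powr (-\<eta>)\<bar> * (1 / v) \<le> (\<bar>\<delta> - \<eta>\<bar> * ln v) * (1 / v)"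
    using v assms by (intro mult_right_mono abs_powr_diff_le) auto
  finally show ?thesis by simp
qed

text \<open>Both factors of - s v^(-s-1) depend on the real part: the first contributes |\<delta> -
  \<eta>|, the second the same with the additional factor \<open>norm s' * ln v\<close>.\<close>

lemma norm_powr_Complex_deriv_diff_le:
  fixes t :: real
  assumes v: "v \<ge> 1" and "\<delta> \<ge> 0" "\<eta> \<ge> 0"
  defines "s \<equiv> Complex (1 + \<delta>) t" and "s' \<equiv> Complex (1 + \<eta>) t"
  shows "norm ((-s) * (of_real v :: complex) powr (-s-1) - (-s') * of_real v powr (-s'-1))
    \<le> \<bar>\<delta> - \<eta>\<bar> * (1 + norm s' * ln v) / v\<^sup>2"
proof -
  have v0: "v > 0" using v by simp
  define u where "u = (of_real v :: complex) powr (- Complex 2 t)"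
  have "-s-1 = - Complex (2 + \<delta>) t" "-s'-1 = - Complex (2 + \<eta>) t"
    by (simp_all add: s_def s'_def complex_eq_iff)
  hence pow: "(of_real v :: complex) powr (-s-1) = of_real (v powr (-\<delta>)) * u"
      "(of_real v :: complex) powr (-s'-1) = of_real (v powr (-\<eta>)) * u"
    unfolding u_def by (simp_all only: powr_Complex_split[OF v0])
  have s: "s = s' + of_real (\<delta> - \<eta>)" by (simp add: s_def s'_def complex_eq_iff)
  have "(-s) * (of_real v :: complex) powr (-s-1) - (-s') * of_real v powr (-s'-1) =
     (of_real (\<eta> - \<delta>) * of_real (v powr (-\<delta>)) + s' * of_real (v powr (-\<eta>) - v powr (-\<delta>))) * u"
    unfolding pow by (subst s) (simp add: algebra_simps)
  hence "norm ((-s) * (of_real v :: complex) powr (-s-1) - (-s') * of_real v powr (-s'-1)) =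
     norm (of_real (\<eta> - \<delta>) * of_real (v powr (-\<delta>)) + s' * of_real (v powr (-\<eta>) - v powr (-\<delta>))) * norm u"
    by (simp only: norm_mult)
  also have "norm u = 1 / v\<^sup>2"
    using v0 unfolding u_def by (subst norm_real_powr) (auto simp: powr_minus_divide powr_numeral)
  also have "norm (of_real (\<eta> - \<delta>) * of_real (v powr (-\<delta>)) + s' * of_real (v powr (-\<eta>) - v powr (-\<delta>))) \<le>
     norm (of_real (\<eta> - \<delta>) * of_real (v powr (-\<delta>)) :: complex) + norm (s' * of_real (v powr (-\<eta>) - v powr (-\<delta>)))"
    by (rule norm_triangle_ineq)
  also have "\<dots> = \<bar>\<eta> - \<delta>\<bar> * v powr (-\<delta>) + norm s' * \<bar>v powr (-\<eta>) - v powr (-\<delta>)\<bar>"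
    using v0 by (simp add: norm_mult del: of_real_diff)
  also have "\<dots> \<le> \<bar>\<eta> - \<delta>\<bar> * 1 + norm s' * (\<bar>\<eta> - \<delta>\<bar> * ln v)"
    using assms powr_mono[of "-\<delta>" 0 v] by (intro add_mono mult_left_mono abs_powr_diff_le) auto
  also have "\<dots> = \<bar>\<delta> - \<eta>\<bar> * (1 + norm s' * ln v)"
    by (simp add: algebra_simps abs_minus_commute)
  finally show ?thesis by (simp add: divide_right_mono)
qed

lemma ln_add_one_le_sqrt:
  assumes "a \<ge> 1"
  shows "ln (a + 1) \<le> 2 * sqrt a"
proof -
  have "ln (a + 1) = 2 * ln (sqrt (a + 1))" using assms by (simp add: ln_sqrt)
  also have "\<dots> \<le> 2 * (sqrt (a + 1) - 1)" using assms by (intro mult_left_mono ln_le_minus_one) auto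
  also have "sqrt (a + 1) \<le> sqrt a + 1"
    using assms sqrt_add_le_add_sqrt[of a 1] by simp
  finally show ?thesis by simp
qed

text \<open>The lower bound for \<open>\<bar>\<zeta>\<bar>\<close> below is a multiple of \<open>zeta_majorant t ^ (-4)\<close>. Square
  integrability of its inverse divided by \<open>t\<close> requires an exponent smaller than \<open>1/8\<close> here.\<close>

definition zeta_majorant :: "real \<Rightarrow> real" where
  "zeta_majorant t = 2600000 * (\<bar>t\<bar> + 2) powr (1 / 16)"

lemma zeta_majorant_ge: "2600000 \<le> zeta_majorant t"
  using ge_one_powr_ge_zero[of "\<bar>t\<bar> + 2" "1/16"] by (simp add: zeta_majorant_def)

text \<open>Stands in for the classical estimate zeta'(s) = O(log^2 |t|) near Re s = 1. The series
  of differences is cut at N of order t^2: the head costs a logarithm times a harmonic sum, the tail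
  is replaced by - K(N) with an error of order |s'| / sqrt N, and every part keeps the factor
  d.\<close>

lemma norm_zeta_series_diff_le:
  assumes \<delta>: "0 < \<delta>" "\<delta> \<le> 1" and \<eta>: "0 < \<eta>" "\<eta> \<le> 1" and t: "\<bar>t\<bar> \<ge> 1 / 16"
  shows "norm (zeta_series (Complex (1 + \<delta>) t) - zeta_series (Complex (1 + \<eta>) t)) \<le> zeta_majorant t * \<bar>\<delta> - \<eta>\<bar>"
proof -
  define s s' where "s = Complex (1 + \<delta>) t" and "s' = Complex (1 + \<eta>) t"
  define \<tau> where "\<tau> = \<bar>t\<bar> + 2"
  \<comment> \<open>Ensures sqrt N >= \<tau> >= |s'|, so the error of the tail is at most a constant
    times d.\<close>
  define N where "N = nat \<lceil>\<tau>\<^sup>2\<rceil>"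
  define d where "d = \<bar>\<delta> - \<eta>\<bar>"
  have \<tau>: "\<tau> \<ge> 2" by (simp add: \<tau>_def)
  have \<tau>2: "\<tau>\<^sup>2 \<ge> 4" using power_mono[OF \<tau>, of 2] by simp
  have N: "real N \<ge> \<tau>\<^sup>2" "real N \<le> \<tau>\<^sup>2 + 1" "N \<ge> 1"
    using \<tau>2 unfolding N_def by linarith+
  have s: "Re s > 1" "Re s' > 1" using \<delta> \<eta> by (auto simp: s_def s'_def)
  have d0: "d \<ge> 0" by (simp add: d_def)
  \<comment> \<open>Terms and antiderivatives are subtracted before sum and integral are compared;
    comparing each zeta value separately would lose the factor d.\<close>
  define k where "k z = z powr (-s) - z powr (-s')" for z :: complex
  define K where "K z = z powr (1 - s) / (1 - s) - z powr (1 - s') / (1 - s')" for z :: complex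
  define k' where "k' z = (-s) * z powr (-s-1) - (-s') * z powr (-s'-1)" for z :: complex
  define L where "L = ln (real N)"
  have L0: "L \<ge> 0" using N by (simp add: L_def)
  have norm_s': "norm s' \<le> \<tau>"
    unfolding s'_def \<tau>_def using cmod_le[of "Complex (1 + \<eta>) t"] \<eta> by simp
  have sum_k: "summable (\<lambda>n. k (of_nat n))"
    unfolding k_def using s by (intro summable_diff summable_nat_powr)
  have tail: "norm ((\<Sum>n. k (of_nat (n + N))) + K (of_nat N)) \<le> 4 * d * (1 + 2 * norm s') / sqrt N"
  proof (rule norm_series_plus_antiderivative_le[OF _ _ sum_k])
    show "(\<lambda>n. K (of_nat n)) \<longlonglongrightarrow> 0"
      unfolding K_def using tendsto_diff[OF powr_antiderivative_tendsto_0[OF s(1)] powr_antiderivative_tendsto_0[OF s(2)]] by simp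
    fix n assume n: "n \<ge> N"
    with N have n1: "real n \<ge> 1" by simp
    have "norm (K (of_real (real n + 1)) - K (of_real (real n)) - k (of_real (real n))) \<le>
       d * (1 + norm s' * (2 * sqrt n)) / (real n)\<^sup>2"
    proof (rule antiderivative_difference_le)
      fix v assume v: "real n \<le> v"
      with n1 have v0: "v > 0" "v \<ge> 1" by auto
      show "(K has_field_derivative k (of_real v)) (at (of_real v))"
        unfolding K_def k_def using s v0
        by (intro DERIV_diff has_derivative_powr_antiderivative) auto
      show "(k has_field_derivative k' (of_real v)) (at (of_real v))"
        unfolding k_def k'_def using v0 by (intro DERIV_diff has_derivative_powr_uminus)
      assume v2: "v \<le> real n + 1"
      have "norm (k' (of_real v)) \<le> d * (1 + norm s' * ln v) / v\<^sup>2"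
        unfolding k'_def s_def s'_def d_def using v0 \<delta> \<eta> by (intro norm_powr_Complex_deriv_diff_le) auto
      also have "ln v \<le> ln (real n + 1)" using v0 v2 by simp
      also have "ln (real n + 1) \<le> 2 * sqrt n" using n1 by (rule ln_add_one_le_sqrt)
      finally have "norm (k' (of_real v)) \<le> d * (1 + norm s' * (2 * sqrt n)) / v\<^sup>2"
        using d0 by (simp add: divide_right_mono mult_left_mono)
      also have "\<dots> \<le> d * (1 + norm s' * (2 * sqrt n)) / (real n)\<^sup>2"
        using v n1 d0 by (intro divide_left_mono power_mono) auto
      finally show "norm (k' (of_real v)) \<le> d * (1 + norm s' * (2 * sqrt n)) / (real n)\<^sup>2" .
    qed
    also have "d * (1 + norm s' * (2 * sqrt n)) / (real n)\<^sup>2 \<le> d * ((1 + 2 * norm s') * sqrt n) / (real n)\<^sup>2"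
      using d0 n1 by (intro divide_right_mono mult_left_mono) (auto simp: algebra_simps)
    also have "d * ((1 + 2 * norm s') * sqrt n) / (real n)\<^sup>2 = d * (1 + 2 * norm s') * (1 / (real n * sqrt n))"
    proof -
      have "sqrt n / (real n)\<^sup>2 = 1 / (real n * sqrt n)"
        using n1 by (simp add: field_simps power2_eq_square)
      thus ?thesis by (metis times_divide_eq_right mult.assoc)
    qed
    also have "\<dots> \<le> d * (1 + 2 * norm s') * (4 * (1 / sqrt n - 1 / sqrt (real n + 1)))"
      using d0 n1 by (intro mult_left_mono inverse_mult_sqrt_le) auto
    also have "\<dots> = 4 * d * (1 + 2 * norm s') * (1 / sqrt n - 1 / sqrt (real n + 1))"
      by (simp only: mult_ac)
    also have "real n + 1 = real (Suc n)" by simp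
    finally show "norm (K (of_nat (Suc n)) - K (of_nat n) - k (of_nat n)) \<le>
        4 * d * (1 + 2 * norm s') * (1 / sqrt n - 1 / sqrt (Suc n))"
      by (simp only: of_real_of_nat_eq)
  qed
  have tail': "4 * d * (1 + 2 * norm s') / sqrt N \<le> 12 * d"
  proof -
    have "sqrt N \<ge> \<tau>" using N(1) \<tau> by (simp add: real_le_rsqrt)
    moreover have "1 + 2 * norm s' \<le> 3 * \<tau>" using norm_s' \<tau> by linarith
    ultimately have "4 * d * (1 + 2 * norm s') / sqrt N \<le> 4 * d * (3 * \<tau>) / \<tau>"
      using d0 \<tau> by (intro frac_le mult_left_mono) auto
    thus ?thesis using \<tau> by simp
  qed
  have KN: "norm (K (of_nat N)) \<le> 16 * d * L + 256 * d"
  proof -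
    define y where "y = (of_real (real N) :: complex) powr (- Complex 0 t)"
    define p q where "p = 1 - s" and "q = 1 - s'"
    define A B where "A = real N powr (-\<delta>)" and "B = real N powr (-\<eta>)"
    have N0: "real N > 0" using N by simp
    have y: "norm y = 1" using N0 unfolding y_def by (subst norm_real_powr) auto
    have pq: "p = - Complex (0 + \<delta>) t" "q = - Complex (0 + \<eta>) t"
      by (simp_all add: p_def q_def s_def s'_def complex_eq_iff)
    \<comment> \<open>The hypothesis on t keeps 1 - s and 1 - s' away from the pole; this is the
      source of 16 and 256 = 16^2.\<close>
    have normpq: "norm p \<ge> 1 / 16" "norm q \<ge> 1 / 16"
      using t abs_Im_le_cmod[of p] abs_Im_le_cmod[of q] by (auto simp: pq)
    hence pq0: "p \<noteq> 0" "q \<noteq> 0" by auto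
    have "K (of_nat N) = of_real A * y / p - of_real B * y / q"
      unfolding K_def p_def[symmetric] q_def[symmetric] unfolding pq y_def A_def B_def
      using powr_Complex_split[OF N0, of 0 \<delta> t] powr_Complex_split[OF N0, of 0 \<eta> t] by simp
    also have "\<dots> = y * (of_real (A - B) / p + of_real B * ((q - p) / (p * q)))"
      using pq0 by (simp add: field_simps)
    finally have "norm (K (of_nat N)) = norm (of_real (A - B) / p + of_real B * ((q - p) / (p * q)))"
      by (simp add: norm_mult y)
    also have "\<dots> \<le> norm (of_real (A - B) / p) + norm (of_real B * ((q - p) / (p * q)))"
      by (rule norm_triangle_ineq)
    also have "norm (of_real (A - B) / p) \<le> (d * L) / (1 / 16)"
    proof -
      have "\<bar>A - B\<bar> \<le> d * L"
        unfolding A_def B_def d_def L_def using N \<delta> \<eta> by (intro abs_powr_diff_le) auto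
      thus ?thesis using normpq by (simp only: norm_divide norm_of_real) (intro frac_le, auto)
    qed
    also have "norm (of_real B * ((q - p) / (p * q))) \<le> 1 * (d / (1 / 16 * (1 / 16)))"
    proof -
      have "B \<le> real N powr 0" unfolding B_def using N \<eta> by (intro powr_mono) auto
      hence "norm (of_real B :: complex) \<le> 1" using N0 by (simp add: B_def)
      moreover have "norm (q - p) = d"
      proof -
        have "q - p = of_real (\<delta> - \<eta>)" by (simp add: pq complex_eq_iff)
        thus ?thesis unfolding d_def by (metis norm_of_real)
      qed
      moreover have "norm ((q - p) / (p * q)) \<le> norm (q - p) / (1 / 16 * (1 / 16))"
        unfolding norm_divide norm_mult using normpq by (intro divide_left_mono mult_mono mult_pos_pos) auto
      ultimately show ?thesis
        unfolding norm_mult by (intro mult_mono) auto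
    qed
    finally show ?thesis by simp
  qed
  have head: "norm (\<Sum>n<N. k (of_nat n)) \<le> d * (L * (1 + L))"
  proof -
    have "norm (\<Sum>n<N. k (of_nat n)) \<le> (\<Sum>n<N. norm (k (of_nat n)))" by (rule norm_sum)
    also have "\<dots> \<le> (\<Sum>n<N. d * L * inverse (real n))"
    proof (rule sum_mono)
      fix n assume n: "n \<in> {..<N}"
      show "norm (k (of_nat n)) \<le> d * L * inverse (real n)"
      proof (cases "n = 0")
        case False
        hence "norm (k (of_real (real n))) \<le> d * (ln n / n)"
          unfolding k_def s_def s'_def d_def using \<delta> \<eta> by (intro norm_powr_Complex_diff_le) auto
        also have "\<dots> \<le> d * (L / n)"
          unfolding L_def using False n d0 by (intro mult_left_mono divide_right_mono) auto
        finally show ?thesis by (simp add: divide_inverse mult_ac)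
      qed (simp add: k_def)
    qed
    also have "\<dots> = d * L * (\<Sum>n<N. inverse (real n))" by (simp add: sum_distrib_left)
    also have "\<dots> \<le> d * L * (1 + L)"
    proof (intro mult_left_mono)
      have "(\<Sum>n<N. inverse (real n)) \<le> (\<Sum>n\<in>insert 0 {1..N}. inverse (real n))"
        by (intro sum_mono2) auto
      also have "\<dots> = harm N" by (simp add: harm_def)
      also have "harm N \<le> 1 + L"
        using euler_mascheroni_sequence_decreasing[of 1 N] N by (simp add: L_def harm_def)
      finally show "(\<Sum>n<N. inverse (real n)) \<le> 1 + L" .
    qed (use d0 L0 in auto)
    finally show ?thesis by (simp only: mult_ac)
  qed
  have "zeta_series s - zeta_series s' = (\<Sum>n. k (of_nat n))"
    unfolding zeta_series_def k_def using s by (intro suminf_diff summable_nat_powr)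
  also have "\<dots> = (\<Sum>n. k (of_nat (n + N))) + (\<Sum>n<N. k (of_nat n))"
    by (rule suminf_split_initial_segment[OF sum_k])
  also have "\<dots> = ((\<Sum>n. k (of_nat (n + N))) + K (of_nat N)) - K (of_nat N) + (\<Sum>n<N. k (of_nat n))"
    by simp
  also have "norm \<dots> \<le> 12 * d + (16 * d * L + 256 * d) + d * (L * (1 + L))"
  proof -
    have "norm (x - y + z) \<le> norm x + norm y + norm z" for x y z :: complex
      using norm_triangle_ineq[of "x - y" z] norm_triangle_ineq4[of x y] by linarith
    from order_trans[OF this add_mono[OF add_mono[OF order_trans[OF tail tail'] KN] head]]
    show ?thesis .
  qed
  \<comment> \<open>268 = 12 + 256 is the constant coefficient of the quadratic in L; the other
    coefficients, 17 and 1, are smaller than those of the square.\<close>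
  also have "\<dots> \<le> 268 * (1 + L)\<^sup>2 * d"
  proof -
    have "0 \<le> d * (519 * L + 267 * L\<^sup>2)" using d0 L0 by (intro mult_nonneg_nonneg add_nonneg_nonneg) auto
    thus ?thesis by (simp add: power2_eq_square algebra_simps)
  qed
  also have "268 * (1 + L)\<^sup>2 * d \<le> zeta_majorant t * d"
  proof (rule mult_right_mono[OF _ d0])
    \<comment> \<open>Then L <= 3 ln \<tau> <= 96 \<tau>^(1/32), so 1 + L <= 97 \<tau>^(1/32).
      Squaring yields the exponent 1/16 of \<open>zeta_majorant\<close>, and 268 * 97^2 = 2521612 is
      rounded up to its constant.\<close>
    have "real N \<le> \<tau> ^ 3"
    proof -
      have "\<tau>\<^sup>2 * 2 \<le> \<tau>\<^sup>2 * \<tau>" using \<tau> by (intro mult_left_mono) auto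
      thus ?thesis using N(2) \<tau>2 by (simp add: power3_eq_cube power2_eq_square)
    qed
    hence "L \<le> ln (\<tau> ^ 3)" using N \<tau> unfolding L_def by (subst ln_le_cancel_iff) auto
    also have "\<dots> = 3 * ln \<tau>" using \<tau> by (simp add: ln_realpow)
    also have "ln \<tau> \<le> \<tau> powr (1 / 32) / (1 / 32)" using \<tau> by (intro ln_powr_bound) auto
    finally have "1 + L \<le> 97 * \<tau> powr (1 / 32)"
      using ge_one_powr_ge_zero[of \<tau> "1/32"] \<tau> by simp
    hence "(1 + L)\<^sup>2 \<le> (97 * \<tau> powr (1 / 32))\<^sup>2" using L0 by (intro power_mono) auto
    also have "\<dots> = 9409 * \<tau> powr (1 / 16)"
      using \<tau> by (simp add: power_mult_distrib powr_power)
    finally have "268 * (1 + L)\<^sup>2 \<le> 2521612 * \<tau> powr (1 / 16)" by simp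
    also have "\<dots> \<le> 2600000 * \<tau> powr (1 / 16)" by (intro mult_right_mono) auto
    finally show "268 * (1 + L)\<^sup>2 \<le> zeta_majorant t" by (simp add: zeta_majorant_def \<tau>_def)
  qed
  finally show ?thesis by (simp add: s_def s'_def d_def)
qed

section \<open>Upper and lower bounds for zeta close to the line Re s = 1\<close>

lemma norm_zeta_series_at_2_le: "norm (zeta_series (Complex 2 t)) \<le> 2"
proof -
  have sm: "summable (\<lambda>n. real n powr (-2))" by (simp add: summable_real_powr_iff)
  have "norm (zeta_series (Complex 2 t)) \<le> (\<Sum>n. norm ((of_nat n :: complex) powr (- Complex 2 t)))"
    unfolding zeta_series_def by (rule summable_norm) (simp add: norm_nat_powr sm)
  also have "\<dots> = (\<Sum>n. real n powr (-2))" by (simp add: norm_nat_powr)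
  also have "\<dots> \<le> 2"
  proof (rule suminf_le_const[OF sm])
    fix n
    have "(\<Sum>i<n. real i powr (-2)) \<le> (\<Sum>i\<in>insert 0 {1..n}. real i powr (-2))"
      by (intro sum_mono2) auto
    also have "\<dots> = (\<Sum>i=1..n. 1 / (real i)\<^sup>2)"
      by (auto simp: powr_minus_divide powr_numeral intro!: sum.cong)
    also have "\<dots> \<le> 2" by (rule sum_inverse_squares_le)
    finally show "(\<Sum>i<n. real i powr (-2)) \<le> 2" .
  qed
  finally show ?thesis .
qed

text \<open>The Lipschitz bound carries the estimate from Re s = 2, where the series is trivially
  bounded, to 1 + \<delta>.\<close>

lemma norm_zeta_series_le:
  assumes "0 < \<delta>" "\<delta> \<le> 1" "\<bar>t\<bar> \<ge> 1 / 16"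
  shows "norm (zeta_series (Complex (1 + \<delta>) t)) \<le> 2 * zeta_majorant t"
proof -
  have "norm (zeta_series (Complex (1 + \<delta>) t) - zeta_series (Complex (1 + 1) t)) \<le> zeta_majorant t * \<bar>\<delta> - 1\<bar>"
    using assms by (intro norm_zeta_series_diff_le) auto
  also have "\<dots> \<le> zeta_majorant t * 1"
    using assms zeta_majorant_ge[of t] by (intro mult_left_mono) auto
  finally show ?thesis
    using norm_zeta_series_at_2_le[of t] zeta_majorant_ge[of t]
      norm_triangle_ineq2[of "zeta_series (Complex (1 + \<delta>) t)" "zeta_series (Complex 2 t)"] by simp
qed

lemma zeta_majorant_double_le: "zeta_majorant (2 * t) \<le> 2 * zeta_majorant t"
proof -
  have "(\<bar>2 * t\<bar> + 2) powr (1 / 16) \<le> (2 * (\<bar>t\<bar> + 2)) powr (1 / 16)"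
    by (intro powr_mono2) auto
  also have "\<dots> = 2 powr (1 / 16) * (\<bar>t\<bar> + 2) powr (1 / 16)" by (subst powr_mult) auto
  also have "\<dots> \<le> 2 powr 1 * (\<bar>t\<bar> + 2) powr (1 / 16)"
    by (intro mult_right_mono powr_mono) auto
  finally show ?thesis by (simp add: zeta_majorant_def)
qed

text \<open>The square root of exp (-16) / (9^6 * 4^2): the 3-4-1 inequality gives exp (-16), while
  9/\<delta> and 4W bound zeta at 1 + \<delta> and 1 + \<delta> + 2it.\<close>

definition zeta_const :: real where
  "zeta_const = exp (-8) / 2916"

text \<open>The 3-4-1 inequality solved for the eighth power of the middle factor, with upper bounds
  inserted for the other two; a square root leaves the fourth power.\<close>

lemma zeta_series_power4_ge:
  assumes \<delta>: "0 < \<delta>" "\<delta> \<le> 1" and t: "\<bar>t\<bar> \<ge> 1 / 16"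
  shows "zeta_const * \<delta> ^ 3 / zeta_majorant t \<le> norm (zeta_series (Complex (1 + \<delta>) t)) ^ 4"
proof (rule power2_le_imp_le)
  define W where "W = zeta_majorant t"
  define y where "y = norm (zeta_series (Complex (1 + \<delta>) t))"
  have W: "W > 0" using zeta_majorant_ge[of t] by (simp add: W_def)
  \<comment> \<open>The pole contributes 1/\<delta>, the remainder at most 4 |s| <= 8 <=
    8/\<delta>.\<close>
  have z0: "norm (zeta_series (Complex (1 + \<delta>) 0)) \<le> 9 / \<delta>"
  proof -
    define s where "s = Complex (1 + \<delta>) 0"
    have "norm (zeta_series s - 1 / (s - 1)) \<le> 4 * norm s"
      using \<delta> by (intro norm_zeta_series_minus_pole_le) (simp add: s_def)
    moreover have "norm s \<le> 2" using \<delta> cmod_le[of s] by (simp add: s_def)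
    moreover have "norm (1 / (s - 1)) = 1 / \<delta>"
    proof -
      have "s - 1 = of_real \<delta>" by (simp add: s_def complex_eq_iff)
      thus ?thesis using \<delta> by (simp add: norm_divide)
    qed
    moreover have "1 / \<delta> \<ge> 1" using \<delta> by simp
    ultimately show ?thesis
      using norm_triangle_ineq2[of "zeta_series s" "1 / (s - 1)"] unfolding s_def[symmetric] by simp
  qed
  have z2: "norm (zeta_series (Complex (1 + \<delta>) (2 * t))) \<le> 4 * W"
  proof -
    have "\<bar>2 * t\<bar> \<ge> 1 / 16" using t by (simp add: abs_mult)
    from norm_zeta_series_le[OF \<delta> this] zeta_majorant_double_le[of t] show ?thesis
      unfolding W_def by linarith
  qed
  have "exp (- 16) \<le> norm (zeta_series (Complex (1 + \<delta>) 0)) ^ 6 * y ^ 8 *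
      norm (zeta_series (Complex (1 + \<delta>) (2 * t))) ^ 2"
    unfolding y_def by (rule zeta_series_3_4_1[OF \<delta>(1)])
  also have "\<dots> \<le> (9 / \<delta>) ^ 6 * y ^ 8 * (4 * W) ^ 2"
    using z0 z2 W \<delta> by (intro mult_mono power_mono mult_nonneg_nonneg) (auto simp: y_def)
  finally have le: "exp (- 16) \<le> (9 / \<delta>) ^ 6 * y ^ 8 * (4 * W) ^ 2" .
  have "(zeta_const * \<delta> ^ 3 / W)\<^sup>2 = exp (-16) * (\<delta> ^ 6 / (2916 * W)\<^sup>2)"
  proof -
    have "exp (-8 :: real) ^ 2 = exp (-16)" using exp_of_nat_mult[of 2 "-8 :: real"] by simp
    thus ?thesis by (simp add: zeta_const_def power_divide power_mult_distrib flip: power_mult)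
  qed
  also have "\<dots> \<le> ((9 / \<delta>) ^ 6 * y ^ 8 * (4 * W) ^ 2) * (\<delta> ^ 6 / (2916 * W)\<^sup>2)"
    using le \<delta> by (intro mult_right_mono) auto
  also have "\<dots> = (y ^ 4)\<^sup>2"
    using \<delta> W by (simp add: power_divide power_mult_distrib flip: power_mult)
  finally show "(zeta_const * \<delta> ^ 3 / zeta_majorant t)\<^sup>2 \<le> (norm (zeta_series (Complex (1 + \<delta>) t)) ^ 4)\<^sup>2"
    by (simp add: W_def y_def)
qed simp

text \<open>The 3-4-1 bound deteriorates as \<eta> tends to 0, so it is used for \<eta> >= \<delta>
  only. Below \<delta> the Lipschitz bound changes zeta by at most W \<delta> = \<kappa> / W^4, half
  of the lower bound available at \<delta>.\<close>

lemma zeta_series_lower_bound: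
  assumes \<eta>: "0 < \<eta>" "\<eta> \<le> 1" and t: "\<bar>t\<bar> \<ge> 1 / 16"
  shows "norm (zeta_series (Complex (1 + \<eta>) t)) \<ge> zeta_const / 16 / zeta_majorant t ^ 4"
proof -
  define W where "W = zeta_majorant t"
  define \<kappa> where "\<kappa> = zeta_const / 16"
  define \<delta> where "\<delta> = \<kappa> / W ^ 5"
    \<comment> \<open>the distance at which the bound from the 3-4-1 inequality balances the Lipschitz bound\<close>
  have W: "W \<ge> 1" using zeta_majorant_ge[of t] by (simp add: W_def)
  have "exp (-8 :: real) \<le> 1" by simp
  hence "\<kappa> \<le> 1" unfolding \<kappa>_def zeta_const_def by linarith
  hence \<kappa>: "0 < \<kappa>" "\<kappa> \<le> 1" by (simp_all add: \<kappa>_def zeta_const_def)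
  have W5: "W ^ 5 \<ge> 1" using W by (rule one_le_power)
  have "\<kappa> \<le> W ^ 5" using \<kappa> W5 by linarith
  hence "\<delta> \<le> 1" unfolding \<delta>_def using W by (subst divide_le_eq_1_pos) auto
  moreover have "0 < \<delta>" unfolding \<delta>_def using \<kappa> W by (intro divide_pos_pos zero_less_power) auto
  ultimately have \<delta>: "0 < \<delta>" "\<delta> \<le> 1" by auto
  have lower: "2 * \<kappa> / W ^ 4 \<le> norm (zeta_series (Complex (1 + x) t))" if x: "\<delta> \<le> x" "x \<le> 1" for x
  proof -
    \<comment> \<open>The 16 in the definition of \<kappa> is 2^4: the doubled bound, raised to the
      fourth power, matches \<open>zeta_const\<close> exactly.\<close>
    have "(2 * \<kappa> / W ^ 4) ^ 4 = 16 * \<kappa> * \<delta> ^ 3 / W"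
    proof -
      have "W ^ 16 = W ^ 15 * W" by (simp add: eval_nat_numeral)
      thus ?thesis using W
        by (simp add: \<delta>_def power_divide power_mult_distrib eval_nat_numeral flip: power_mult)
    qed
    also have "\<dots> \<le> zeta_const * x ^ 3 / W"
      using x \<delta> \<kappa> W unfolding \<kappa>_def by (intro divide_right_mono mult_mono power_mono) auto
    also have "\<dots> \<le> norm (zeta_series (Complex (1 + x) t)) ^ 4"
      unfolding W_def using x \<delta> t by (intro zeta_series_power4_ge) auto
    finally show ?thesis using \<kappa> W by (subst (asm) power_mono_iff) auto
  qed
  have W4: "W ^ 4 > 0" using W by simp
  show ?thesis
  proof (cases "\<delta> \<le> \<eta>")
    case True
    have "\<kappa> / W ^ 4 \<le> 2 * \<kappa> / W ^ 4" using \<kappa> W4 by (intro divide_right_mono) auto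
    thus ?thesis using lower[OF True \<eta>(2)] by (simp add: \<kappa>_def W_def)
  next
    case False
    have "norm (zeta_series (Complex (1 + \<delta>) t) - zeta_series (Complex (1 + \<eta>) t)) \<le> W * \<bar>\<delta> - \<eta>\<bar>"
      unfolding W_def using \<delta> \<eta> t by (intro norm_zeta_series_diff_le)
    also have "\<dots> \<le> W * \<delta>" using False W \<eta> by (intro mult_left_mono) auto
    also have "W * \<delta> = \<kappa> / W ^ 4" using W by (simp add: \<delta>_def eval_nat_numeral)
    finally have "norm (zeta_series (Complex (1 + \<delta>) t) - zeta_series (Complex (1 + \<eta>) t)) \<le> \<kappa> / W ^ 4" .
    moreover have "2 * \<kappa> / W ^ 4 \<le> norm (zeta_series (Complex (1 + \<delta>) t))" using \<delta> by (intro lower) auto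
    moreover have "2 * \<kappa> / W ^ 4 = \<kappa> / W ^ 4 + \<kappa> / W ^ 4" by simp
    ultimately have "\<kappa> / W ^ 4 \<le> norm (zeta_series (Complex (1 + \<eta>) t))"
      using norm_triangle_ineq2[of "zeta_series (Complex (1 + \<delta>) t)" "zeta_series (Complex (1 + \<eta>) t)"] by linarith
    thus ?thesis by (simp add: \<kappa>_def W_def)
  qed
qed

text \<open>For |t| >= 1/16 the lower bound for zeta gives |t|^(1/4) for the Liouville series, hence
  |t|^(1/2 - 2) after division and squaring. For smaller t, zeta(s)(s - 1) is close to 1, so the
  Liouville series is at most a multiple of |s - 1|, which cancels the denominator. Neither bound
  depends on \<eta>.\<close>

lemma liouville_series_quotient_bound:
  "\<exists>C>0. \<forall>\<eta> t. 0 < \<eta> \<longrightarrow> \<eta> \<le> 1 / 16 \<longrightarrow>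
     (norm (liouville_series (Complex (1 + \<eta>) t) / Complex \<eta> t))\<^sup>2 \<le> C * (1 + \<bar>t\<bar>) powr (- 3 / 2)"
proof -
  define C1 where "C1 = 4 * (16 * exp 4 / 7 :: real)\<^sup>2"
  define c where "c = exp 4 * 16 / zeta_const * 2600000 ^ 4"
  define C2 where "C2 = 578 * c\<^sup>2"
  have zc: "zeta_const > 0" by (simp add: zeta_const_def)
  have C: "C1 > 0" "C2 > 0" using zc by (simp_all add: C1_def C2_def c_def)
  have "(norm (liouville_series (Complex (1 + \<eta>) t) / Complex \<eta> t))\<^sup>2 \<le> (C1 + C2) * (1 + \<bar>t\<bar>) powr (- 3 / 2)"
    if \<eta>: "0 < \<eta>" "\<eta> \<le> 1 / 16" for \<eta> t
  proof -
    define s where "s = Complex (1 + \<eta>) t"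
    have s1: "s - 1 = Complex \<eta> t" by (simp add: s_def complex_eq_iff)
    have prod: "norm (liouville_series s) * norm (zeta_series s) \<le> exp 4"
      using \<eta> by (intro norm_liouville_series_zeta_series_le) (simp add: s_def)
    have pos: "1 + \<bar>t\<bar> > 0" by simp
    show ?thesis
    proof (cases "\<bar>t\<bar> \<ge> 1 / 16")
      case True
      define \<tau> where "\<tau> = \<bar>t\<bar> + 2"
      have \<tau>: "\<tau> > 0" by (simp add: \<tau>_def)
      define b where "b = zeta_const / 16 / zeta_majorant t ^ 4"
      have b: "b > 0" "b \<le> norm (zeta_series s)"
        using zc zeta_majorant_ge[of t] zeta_series_lower_bound[of \<eta> t] \<eta> True by (auto simp: b_def s_def)
      have "norm (liouville_series s) * b \<le> exp 4"
        using b prod mult_left_mono[OF b(2), of "norm (liouville_series s)"] by simp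
      hence "norm (liouville_series s) \<le> exp 4 / b" using b by (simp add: field_simps)
      also have "\<dots> = exp 4 * 16 / zeta_const * zeta_majorant t ^ 4" by (simp add: b_def)
      also have "zeta_majorant t ^ 4 = 2600000 ^ 4 * \<tau> powr (1 / 4)"
        using \<tau> by (simp add: zeta_majorant_def \<tau>_def power_mult_distrib powr_power)
      finally have "norm (liouville_series s) \<le> c * \<tau> powr (1 / 4)" by (simp add: c_def)
      hence "norm (liouville_series s) ^ 2 \<le> (c * \<tau> powr (1 / 4)) ^ 2" by (intro power_mono) auto
      also have "\<dots> = c\<^sup>2 * \<tau> powr (1 / 2)" using \<tau> by (simp add: power_mult_distrib powr_power)
      also have "\<tau> powr (1 / 2) \<le> (4 * (1 + \<bar>t\<bar>)) powr (1 / 2)"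
        unfolding \<tau>_def by (intro powr_mono2) auto
      also have "\<dots> = 2 * (1 + \<bar>t\<bar>) powr (1 / 2)"
      proof -
        have "(4 * (1 + \<bar>t\<bar>)) powr (1 / 2) = 4 powr (1 / 2) * (1 + \<bar>t\<bar>) powr (1 / 2)"
          by (subst powr_mult) auto
        thus ?thesis by (simp add: powr_half_sqrt)
      qed
      finally have 1: "norm (liouville_series s) ^ 2 \<le> c\<^sup>2 * (2 * (1 + \<bar>t\<bar>) powr (1 / 2))"
        by (simp add: mult_left_mono)
      \<comment> \<open>|t| >= 1/16 means 1 + |t| <= 17 |t|; together with the factor 2 above this
        explains 578 = 2 * 17^2.\<close>
      have 2: "((1 + \<bar>t\<bar>) / 17)\<^sup>2 \<le> norm (s - 1) ^ 2"
      proof (rule power_mono)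
        have "(1 + \<bar>t\<bar>) / 17 \<le> \<bar>t\<bar>" using True by simp
        also have "\<dots> \<le> norm (s - 1)" using abs_Im_le_cmod[of "s - 1"] by (simp add: s1)
        finally show "(1 + \<bar>t\<bar>) / 17 \<le> norm (s - 1)" .
      qed simp
      have "(norm (liouville_series s / (s - 1)))\<^sup>2 = norm (liouville_series s) ^ 2 / norm (s - 1) ^ 2"
        by (simp add: norm_divide power_divide)
      also have "\<dots> \<le> c\<^sup>2 * (2 * (1 + \<bar>t\<bar>) powr (1 / 2)) / ((1 + \<bar>t\<bar>) / 17)\<^sup>2"
        using 1 2 by (intro frac_le) auto
      also have "\<dots> = C2 * ((1 + \<bar>t\<bar>) powr (1 / 2) / (1 + \<bar>t\<bar>) ^ 2)"
        by (simp add: C2_def power_divide)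
      also have "(1 + \<bar>t\<bar>) powr (1 / 2) / (1 + \<bar>t\<bar>) ^ 2 = (1 + \<bar>t\<bar>) powr (1 / 2 - 2)"
        unfolding powr_diff by (simp add: powr_numeral)
      also have "C2 * (1 + \<bar>t\<bar>) powr (1 / 2 - 2) \<le> (C1 + C2) * (1 + \<bar>t\<bar>) powr (- 3 / 2)"
        using C by (simp add: mult_right_mono)
      finally show ?thesis unfolding s1[symmetric] s_def[symmetric] .
    next
      case False
      have n0: "s - 1 \<noteq> 0" using \<eta> by (simp add: s1 complex_eq_iff)
      have n1: "norm (s - 1) \<le> 1 / 8"
        using cmod_le[of "s - 1"] \<eta> False by (simp add: s1)
      have n2: "norm s \<le> 9 / 8" using norm_triangle_ineq[of "s - 1" 1] n1 by simp
      have "norm (zeta_series s - 1 / (s - 1)) \<le> 4 * norm s"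
        using \<eta> by (intro norm_zeta_series_minus_pole_le) (simp add: s_def)
      \<comment> \<open>The range 1/16 for both \<eta> and |t| is chosen so that this error is below
        1; it leaves 1 - 9/16 = 7/16.\<close>
      hence "norm (zeta_series s - 1 / (s - 1)) * norm (s - 1) \<le> 4 * (9 / 8) * (1 / 8)"
        using n1 n2 by (intro mult_mono) auto
      hence "norm (zeta_series s * (s - 1) - 1) \<le> 9 / 16"
        using n0 by (simp add: left_diff_distrib flip: norm_mult)
      hence "7 / 16 \<le> norm (zeta_series s * (s - 1))"
        using norm_triangle_ineq2[of 1 "1 - zeta_series s * (s - 1)"] by (simp add: norm_minus_commute)
      hence "norm (liouville_series s) * (7 / 16) \<le> norm (liouville_series s) * (norm (zeta_series s) * norm (s - 1))"
        by (intro mult_left_mono) (auto simp: norm_mult)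
      also have "\<dots> \<le> exp 4 * norm (s - 1)"
        using mult_right_mono[OF prod, of "norm (s - 1)"] by (simp add: mult_ac)
      finally have "norm (liouville_series s / (s - 1)) \<le> 16 * exp 4 / 7"
        using n0 by (simp add: norm_divide field_simps)
      hence "(norm (liouville_series s / (s - 1)))\<^sup>2 \<le> (16 * exp 4 / 7)\<^sup>2" by (intro power_mono) auto
      also have "\<dots> = C1 * (1 / 4)" by (simp add: C1_def)
      also have "1 / 4 \<le> (1 + \<bar>t\<bar>) powr (- 3 / 2)"
      proof -
        have "1 / 4 = (2::real) powr (-2)" by (simp add: powr_minus_divide powr_numeral)
        also have "\<dots> \<le> 2 powr (- 3 / 2)" by (intro powr_mono) auto
        also have "\<dots> \<le> (1 + \<bar>t\<bar>) powr (- 3 / 2)" using False by (intro powr_mono2') auto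
        finally show ?thesis .
      qed
      finally have "(norm (liouville_series s / (s - 1)))\<^sup>2 \<le> C1 * (1 + \<bar>t\<bar>) powr (- 3 / 2)"
        using C by (simp add: mult_left_mono)
      also have "\<dots> \<le> (C1 + C2) * (1 + \<bar>t\<bar>) powr (- 3 / 2)" using C by (intro mult_right_mono) auto
      finally show ?thesis unfolding s1[symmetric] s_def[symmetric] .
    qed
  qed
  thus ?thesis using C by (intro exI[of _ "C1 + C2"]) auto
qed

section \<open>The Plancherel inequality\<close>

lemma Fubini_bounded_kernel:
  fixes f g :: "real \<Rightarrow> complex" and u :: "real \<Rightarrow> real \<Rightarrow> complex"
  assumes f: "integrable lborel f" and g: "integrable lborel g"
    and u: "case_prod u \<in> borel_measurable (borel \<Otimes>\<^sub>M borel)" and bound: "\<And>x y. norm (u x y) \<le> c"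
  shows "(\<integral>x. (\<integral>y. f x * g y * u x y \<partial>lborel) \<partial>lborel) = (\<integral>y. (\<integral>x. f x * g y * u x y \<partial>lborel) \<partial>lborel)"
proof (rule lborel_pair.Fubini_integral[symmetric])
  have [measurable]: "f \<in> borel_measurable borel" "g \<in> borel_measurable borel"
    using borel_measurable_integrable[OF f] borel_measurable_integrable[OF g] by simp_all
  have "integrable (lborel \<Otimes>\<^sub>M lborel) (\<lambda>(x, y). f x * g y)"
  proof (rule lborel_pair.Fubini_integrable)
    show "AE x in lborel. integrable lborel (\<lambda>y. case (x, y) of (x, y) \<Rightarrow> f x * g y)"
      using g by simp
    have "integrable lborel (\<lambda>x. norm (f x) * (\<integral>y. norm (g y) \<partial>lborel))"
      using f by (intro integrable_mult_left integrable_norm)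
    thus "integrable lborel (\<lambda>x. \<integral>y. norm (case (x, y) of (x, y) \<Rightarrow> f x * g y) \<partial>lborel)"
      by (simp add: norm_mult)
  qed simp
  hence "integrable (lborel \<Otimes>\<^sub>M lborel) (\<lambda>p. of_real c * (case p of (x, y) \<Rightarrow> f x * g y))"
    by (rule integrable_mult_right)
  thus "integrable (lborel \<Otimes>\<^sub>M lborel) (\<lambda>(x, y). f x * g y * u x y)"
  proof (rule Bochner_Integration.integrable_bound)
    show "(\<lambda>(x, y). f x * g y * u x y) \<in> borel_measurable (lborel \<Otimes>\<^sub>M lborel)"
      using u by measurable
    show "AE p in lborel \<Otimes>\<^sub>M lborel. norm (case p of (x, y) \<Rightarrow> f x * g y * u x y) \<le>
        norm (of_real c * (case p of (x, y) \<Rightarrow> f x * g y))"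
    proof (intro AE_I2, clarify)
      fix x y
      have "norm (f x * g y * u x y) \<le> norm (f x * g y) * c"
        unfolding norm_mult[of "f x * g y"] by (intro mult_left_mono bound) auto
      also have "\<dots> \<le> norm (f x * g y) * \<bar>c\<bar>" by (intro mult_left_mono) auto
      finally show "norm (f x * g y * u x y) \<le> norm (complex_of_real c * (f x * g y))"
        by (simp add: norm_mult mult_ac)
    qed
  qed
qed

lemma std_normal_density_iexp:
  "(\<integral>t. of_real (std_normal_density t) * iexp (t * u) \<partial>lborel) = of_real (exp (- (u\<^sup>2) / 2))"
proof -
  have "of_real (exp (- (u\<^sup>2) / 2)) = char std_normal_distribution u"
    by (simp add: char_std_normal_distribution)
  also have "\<dots> = (\<integral>t. std_normal_density t *\<^sub>R iexp (u * t) \<partial>lborel)"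
    unfolding char_def by (subst integral_density) auto
  finally show ?thesis by (simp add: scaleR_conv_of_real mult.commute)
qed

text \<open>Smoothing with a Gaussian of width \<open>h\<close>; the limit \<open>h \<longlongrightarrow> 0\<close> gives Plancherel's inequality.\<close>

lemma gaussian_mean_Fourier:
  fixes f :: "real \<Rightarrow> real"
  assumes f: "integrable lborel f" and h: "h > 0"
  defines "P \<equiv> \<lambda>t. \<integral>y. of_real (f y) * iexp (y * t) \<partial>lborel"
  shows "(\<integral>t. std_normal_density t * (norm (P (t / h)))\<^sup>2 \<partial>lborel) =
    h * sqrt (2 * pi) * (\<integral>x. f x * (\<integral>w. f (x + h * w) * std_normal_density w \<partial>lborel) \<partial>lborel)"
proof -
  have fm [measurable]: "f \<in> borel_measurable borel"
    using borel_measurable_integrable[OF f] by simp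
  have fc: "integrable lborel (\<lambda>x. complex_of_real (f x))" using f by simp
  have gc: "integrable lborel (\<lambda>x. complex_of_real (std_normal_density x))"
    by (simp add: integrable_normal_density integral_normal_density)
  have Pm [measurable]: "P \<in> borel_measurable borel"
    unfolding P_def by (intro lborel.borel_measurable_lebesgue_integral) measurable
  define K where "K = (\<integral>y. \<bar>f y\<bar> \<partial>lborel)"
  have PK: "norm (P t) \<le> K" for t
  proof -
    have "norm (P t) \<le> (\<integral>y. norm (of_real (f y) * iexp (y * t)) \<partial>lborel)"
      unfolding P_def by (rule integral_norm_bound)
    thus ?thesis by (simp add: K_def norm_mult)
  qed
  have cnjP: "cnj (P t) = (\<integral>x. of_real (f x) * iexp (- (x * t)) \<partial>lborel)" for t
  proof -
    have "cnj (P t) = (\<integral>y. cnj (of_real (f y) * iexp (y * t)) \<partial>lborel)"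
      unfolding P_def by (rule Bochner_Integration.integral_cnj[symmetric])
    also have "\<dots> = (\<integral>x. of_real (f x) * iexp (- (x * t)) \<partial>lborel)"
      by (rule Bochner_Integration.integral_cong) (simp_all add: exp_cnj)
    finally show ?thesis .
  qed
  \<comment> \<open>For fixed x the Gaussian weight in t is replaced by its Fourier transform, a
    Gaussian in (y - x)/h; the substitution y = x + h w then produces the local average of
    f.\<close>
  have inner: "(\<integral>t. of_real (std_normal_density t) * of_real (f x) * (iexp (- (x * (t / h))) * P (t / h)) \<partial>lborel) =
      of_real (h * sqrt (2 * pi) * (f x * (\<integral>w. f (x + h * w) * std_normal_density w \<partial>lborel)))" for x
  proof -
    have "(\<integral>t. of_real (std_normal_density t) * of_real (f x) * (iexp (- (x * (t / h))) * P (t / h)) \<partial>lborel) =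
      of_real (f x) * (\<integral>t. of_real (std_normal_density t) * iexp (- (x * (t / h))) * P (t / h) \<partial>lborel)"
      by (subst integral_mult_right_zero[symmetric]) (simp add: mult_ac)
    also have "(\<integral>t. of_real (std_normal_density t) * iexp (- (x * (t / h))) * P (t / h) \<partial>lborel) =
       (\<integral>t. (\<integral>y. of_real (std_normal_density t) * of_real (f y) * iexp (t * ((y - x) / h)) \<partial>lborel) \<partial>lborel)"
    proof (rule Bochner_Integration.integral_cong[OF refl])
      fix t
      have "of_real (std_normal_density t) * of_real (f y) * iexp (t * ((y - x) / h)) =
         of_real (std_normal_density t) * iexp (- (x * (t / h))) * (of_real (f y) * iexp (y * (t / h)))" for y
      proof -
        have "iexp (t * ((y - x) / h)) = iexp (- (x * (t / h))) * iexp (y * (t / h))"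
          by (simp add: diff_divide_distrib algebra_simps flip: exp_add)
        thus ?thesis by (simp only: mult_ac)
      qed
      thus "of_real (std_normal_density t) * iexp (- (x * (t / h))) * P (t / h) =
         (\<integral>y. of_real (std_normal_density t) * of_real (f y) * iexp (t * ((y - x) / h)) \<partial>lborel)"
        unfolding P_def by (simp only: integral_mult_right_zero)
    qed
    also have "\<dots> = (\<integral>y. (\<integral>t. of_real (std_normal_density t) * of_real (f y) * iexp (t * ((y - x) / h)) \<partial>lborel) \<partial>lborel)"
    proof (rule Fubini_bounded_kernel[OF gc fc, where c = 1])
      show "(\<lambda>(t, y). iexp (t * ((y - x) / h))) \<in> borel_measurable (borel \<Otimes>\<^sub>M borel)"
        by measurable
    qed simp
    also have "\<dots> = (\<integral>y. of_real (f y * exp (- (((y - x) / h)\<^sup>2) / 2)) \<partial>lborel)"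
    proof (rule Bochner_Integration.integral_cong[OF refl])
      fix y
      have "(\<integral>t. of_real (std_normal_density t) * of_real (f y) * iexp (t * ((y - x) / h)) \<partial>lborel) =
        of_real (f y) * (\<integral>t. of_real (std_normal_density t) * iexp (t * ((y - x) / h)) \<partial>lborel)"
        by (subst integral_mult_right_zero[symmetric]) (simp only: mult_ac)
      also have "\<dots> = of_real (f y) * of_real (exp (- (((y - x) / h)\<^sup>2) / 2))"
        by (subst std_normal_density_iexp) (rule refl)
      finally show "(\<integral>t. of_real (std_normal_density t) * of_real (f y) * iexp (t * ((y - x) / h)) \<partial>lborel) =
        of_real (f y * exp (- (((y - x) / h)\<^sup>2) / 2))"
        by (simp only: of_real_mult)
    qed
    also have "\<dots> = of_real (\<integral>y. f y * exp (- (((y - x) / h)\<^sup>2) / 2) \<partial>lborel)"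
      by (rule integral_complex_of_real)
    also have "(\<integral>y. f y * exp (- (((y - x) / h)\<^sup>2) / 2) \<partial>lborel) =
      h * (\<integral>w. f (x + h * w) * exp (- (w\<^sup>2) / 2) \<partial>lborel)"
      using h by (subst lborel_integral_real_affine[of h _ x]) auto
    also have "(\<integral>w. f (x + h * w) * exp (- (w\<^sup>2) / 2) \<partial>lborel) =
      sqrt (2 * pi) * (\<integral>w. f (x + h * w) * std_normal_density w \<partial>lborel)"
      by (subst integral_mult_right_zero[symmetric]) (simp add: std_normal_density_def)
    finally show ?thesis by (simp add: mult_ac)
  qed
  have "complex_of_real (\<integral>t. std_normal_density t * (norm (P (t / h)))\<^sup>2 \<partial>lborel) =
      (\<integral>t. of_real (std_normal_density t * (norm (P (t / h)))\<^sup>2) \<partial>lborel)"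
    by (rule integral_complex_of_real[symmetric])
  also have "\<dots> = (\<integral>t. (\<integral>x. of_real (std_normal_density t) * of_real (f x) *
      (iexp (- (x * (t / h))) * P (t / h)) \<partial>lborel) \<partial>lborel)"
  proof (rule Bochner_Integration.integral_cong[OF refl])
    fix t
    have "of_real (std_normal_density t * (norm (P (t / h)))\<^sup>2) =
      of_real (std_normal_density t) * (P (t / h) * cnj (P (t / h)))"
      by (simp only: of_real_mult complex_norm_square)
    also have "\<dots> = (of_real (std_normal_density t) * P (t / h)) * (\<integral>x. of_real (f x) * iexp (- (x * (t / h))) \<partial>lborel)"
      by (simp only: cnjP mult_ac)
    also have "\<dots> = (\<integral>x. of_real (std_normal_density t) * P (t / h) * (of_real (f x) * iexp (- (x * (t / h)))) \<partial>lborel)"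
      by (simp only: integral_mult_right_zero)
    finally show "of_real (std_normal_density t * (norm (P (t / h)))\<^sup>2) =
      (\<integral>x. of_real (std_normal_density t) * of_real (f x) * (iexp (- (x * (t / h))) * P (t / h)) \<partial>lborel)"
      by (simp only: mult_ac)
  qed
  also have "\<dots> = (\<integral>x. (\<integral>t. of_real (std_normal_density t) * of_real (f x) *
      (iexp (- (x * (t / h))) * P (t / h)) \<partial>lborel) \<partial>lborel)"
  proof (rule Fubini_bounded_kernel[OF gc fc, where c = K])
    show "norm (iexp (- (x * (t / h))) * P (t / h)) \<le> K" for x t
      using PK[of "t / h"] by (simp add: norm_mult)
  qed measurable
  also have "\<dots> = (\<integral>x. of_real (h * sqrt (2 * pi) * (f x * (\<integral>w. f (x + h * w) * std_normal_density w \<partial>lborel))) \<partial>lborel)"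
    by (simp only: inner)
  also have "\<dots> = of_real (\<integral>x. h * sqrt (2 * pi) * (f x * (\<integral>w. f (x + h * w) * std_normal_density w \<partial>lborel)) \<partial>lborel)"
    by (rule integral_complex_of_real)
  also have "\<dots> = of_real (h * sqrt (2 * pi) * (\<integral>x. f x * (\<integral>w. f (x + h * w) * std_normal_density w \<partial>lborel) \<partial>lborel))"
    by (simp only: integral_mult_right_zero)
  finally show ?thesis by (simp only: of_real_eq_iff)
qed

text \<open>The Gaussian density is at most 1/sqrt(2 pi), so the left side of
  \<open>gaussian_mean_Fourier\<close> is at most h/sqrt(2 pi) times the integral of \<Phi>;
  division by h sqrt(2 pi) gives the factor 1/(2 pi). As h tends to 0 the averages tend to f at its
  continuity points, and boundedness of f supplies the dominating functions. Continuity is only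
  asked for almost everywhere since the intended f has jumps.\<close>

lemma square_integral_le_Fourier:
  fixes f \<Phi> :: "real \<Rightarrow> real"
  assumes f: "integrable lborel f" and B: "\<And>x. \<bar>f x\<bar> \<le> B" and cont: "AE x in lborel. isCont f x"
    and \<Phi>: "integrable lborel \<Phi>"
    and bound: "\<And>t. (norm (\<integral>y. of_real (f y) * iexp (y * t) \<partial>lborel))\<^sup>2 \<le> \<Phi> t"
  shows "(\<integral>x. (f x)\<^sup>2 \<partial>lborel) \<le> (\<integral>t. \<Phi> t \<partial>lborel) / (2 * pi)"
proof -
  have fm [measurable]: "f \<in> borel_measurable borel"
    using borel_measurable_integrable[OF f] by simp
  define P where "P t = (\<integral>y. of_real (f y) * iexp (y * t) \<partial>lborel)" for t
  have Pm [measurable]: "P \<in> borel_measurable borel"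
    unfolding P_def by (intro lborel.borel_measurable_lebesgue_integral) measurable
  have \<Phi>0: "0 \<le> \<Phi> t" for t using bound[of t] by (rule order_trans[rotated]) simp
  define A where "A h x = (\<integral>w. f (x + h * w) * std_normal_density w \<partial>lborel)" for h x
  have snd: "integrable lborel std_normal_density" "(\<integral>w. std_normal_density w \<partial>lborel) = 1"
    by (simp_all add: integrable_normal_density integral_normal_density)
  have le: "(\<integral>x. f x * A h x \<partial>lborel) \<le> (\<integral>t. \<Phi> t \<partial>lborel) / (2 * pi)" if h: "h > 0" for h
  proof -
    have \<Phi>h: "integrable lborel (\<lambda>t. \<Phi> (0 + (1 / h) * t))"
      using h by (intro lborel_integrable_real_affine[OF \<Phi>]) auto
    have "h * sqrt (2 * pi) * (\<integral>x. f x * A h x \<partial>lborel) =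
       (\<integral>t. std_normal_density t * (norm (P (t / h)))\<^sup>2 \<partial>lborel)"
      unfolding A_def P_def by (rule gaussian_mean_Fourier[OF f h, symmetric])
    also have "\<dots> \<le> (\<integral>t. 1 / sqrt (2 * pi) * \<Phi> (0 + (1 / h) * t) \<partial>lborel)"
    proof -
      have pt: "std_normal_density t * (norm (P (t / h)))\<^sup>2 \<le> 1 / sqrt (2 * pi) * \<Phi> (0 + (1 / h) * t)" for t
      proof (rule mult_mono)
        show "std_normal_density t \<le> 1 / sqrt (2 * pi)"
          by (simp add: std_normal_density_def divide_right_mono)
        show "(norm (P (t / h)))\<^sup>2 \<le> \<Phi> (0 + (1 / h) * t)"
          using bound[of "t / h"] by (simp add: P_def)
      qed auto
      have "integrable lborel (\<lambda>t. std_normal_density t * (norm (P (t / h)))\<^sup>2)"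
      proof (rule Bochner_Integration.integrable_bound)
        show "integrable lborel (\<lambda>t. 1 / sqrt (2 * pi) * \<Phi> (0 + (1 / h) * t))"
          by (rule integrable_mult_right) (rule \<Phi>h)
        show "AE t in lborel. norm (std_normal_density t * (norm (P (t / h)))\<^sup>2) \<le>
            norm (1 / sqrt (2 * pi) * \<Phi> (0 + (1 / h) * t))"
        proof (intro AE_I2)
          fix t
          have "norm (std_normal_density t * (norm (P (t / h)))\<^sup>2) = std_normal_density t * (norm (P (t / h)))\<^sup>2"
            by simp
          also have "\<dots> \<le> norm (1 / sqrt (2 * pi) * \<Phi> (0 + (1 / h) * t))"
            using pt[of t] by (simp only: real_norm_def)
          finally show "norm (std_normal_density t * (norm (P (t / h)))\<^sup>2) \<le>
            norm (1 / sqrt (2 * pi) * \<Phi> (0 + (1 / h) * t))" .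
        qed
      qed simp
      thus ?thesis by (intro integral_mono integrable_mult_right \<Phi>h pt)
    qed
    also have "\<dots> = 1 / sqrt (2 * pi) * (\<integral>t. \<Phi> (0 + (1 / h) * t) \<partial>lborel)"
      by (rule integral_mult_right_zero)
    also have "(\<integral>t. \<Phi> (0 + (1 / h) * t) \<partial>lborel) = h * (\<integral>t. \<Phi> t \<partial>lborel)"
      using h lborel_integral_real_affine[of "1 / h" \<Phi> 0] by simp
    finally have "h * (sqrt (2 * pi) * (\<integral>x. f x * A h x \<partial>lborel)) \<le> h * ((\<integral>t. \<Phi> t \<partial>lborel) / sqrt (2 * pi))"
      by (simp add: mult_ac)
    hence "sqrt (2 * pi) * (\<integral>x. f x * A h x \<partial>lborel) \<le> (\<integral>t. \<Phi> t \<partial>lborel) / sqrt (2 * pi)"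
      using h by (simp only: mult_le_cancel_left_pos)
    hence "sqrt (2 * pi) * (sqrt (2 * pi) * (\<integral>x. f x * A h x \<partial>lborel)) \<le> (\<integral>t. \<Phi> t \<partial>lborel)"
      by (simp add: pos_le_divide_eq mult.commute)
    moreover have "sqrt (2 * pi) * sqrt (2 * pi) = 2 * pi" by simp
    ultimately have "2 * pi * (\<integral>x. f x * A h x \<partial>lborel) \<le> (\<integral>t. \<Phi> t \<partial>lborel)"
      by (metis mult.assoc)
    thus ?thesis by (simp add: pos_le_divide_eq mult.commute)
  qed
  have B0: "B \<ge> 0" using B[of 0] by simp
  have Abound: "\<bar>A h x\<bar> \<le> B" for h x
  proof -
    have "\<bar>A h x\<bar> \<le> (\<integral>w. B * std_normal_density w \<partial>lborel)"
      unfolding A_def real_norm_def[symmetric]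
    proof (rule Bochner_Integration.integral_norm_bound_integral)
      have pt: "norm (f (x + h * w) * std_normal_density w) \<le> B * std_normal_density w" for w
        using B[of "x + h * w"] by (simp add: abs_mult mult_right_mono)
      thus "norm (f (x + h * w) * std_normal_density w) \<le> B * std_normal_density w" for w .
      show int: "integrable lborel (\<lambda>w. B * std_normal_density w)"
        by (intro integrable_mult_right snd)
      show "integrable lborel (\<lambda>w. f (x + h * w) * std_normal_density w)"
        using order_trans[OF pt abs_ge_self] by (intro Bochner_Integration.integrable_bound[OF int]) auto
    qed
    thus ?thesis using snd by simp
  qed
  define h where "h n = 1 / real (Suc n)" for n
  have h: "h \<longlonglongrightarrow> 0" "\<And>n. h n > 0"
    using LIMSEQ_Suc[OF lim_1_over_n[where 'a = real]] by (auto simp: h_def[abs_def])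
  have "(\<lambda>n. \<integral>x. f x * A (h n) x \<partial>lborel) \<longlonglongrightarrow> (\<integral>x. f x * f x \<partial>lborel)"
  proof (rule integral_dominated_convergence[where w = "\<lambda>x. B * \<bar>f x\<bar>"])
    show "AE x in lborel. (\<lambda>n. f x * A (h n) x) \<longlonglongrightarrow> f x * f x"
      using cont
    proof eventually_elim
      case (elim x)
      have "(\<lambda>n. \<integral>w. f (x + h n * w) * std_normal_density w \<partial>lborel) \<longlonglongrightarrow> (\<integral>w. f x * std_normal_density w \<partial>lborel)"
      proof (rule integral_dominated_convergence[where w = "\<lambda>w. B * std_normal_density w"])
        show "integrable lborel (\<lambda>w. B * std_normal_density w)" by (intro integrable_mult_right snd)
        show "AE w in lborel. norm (f (x + h n * w) * std_normal_density w) \<le> B * std_normal_density w" for n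
          using B by (intro AE_I2) (simp add: abs_mult mult_right_mono)
        show "AE w in lborel. (\<lambda>n. f (x + h n * w) * std_normal_density w) \<longlonglongrightarrow> f x * std_normal_density w"
        proof (intro AE_I2 tendsto_mult tendsto_const)
          fix w
          have "(\<lambda>n. x + h n * w) \<longlonglongrightarrow> x + 0 * w" by (intro tendsto_intros h)
          thus "(\<lambda>n. f (x + h n * w)) \<longlonglongrightarrow> f x"
            using isCont_tendsto_compose[OF elim] by simp
        qed
      qed auto
      hence "(\<lambda>n. A (h n) x) \<longlonglongrightarrow> f x" using snd by (simp add: A_def)
      thus ?case by (intro tendsto_intros)
    qed
    show "integrable lborel (\<lambda>x. B * \<bar>f x\<bar>)" using f by (intro integrable_mult_right integrable_abs)
    show "AE x in lborel. norm (f x * A (h n) x) \<le> B * \<bar>f x\<bar>" for n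
    proof (intro AE_I2)
      fix x
      have "\<bar>f x\<bar> * \<bar>A (h n) x\<bar> \<le> \<bar>f x\<bar> * B" by (intro mult_left_mono Abound) auto
      thus "norm (f x * A (h n) x) \<le> B * \<bar>f x\<bar>" by (simp add: abs_mult mult.commute)
    qed
    show "(\<lambda>x. f x * A (h n) x) \<in> borel_measurable lborel" for n
      unfolding A_def by measurable
  qed measurable
  from LIMSEQ_le_const2[OF this] le[OF h(2)] show ?thesis by (auto simp: power2_eq_square)
qed

section \<open>The Laplace transform of the logarithmic sums\<close>

lemma exp_integral_to_infinity:
  assumes s: "Re s > 0"
  shows "set_integrable lborel {a<..} (\<lambda>x. exp (- (s * of_real x)))"
    and "(LINT x:{a<..}|lborel. exp (- (s * of_real x))) = exp (- (s * of_real a)) / s"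
    and "(LINT x:{a<..}|lborel. norm (exp (- (s * of_real x)))) = exp (- (Re s * a)) / Re s"
proof -
  have norm: "norm (exp (- (s * of_real x))) = exp (- (Re s * x))" for x by simp
  have 1: "set_integrable lborel (einterval (ereal a) \<infinity>) (\<lambda>x. exp (- (Re s * x)))"
    and 2: "(LBINT x=ereal a..\<infinity>. exp (- (Re s * x))) = 0 - (- exp (- (Re s * a)) / Re s)"
  proof -
    have D: "DERIV (\<lambda>x. - exp (- (Re s * x)) / Re s) x :> exp (- (Re s * x))" for x
      using s by (auto intro!: derivative_eq_intros)
    have A: "(((\<lambda>x. - exp (- (Re s * x)) / Re s) \<circ> real_of_ereal) \<longlongrightarrow> - exp (- (Re s * a)) / Re s) (at_right (ereal a))"
      unfolding ereal_tendsto_simps1 using s by (intro tendsto_intros) auto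
    have B: "(((\<lambda>x. - exp (- (Re s * x)) / Re s) \<circ> real_of_ereal) \<longlongrightarrow> 0) (at_left \<infinity>)"
      unfolding ereal_tendsto_simps1 using s by real_asymp
    note FTC = interval_integral_FTC_nonneg[OF _ D _ _ A B]
    show "set_integrable lborel (einterval (ereal a) \<infinity>) (\<lambda>x. exp (- (Re s * x)))" by (rule FTC(1)) auto
    show "(LBINT x=ereal a..\<infinity>. exp (- (Re s * x))) = 0 - (- exp (- (Re s * a)) / Re s)" by (rule FTC(2)) auto
  qed
  show "(LINT x:{a<..}|lborel. norm (exp (- (s * of_real x)))) = exp (- (Re s * a)) / Re s"
    unfolding norm using 2 by (simp add: interval_integral_to_infinity_eq)
  show 3: "set_integrable lborel {a<..} (\<lambda>x. exp (- (s * of_real x)))"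
  proof -
    have "set_integrable lborel {a<..} (\<lambda>x. exp (- (Re s * x)))" using 1 by simp
    thus ?thesis
      unfolding set_integrable_def
      by (rule Bochner_Integration.integrable_bound) (auto simp: indicator_def)
  qed
  have "(LBINT x=ereal a..\<infinity>. exp (- (s * of_real x))) = 0 - (- exp (- (s * of_real a)) / s)"
  proof (rule interval_integral_FTC_integrable)
    have s0: "s \<noteq> 0" using s by auto
    show "((\<lambda>x. - exp (- (s * of_real x)) / s) has_vector_derivative exp (- (s * of_real x))) (at x)" for x
    proof -
      have "((\<lambda>z. - exp (- (s * z)) / s) has_field_derivative exp (- (s * of_real x))) (at (of_real x))"
        using s0 by (auto intro!: derivative_eq_intros)
      from has_vector_derivative_real_field[OF this] show ?thesis by (simp add: o_def)
    qed
    show "set_integrable lborel (einterval (ereal a) \<infinity>) (\<lambda>x. exp (- (s * of_real x)))" using 3 by simp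
    show "(((\<lambda>x. - exp (- (s * of_real x)) / s) \<circ> real_of_ereal) \<longlongrightarrow> - exp (- (s * of_real a)) / s) (at_right (ereal a))"
      unfolding ereal_tendsto_simps1 using s0 by (intro tendsto_intros) auto
    have "((\<lambda>x. norm (- exp (- (s * of_real x)) / s)) \<longlongrightarrow> 0) at_top"
    proof -
      have "((\<lambda>x. exp (- (Re s * x)) / norm s) \<longlongrightarrow> 0) at_top" using s s0 by real_asymp
      thus ?thesis by (simp add: norm_divide)
    qed
    thus "(((\<lambda>x. - exp (- (s * of_real x)) / s) \<circ> real_of_ereal) \<longlongrightarrow> 0) (at_left \<infinity>)"
      unfolding ereal_tendsto_simps1 by (rule tendsto_norm_zero_cancel)
  qed auto
  thus "(LINT x:{a<..}|lborel. exp (- (s * of_real x))) = exp (- (s * of_real a)) / s"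
    by (simp add: interval_integral_to_infinity_eq)
qed

lemma exp_mult_ln_nat: "n > 0 \<Longrightarrow> exp (- (s * of_real (ln (real n)))) = (of_nat n :: complex) powr (-s)"
  by (simp add: powr_def)

text \<open>M(e^x) is a step function with jump \<open>liouville n / n\<close> at ln n. Written as a
  series of half-line indicators, finite at each x, it can be integrated term by term.\<close>

lemma liouville_log_sum_exp_sums:
  fixes s :: complex
  assumes s: "Re s > 0"
  shows "(\<lambda>n. of_int (liouville n) / of_nat n * (indicator {ln (real n)<..} x *\<^sub>R exp (- (s * of_real x))))
    sums (of_real (liouville_log_sum (exp x)) * exp (- (s * of_real x)))"
proof -
  have "(\<lambda>n. of_int (liouville n) / of_nat n * (indicator {ln (real n)<..} x *\<^sub>R exp (- (s * of_real x))))
    sums (\<Sum>n\<in>posnats_below (exp x). of_int (liouville n) / of_nat n *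
       (indicator {ln (real n)<..} x *\<^sub>R exp (- (s * of_real x))))"
  proof (rule sums_finite)
    fix n assume n: "n \<notin> posnats_below (exp x)"
    show "of_int (liouville n) / of_nat n * (indicator {ln (real n)<..} x *\<^sub>R exp (- (s * of_real x))) = 0"
    \<comment> \<open>For n = 0 the indicator involves the default value of \<open>ln 0\<close>, but
      the coefficient is a division by 0 and hence 0.\<close>
    proof (cases "n = 0")
      case False
      with n have "exp x \<le> real n" by (auto simp: posnats_below_def)
      hence "x \<le> ln (real n)" using False by (subst ln_ge_iff) auto
      thus ?thesis by simp
    qed simp
  qed simp
  also have "(\<Sum>n\<in>posnats_below (exp x). of_int (liouville n) / of_nat n *
       (indicator {ln (real n)<..} x *\<^sub>R exp (- (s * of_real x)))) =
     (\<Sum>n\<in>posnats_below (exp x). of_real (liouville n / n) * exp (- (s * of_real x)))"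
  proof (rule sum.cong[OF refl])
    fix n assume "n \<in> posnats_below (exp x)"
    hence "0 < real n" "real n < exp x" by (auto simp: posnats_below_def)
    hence "ln (real n) < x" by (metis ln_exp ln_less_cancel_iff exp_gt_zero)
    thus "of_int (liouville n) / of_nat n * (indicator {ln (real n)<..} x *\<^sub>R exp (- (s * of_real x))) =
      of_real (liouville n / n) * exp (- (s * of_real x))" by simp
  qed
  also have "\<dots> = of_real (liouville_log_sum (exp x)) * exp (- (s * of_real x))"
    by (simp add: liouville_log_sum_def sum_distrib_right)
  finally show ?thesis .
qed

lemma summable_nat_powr_real: "\<sigma> > 0 \<Longrightarrow> summable (\<lambda>n. real n powr (- (1 + \<sigma>)))"
  by (simp add: summable_real_powr_iff)

text \<open>On the support x > ln n of the n-th term, exp (- \<sigma> x) is at most n^(-\<sigma>).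
  This supplies the uniform bound that the Plancherel inequality requires.\<close>

lemma abs_liouville_log_sum_exp_le:
  assumes \<sigma>: "\<sigma> > 0"
  shows "\<bar>liouville_log_sum (exp x) * exp (- (\<sigma> * x))\<bar> \<le> (\<Sum>n. real n powr (- (1 + \<sigma>)))"
proof -
  have "norm (of_real (liouville_log_sum (exp x)) * exp (- (of_real \<sigma> * of_real x)) :: complex) \<le>
      (\<Sum>n. real n powr (- (1 + \<sigma>)))"
  proof (rule norm_sums_le[OF liouville_log_sum_exp_sums summable_sums[OF summable_nat_powr_real[OF \<sigma>]]])
    show "0 < Re (of_real \<sigma>)" using \<sigma> by simp
    fix n
    show "norm (of_int (liouville n) / of_nat n * (indicator {ln (real n)<..} x *\<^sub>R
        exp (- (of_real \<sigma> * of_real x))) :: complex) \<le> real n powr (- (1 + \<sigma>))"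
    proof (cases "n > 0 \<and> x > ln (real n)")
      case True
      have "exp (- (\<sigma> * x)) \<le> exp (- (\<sigma> * ln n))" using True \<sigma> by simp
      also have "\<dots> = real n powr (-\<sigma>)" using True by (simp add: powr_def)
      finally have "1 / real n * exp (- (\<sigma> * x)) \<le> 1 / real n * real n powr (-\<sigma>)"
        by (intro mult_left_mono) auto
      also have "\<dots> = real n powr (- 1 + -\<sigma>)" unfolding powr_add using True by (simp add: powr_minus_divide)
      finally show ?thesis using True by (simp add: norm_mult norm_divide)
    qed auto
  qed
  also have "of_real (liouville_log_sum (exp x)) * exp (- (of_real \<sigma> * of_real x)) =
      (of_real (liouville_log_sum (exp x) * exp (- (\<sigma> * x))) :: complex)"
    by (simp flip: exp_of_real)
  finally show ?thesis by (simp only: norm_of_real)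
qed

text \<open>The n-th jump contributes \<open>liouville n / n\<close> times n^(-s) / s; the L1 norms
  n^(-1 - Re s) / Re s are summable, which justifies the interchange. The integral may run over the
  whole line because M(e^x) = 0 for x <= 0.\<close>

lemma liouville_log_sum_Laplace:
  assumes s: "Re s > 0"
  shows "integrable lborel (\<lambda>x. of_real (liouville_log_sum (exp x)) * exp (- (s * of_real x)))"
    and "(\<integral>x. of_real (liouville_log_sum (exp x)) * exp (- (s * of_real x)) \<partial>lborel) =
      liouville_series (1 + s) / s"
proof -
  define T where "T n x = of_int (liouville n) / of_nat n *
      (indicator {ln (real n)<..} x *\<^sub>R exp (- (s * of_real x)))" for n :: nat and x :: real
  have sums: "(\<lambda>n. T n x) sums (of_real (liouville_log_sum (exp x)) * exp (- (s * of_real x)))" for x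
    unfolding T_def by (rule liouville_log_sum_exp_sums[OF s])
  have T_int: "integrable lborel (T n)" for n
    unfolding T_def[abs_def] using exp_integral_to_infinity(1)[OF s, of "ln (real n)"]
    by (intro integrable_mult_right) (simp add: set_integrable_def)
  have T_norm: "(\<integral>x. norm (T n x) \<partial>lborel) = real n powr (- (1 + Re s)) / Re s" for n
  proof (cases "n = 0")
    case False
    have "(\<integral>x. norm (T n x) \<partial>lborel) = (\<integral>x. 1 / real n * (indicator {ln (real n)<..} x *\<^sub>R norm (exp (- (s * of_real x)))) \<partial>lborel)"
      by (intro Bochner_Integration.integral_cong) (auto simp: T_def norm_mult norm_divide)
    also have "\<dots> = 1 / real n * (LINT x:{ln (real n)<..}|lborel. norm (exp (- (s * of_real x))))"
      unfolding set_lebesgue_integral_def by (rule integral_mult_right_zero)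
    also have "\<dots> = 1 / real n * (exp (- (Re s * ln (real n))) / Re s)"
      by (simp only: exp_integral_to_infinity(3)[OF s])
    also have "exp (- (Re s * ln (real n))) = real n powr (- Re s)" using False by (simp add: powr_def)
    also have "1 / real n * (real n powr (- Re s) / Re s) = real n powr (- 1 + - Re s) / Re s"
      unfolding powr_add using False by (simp add: powr_minus_divide)
    finally show ?thesis by simp
  qed (simp add: T_def)
  have T_val: "(\<integral>x. T n x \<partial>lborel) = of_int (liouville n) * of_nat n powr (- (1 + s)) / s" for n
  proof (cases "n = 0")
    case False
    have "(\<integral>x. T n x \<partial>lborel) = of_int (liouville n) / of_nat n * (LINT x:{ln (real n)<..}|lborel. exp (- (s * of_real x)))"
      unfolding set_lebesgue_integral_def T_def by (rule integral_mult_right_zero)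
    also have "\<dots> = of_int (liouville n) / of_nat n * (of_nat n powr (-s) / s)"
      using False by (simp only: exp_integral_to_infinity(2)[OF s] exp_mult_ln_nat)
    also have "\<dots> = of_int (liouville n) * of_nat n powr (-1 + -s) / s"
      unfolding powr_add using False by (simp add: powr_minus_divide)
    finally show ?thesis by simp
  qed (simp add: T_def)
  have AE: "AE x in lborel. summable (\<lambda>n. norm (T n x))"
  proof (intro AE_I2)
    fix x
    show "summable (\<lambda>n. norm (T n x))"
    proof (rule summable_finite[of "posnats_below (exp x)"])
      fix n assume n: "n \<notin> posnats_below (exp x)"
      show "norm (T n x) = 0"
      proof (cases "n = 0")
        case False
        with n have "exp x \<le> real n" by (auto simp: posnats_below_def)
        hence "x \<le> ln (real n)" using False by (subst ln_ge_iff) auto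
        thus ?thesis by (simp add: T_def)
      qed (simp add: T_def)
    qed simp
  qed
  have sm: "summable (\<lambda>n. \<integral>x. norm (T n x) \<partial>lborel)"
    unfolding T_norm using s by (intro summable_divide summable_nat_powr_real)
  have eq: "(\<Sum>n. T n x) = of_real (liouville_log_sum (exp x)) * exp (- (s * of_real x))" for x
    using sums by (rule sums_unique[symmetric])
  show "integrable lborel (\<lambda>x. of_real (liouville_log_sum (exp x)) * exp (- (s * of_real x)))"
    using integrable_suminf[OF T_int AE sm] by (simp only: eq)
  have "(\<lambda>n. of_int (liouville n) * of_nat n powr (- (1 + s)) / s) sums
      (\<integral>x. of_real (liouville_log_sum (exp x)) * exp (- (s * of_real x)) \<partial>lborel)"
    using sums_integral[OF T_int AE sm] by (simp only: eq T_val)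
  moreover have "(\<lambda>n. of_int (liouville n) * of_nat n powr (- (1 + s)) / s) sums (liouville_series (1 + s) / s)"
  proof -
    have "Re (1 + s) > 1" using s by simp
    from summable_completely_multiplicative.summable_norm[OF liouville_powr_summable_completely_multiplicative[OF this]]
    have "summable (\<lambda>n. of_int (liouville n) * (of_nat n :: complex) powr (- (1 + s)))"
      by (rule summable_norm_cancel)
    thus ?thesis unfolding liouville_series_def by (intro sums_divide summable_sums)
  qed
  ultimately show "(\<integral>x. of_real (liouville_log_sum (exp x)) * exp (- (s * of_real x)) \<partial>lborel) =
      liouville_series (1 + s) / s"
    by (rule sums_unique2)
qed

text \<open>Jumps occur only at the countably many points ln n; between consecutive ones the
  function is locally constant.\<close>

lemma AE_isCont_liouville_log_sum_exp: "AE x in lborel. isCont (\<lambda>x. liouville_log_sum (exp x)) x"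
proof -
  have "AE x in lborel. x \<notin> range (\<lambda>n. ln (real n))"
    by (intro AE_not_in countable_imp_null_set_lborel) auto
  thus ?thesis
  proof eventually_elim
    case (elim x)
    define m where "m = nat \<lfloor>exp x\<rfloor>"
    have m: "real m \<le> exp x" "exp x < real m + 1" by (simp_all add: m_def floor_le_iff)
    have "real m \<noteq> exp x" using elim by (metis ln_exp rangeI)
    hence m': "real m < exp x" using m by simp
    have open_set: "open (exp -` {real m<..<real m + 1})"
      by (intro open_vimage continuous_intros)
    have "eventually (\<lambda>y. y \<in> exp -` {real m<..<real m + 1}) (nhds x)"
      using open_set m m' by (intro eventually_nhds_in_open) auto
    hence "eventually (\<lambda>y. liouville_log_sum (exp y) = liouville_log_sum (exp x)) (nhds x)"
    proof eventually_elim
      case (elim y)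
      have "posnats_below v = {1..m}" if "real m < v" "v < real m + 1" for v
        using that by (auto simp: posnats_below_def)
      hence "posnats_below (exp y) = posnats_below (exp x)" using elim m m' by auto
      thus ?case by (simp add: liouville_log_sum_def)
    qed
    thus ?case by (subst isCont_cong[where g = "\<lambda>_. liouville_log_sum (exp x)"]) auto
  qed
qed

lemma integrable_decay: "integrable lborel (\<lambda>t::real. (1 + \<bar>t\<bar>) powr (- 3 / 2))"
proof -
  define g where "g t = indicator {0<..} t *\<^sub>R (1 + t) powr (- 3 / 2)" for t :: real
  have "set_integrable lborel (einterval (ereal 0) \<infinity>) (\<lambda>t. (1 + t) powr (- 3 / 2))"
  proof (rule interval_integral_FTC_nonneg(1))
    show "DERIV (\<lambda>t. -2 * (1 + t) powr (- 1 / 2)) t :> (1 + t) powr (- 3 / 2)" if "ereal 0 < ereal t" for t :: real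
      using that by (auto intro!: derivative_eq_intros)
    show "((((\<lambda>t. -2 * (1 + t) powr (- 1 / 2))) \<circ> real_of_ereal) \<longlongrightarrow> -2) (at_right (ereal 0))"
      unfolding ereal_tendsto_simps1 by real_asymp
    show "((((\<lambda>t. -2 * (1 + t) powr (- 1 / 2))) \<circ> real_of_ereal) \<longlongrightarrow> 0) (at_left \<infinity>)"
      unfolding ereal_tendsto_simps1 by real_asymp
    show "isCont (\<lambda>t. (1 + t) powr (- 3 / 2)) t" if "ereal 0 < ereal t" for t :: real
      using that by (intro continuous_intros) auto
  qed auto
  hence g: "integrable lborel g" by (simp add: set_integrable_def g_def[abs_def])
  have "integrable lborel (\<lambda>t. g t + g (0 + (- 1) * t))"
    using g by (intro Bochner_Integration.integrable_add lborel_integrable_real_affine) auto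
  thus ?thesis
  proof (rule Bochner_Integration.integrable_cong_AE_imp)
    have "AE t in lborel. t \<noteq> (0::real)" by (rule AE_lborel_singleton)
    thus "AE t in lborel. g t + g (0 + (- 1) * t) = (1 + \<bar>t\<bar>) powr (- 3 / 2)"
      by eventually_elim (auto simp: g_def indicator_def)
  qed measurable
qed

text \<open>Plancherel is applied to the damped function M(e^x) exp (- \<sigma> x), with a bound D
  independent of \<sigma>. On [0, X] the damping costs at most exp (2 \<sigma> X), which tends to 1
  as \<sigma> tends to 0 with X fixed.\<close>

lemma sq_integral_bounded: "\<exists>C. \<forall>X\<ge>0. sq_integral X \<le> C"
proof -
  obtain C where C: "C > 0" "\<And>\<eta> t. 0 < \<eta> \<Longrightarrow> \<eta> \<le> 1 / 16 \<Longrightarrow>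
     (norm (liouville_series (Complex (1 + \<eta>) t) / Complex \<eta> t))\<^sup>2 \<le> C * (1 + \<bar>t\<bar>) powr (- 3 / 2)"
    using liouville_series_quotient_bound by blast
  define D where "D = (\<integral>t. C * (1 + \<bar>t\<bar>) powr (- 3 / 2) \<partial>lborel) / (2 * pi)"
  have main: "sq_integral X \<le> exp (2 * \<sigma> * X) * D" if X: "X \<ge> 0" and \<sigma>: "0 < \<sigma>" "\<sigma> \<le> 1 / 16" for X \<sigma>
  proof -
    define f where "f x = liouville_log_sum (exp x) * exp (- (\<sigma> * x))" for x
    \<comment> \<open>The Fourier kernel has the sign opposite to the Laplace kernel, so frequency t
      corresponds to s = \<sigma> - it; the bound is even in t.\<close>
    have Laplace: "of_real (f x) * iexp (x * t) = of_real (liouville_log_sum (exp x)) * exp (- (Complex \<sigma> (-t) * of_real x))" for x t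
    proof -
      have "- (Complex \<sigma> (-t) * of_real x) = of_real (- (\<sigma> * x)) + \<i> * of_real (x * t)"
        by (simp add: complex_eq_iff)
      thus ?thesis by (simp only: exp_add exp_of_real f_def of_real_mult mult.assoc)
    qed
    have "integrable lborel (\<lambda>x. of_real (f x) * iexp (x * 0))"
      unfolding Laplace using \<sigma> by (intro liouville_log_sum_Laplace) auto
    hence f: "integrable lborel f" by (simp add: complex_of_real_integrable_eq)
    have f2: "(\<integral>x. (f x)\<^sup>2 \<partial>lborel) \<le> D"
      unfolding D_def
    proof (rule square_integral_le_Fourier[OF f])
      show "\<bar>f x\<bar> \<le> (\<Sum>n. real n powr (- (1 + \<sigma>)))" for x
        unfolding f_def by (rule abs_liouville_log_sum_exp_le[OF \<sigma>(1)])
      show "AE x in lborel. isCont f x"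
        using AE_isCont_liouville_log_sum_exp
        by eventually_elim (auto simp: f_def[abs_def] intro!: continuous_intros)
      show "integrable lborel (\<lambda>t::real. C * (1 + \<bar>t\<bar>) powr (- 3 / 2))"
        by (intro integrable_mult_right integrable_decay)
      fix t
      have "(\<integral>x. of_real (f x) * iexp (x * t) \<partial>lborel) = liouville_series (1 + Complex \<sigma> (-t)) / Complex \<sigma> (-t)"
        unfolding Laplace using \<sigma> by (intro liouville_log_sum_Laplace) auto
      also have "1 + Complex \<sigma> (-t) = Complex (1 + \<sigma>) (-t)" by (simp add: complex_eq_iff)
      finally show "(norm (\<integral>x. of_real (f x) * iexp (x * t) \<partial>lborel))\<^sup>2 \<le> C * (1 + \<bar>t\<bar>) powr (- 3 / 2)"
        using C(2)[OF \<sigma>, of "-t"] by simp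
    qed
    define B where "B = (\<Sum>n. real n powr (- (1 + \<sigma>)))"
    have fB: "\<bar>f x\<bar> \<le> B" for x
      unfolding f_def B_def by (rule abs_liouville_log_sum_exp_le[OF \<sigma>(1)])
    have f2_int: "integrable lborel (\<lambda>x. (f x)\<^sup>2)"
    proof (rule Bochner_Integration.integrable_bound)
      show "integrable lborel (\<lambda>x. B * f x)" using f by (rule integrable_mult_right)
      show "(\<lambda>x. (f x)\<^sup>2) \<in> borel_measurable lborel"
        using borel_measurable_integrable[OF f] by measurable
      show "AE x in lborel. norm ((f x)\<^sup>2) \<le> norm (B * f x)"
      proof (intro AE_I2)
        fix x
        have "\<bar>f x\<bar> * \<bar>f x\<bar> \<le> \<bar>B\<bar> * \<bar>f x\<bar>" using fB[of x] by (intro mult_right_mono) auto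
        thus "norm ((f x)\<^sup>2) \<le> norm (B * f x)" by (simp add: power2_eq_square abs_mult)
      qed
    qed
    have "set_integrable lborel {0..X} (\<lambda>x. (liouville_log_sum (exp x))\<^sup>2)"
      by (rule liouville_log_sum_sq_set_integrable)
    note HK = set_borel_integral_eq_integral[OF this]
    have "sq_integral X = (LINT x:{0..X}|lborel. (liouville_log_sum (exp x))\<^sup>2)"
      using HK(2) by (simp add: sq_integral_def)
    also have "\<dots> \<le> (\<integral>x. exp (2 * \<sigma> * X) * (f x)\<^sup>2 \<partial>lborel)"
      unfolding set_lebesgue_integral_def
    proof (rule integral_mono)
      show "integrable lborel (\<lambda>x. indicator {0..X} x *\<^sub>R (liouville_log_sum (exp x))\<^sup>2)"
        using liouville_log_sum_sq_set_integrable[of 0 X] by (simp add: set_integrable_def)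
      show "integrable lborel (\<lambda>x. exp (2 * \<sigma> * X) * (f x)\<^sup>2)"
        by (intro integrable_mult_right f2_int)
      fix x
      have "exp (2 * \<sigma> * X) * (f x)\<^sup>2 = exp (2 * \<sigma> * (X - x)) * (liouville_log_sum (exp x))\<^sup>2"
      proof -
        have "exp (2 * \<sigma> * (X - x)) = exp (2 * \<sigma> * X) * (exp (- (\<sigma> * x)))\<^sup>2"
          by (simp add: power2_eq_square algebra_simps flip: exp_add)
        thus ?thesis by (simp add: f_def power_mult_distrib)
      qed
      moreover have "1 * (liouville_log_sum (exp x))\<^sup>2 \<le> exp (2 * \<sigma> * (X - x)) * (liouville_log_sum (exp x))\<^sup>2"
        if "x \<in> {0..X}"
        using that \<sigma> by (intro mult_right_mono) auto
      ultimately show "indicator {0..X} x *\<^sub>R (liouville_log_sum (exp x))\<^sup>2 \<le> exp (2 * \<sigma> * X) * (f x)\<^sup>2"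
        by (auto simp: indicator_def)
    qed
    also have "\<dots> = exp (2 * \<sigma> * X) * (\<integral>x. (f x)\<^sup>2 \<partial>lborel)" by (rule integral_mult_right_zero)
    also have "\<dots> \<le> exp (2 * \<sigma> * X) * D" using f2 by (intro mult_left_mono) auto
    finally show ?thesis .
  qed
  have "sq_integral X \<le> D" if X: "X \<ge> 0" for X
  proof (rule tendsto_lowerbound)
    have "((\<lambda>\<sigma>. exp (2 * \<sigma> * X) * D) \<longlongrightarrow> exp (2 * 0 * X) * D) (at_right 0)"
      by (intro tendsto_intros)
    thus "((\<lambda>\<sigma>. exp (2 * \<sigma> * X) * D) \<longlongrightarrow> D) (at_right 0)" by simp
    show "eventually (\<lambda>\<sigma>. sq_integral X \<le> exp (2 * \<sigma> * X) * D) (at_right 0)"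
      unfolding eventually_at_right_field
      using main[OF X] by (intro exI[of _ "1 / 16"]) auto
  qed simp
  thus ?thesis by blast
qed

theorem theorem1:
  fixes a :: "real \<Rightarrow> nat \<Rightarrow> complex" and l :: "real \<Rightarrow> complex"
  assumes "Limsup at_top
      (\<lambda>x::real. ereal ((1 / x) * (\<Sum>n | 1 \<le> n \<and> real n < x. (cmod (a x n))\<^sup>2))) < \<infinity>"
    and "\<And>z::real. z > 0 \<Longrightarrow>
      ((\<lambda>x::real. complex_of_real (1 / x) *
          (\<Sum>n | 1 \<le> n \<and> real n < x. a x n * of_int (liouville_divisor_sum n z)))
        \<longlongrightarrow> l z) at_top"
  shows "(l \<longlongrightarrow> 0) at_top"
proof -
  obtain A where "Limsup at_top
      (\<lambda>x::real. ereal ((1 / x) * (\<Sum>n | 1 \<le> n \<and> real n < x. (cmod (a x n))\<^sup>2))) < ereal A"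
    using ereal_dense2[OF assms(1)] by blast
  from Limsup_lessD[OF this]
  have bdd: "\<forall>\<^sub>F x in at_top. (1 / x) * (\<Sum>n\<in>posnats_below x. (cmod (a x n))\<^sup>2) \<le> A"
    by (rule eventually_mono) (simp add: posnats_below_def)
  obtain C where C: "\<And>X. 0 \<le> X \<Longrightarrow> sq_integral X \<le> C"
    using sq_integral_bounded by blast
  show ?thesis
  proof (rule limits_tendsto_0[OF bdd])
    show "liouville_gram z z \<le> 4 * C + 52" for z
      using C by (rule liouville_gram_diag_le)
    show "((\<lambda>z. liouville_gram z w) \<longlongrightarrow> 0) at_top" for w
      using liouville_log_sum_tendsto_0[OF C] by (rule liouville_gram_tendsto_0)
  qed (use assms(2) in \<open>simp add: posnats_below_def\<close>)
qed

end
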